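(* Let $P=P_n\subseteq \mathbb{Z}^n\times\mathbb{Z}$ be a data stream problem. Suppose there is a deterministic data stream algorithm solving $P$ on turnstile streams of all lengths, which uses $S$ space during updates and recovery and $s$ space between updates. Then there is a linear sketching algorithm for $P$ that uses $O(S+s\log n)$ space during updates and recovery, and that stores an $s$ space sketch.
   Context: A turnstile data stream $\sigma$ of length $L$ is a sequence of updates $\sigma_1,\dots,\sigma_L\in[n]\times\mathbb{Z}$. Its state at time $t$ is $x^{(t)}=\sum_{(i,\Delta)\in\{\sigma_1,\dots,\sigma_t\}}\Delta\, e_i$ (each update counted once), and its final state (frequency vector) is $\operatorname{freq}\sigma=x^{(L)}$. A data stream problem is a relation $P_n\subseteq\mathbb{Z}^n\times\mathbb{Z}$; $(x,z)\in P_n$ means that $z$ is a valid output on input $x$ (an input may have several valid outputs). A data stream algorithm $\mathcal{A}$ consists of a (distribution over) initial state(s), a transition function taking a state and an update to a new state, and a post-processing function $g$ taking the final state $\mathcal{A}(\sigma)$ to an output $g(\mathcal{A}(\sigma))$. A deterministic algorithm has a fixed initial state and deterministic transition and post-processing functions; it solves $P_n$ on a set of streams if $(\operatorname{freq}\sigma,g(\mathcal{A}(\sigma)))\in P_n$ for every stream $\sigma$ in the set. It uses $s$ space between updates if all states reached can be represented in $s$ bits (so there are at most $2^s$ states); it uses $S\ge s$ space during updates and recovery if the transition function and the post-processing function can be computed using $S$ bits of space. A linear sketch is a $\mathbb{Z}$-module homomorphism $\phi$ from $\mathbb{Z}^n$ to a $\mathbb{Z}$-module $M$. A linear sketching algorithm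 is a data stream algorithm whose state after stream $\sigma$ is $\phi(\operatorname{freq}\sigma)$ for a linear sketch $\phi$, along with the randomness used to choose $\phi$. "Stores an $s$ space sketch" means that the sketch $\phi(\operatorname{freq}\sigma)$ is stored in $s$ bits. The new algorithm is explicit: it has access to the original algorithm (transition and post-processing functions) but to no other advice string, and the space during updates and recovery includes the space needed to compute $\phi$. *)

theory Defs
  imports Complex_Main "Jordan_Normal_Form.VS_Connect"
begin

section \<open>Turnstile streams, data stream problems and data stream algorithms\<close>

text \<open>Coordinates are numbered from 0, so the index set is \<open>{..<n}\<close>; vectors in \<open>Z^n\<close> are
  the elements of \<^term>\<open>carrier_vec n :: int vec set\<close>.\<close>

type_synonym update = "nat \<times> int"

definition streams :: "nat \<Rightarrow> update list set" where
  "streams n = lists ({..<n} \<times> UNIV)"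

definition freq :: "nat \<Rightarrow> update list \<Rightarrow> int vec" where
  "freq n \<sigma> = foldr (\<lambda>(i, \<Delta>) x. \<Delta> \<cdot>\<^sub>v unit_vec n i + x) \<sigma> (0\<^sub>v n)"

definition data_stream_problem :: "nat \<Rightarrow> (int vec \<times> int) set \<Rightarrow> bool" where
  "data_stream_problem n P \<longleftrightarrow> P \<subseteq> carrier_vec n \<times> UNIV"

text \<open>A deterministic algorithm. A state is identified with the number whose binary
  representation is stored, so that an \<open>s\<close>-bit state is a number below \<open>2^s\<close>.\<close>

record stream_alg =
  initial :: nat
  transition :: "nat \<Rightarrow> update \<Rightarrow> nat"
  postproc :: "nat \<Rightarrow> int"

definition final_state :: "stream_alg \<Rightarrow> update list \<Rightarrow> nat" where
  "final_state A \<sigma> = foldl (transition A) (initial A) \<sigma>"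

definition solves :: "nat \<Rightarrow> stream_alg \<Rightarrow> (int vec \<times> int) set \<Rightarrow> bool" where
  "solves n A P \<longleftrightarrow> (\<forall>\<sigma>\<in>streams n. (freq n \<sigma>, postproc A (final_state A \<sigma>)) \<in> P)"

definition space_between_updates :: "nat \<Rightarrow> stream_alg \<Rightarrow> nat \<Rightarrow> bool" where
  "space_between_updates n A s \<longleftrightarrow> (\<forall>\<sigma>\<in>streams n. final_state A \<sigma> < 2 ^ s)"

text \<open>The elements of the module \<open>M\<close> are numbers because they are the stored states
  themselves; \<^const>\<open>space_between_updates\<close> then bounds the size of the stored sketch.\<close>

definition linear_sketching :: "nat \<Rightarrow> stream_alg \<Rightarrow> bool" where
  "linear_sketching n B \<longleftrightarrow>
     (\<exists>(M :: (int, nat) module) \<phi>.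
        mod_hom (class_ring :: int ring) (module_vec TYPE(int) n) M \<phi> \<and>
        (\<forall>\<sigma>\<in>streams n. final_state B \<sigma> = \<phi> (freq n \<sigma>)))"


section \<open>Space-bounded computation\<close>

text \<open>
  The machine model is an offline machine: the inputs are on read-only tapes with two-way heads,
  which (as usual) are not charged for, and the memory consists of finitely many integer registers, charged by the length
  of their binary representation. Programs are lists of procedures that may call each other
  recursively, each call working on a fresh frame of registers; the memory of all
  active frames is added up. In addition a program may query external procedures
  (\<open>Query\<close>), which is how a program gets access to another algorithm; a query is charged
  with the space that the external procedure needs.

  All operations on registers are three-address operations, so that every
  intermediate value is charged for, and they are computable in space linear in the size of
  operands and result.
\<close>

datatype atom = Num int | Reg nat | Sym nat

datatype arith = AddOp | SubOp | MulOp | DivOp | ModOp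

datatype test = Less atom atom | Eq atom atom | Neg test | Conj test test

datatype com =
    Skip
  | Assign nat arith atom atom
  | Load nat nat                  \<comment> \<open>copy an input into a register\<close>
  | MoveLeft nat
  | MoveRight nat
  | Seq com com
  | Cond test com com
  | While test com
  | Call nat nat "atom list"      \<comment> \<open>result register, procedure, arguments\<close>
  | Query nat nat "atom list"     \<comment> \<open>the same for an external procedure\<close>

text \<open>A tape holds an optional minus sign and the binary digits, most significant first. Its
  symbols are the digits 0 and 1, the sign 2, and 3 for the blank on either side.\<close>

fun binary :: "nat \<Rightarrow> int list" where
  "binary k = (if k = 0 then [] else binary (k div 2) @ [int (k mod 2)])"

declare binary.simps [simp del]

definition tape :: "int \<Rightarrow> int list" where
  "tape x = (if x < 0 then [2] else []) @ binary (nat \<bar>x\<bar>)"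

definition tape_at :: "int \<Rightarrow> nat \<Rightarrow> int" where
  "tape_at x h = (if 0 < h \<and> h \<le> length (tape x) then tape x ! (h - 1) else 3)"

text \<open>Registers and head positions of a frame. Heads start on the blank left of the input.\<close>

type_synonym frame = "(nat \<Rightarrow> int) \<times> (nat \<Rightarrow> nat)"

definition fresh :: frame where
  "fresh = (\<lambda>_. 0, \<lambda>_. 0)"

fun atom_val :: "int list \<Rightarrow> frame \<Rightarrow> atom \<Rightarrow> int" where
  "atom_val xs (r, h) (Num k) = k"
| "atom_val xs (r, h) (Reg i) = r i"
| "atom_val xs (r, h) (Sym j) = (if j < length xs then tape_at (xs ! j) (h j) else 3)"

fun arith_val :: "arith \<Rightarrow> int \<Rightarrow> int \<Rightarrow> int" where
  "arith_val AddOp a b = a + b"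
| "arith_val SubOp a b = a - b"
| "arith_val MulOp a b = a * b"
| "arith_val DivOp a b = a div b"
| "arith_val ModOp a b = a mod b"

fun test_val :: "int list \<Rightarrow> frame \<Rightarrow> test \<Rightarrow> bool" where
  "test_val xs f (Less a b) = (atom_val xs f a < atom_val xs f b)"
| "test_val xs f (Eq a b) = (atom_val xs f a = atom_val xs f b)"
| "test_val xs f (Neg t) = (\<not> test_val xs f t)"
| "test_val xs f (Conj t u) = (test_val xs f t \<and> test_val xs f u)"

fun atom_regs :: "atom \<Rightarrow> nat set" where
  "atom_regs (Reg i) = {i}"
| "atom_regs _ = {}"

fun test_regs :: "test \<Rightarrow> nat set" where
  "test_regs (Less a b) = atom_regs a \<union> atom_regs b"
| "test_regs (Eq a b) = atom_regs a \<union> atom_regs b"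
| "test_regs (Neg t) = test_regs t"
| "test_regs (Conj t u) = test_regs t \<union> test_regs u"

fun com_regs :: "com \<Rightarrow> nat set" where
  "com_regs Skip = {}"
| "com_regs (Assign r _ a b) = {r} \<union> atom_regs a \<union> atom_regs b"
| "com_regs (Load r _) = {r}"
| "com_regs (MoveLeft _) = {}"
| "com_regs (MoveRight _) = {}"
| "com_regs (Seq c d) = com_regs c \<union> com_regs d"
| "com_regs (Cond t c d) = test_regs t \<union> com_regs c \<union> com_regs d"
| "com_regs (While t c) = test_regs t \<union> com_regs c"
| "com_regs (Call r _ as) = {r} \<union> \<Union> (atom_regs ` set as)"
| "com_regs (Query r _ as) = {r} \<union> \<Union> (atom_regs ` set as)"

text \<open>Register 0 holds the result of a procedure and is always part of its frame.\<close>

definition frame_regs :: "com \<Rightarrow> nat set" where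
  "frame_regs c = insert 0 (com_regs c)"

text \<open>One extra cell per register, so that even a register holding 0 is not free.\<close>

definition mem :: "nat set \<Rightarrow> (nat \<Rightarrow> int) \<Rightarrow> nat" where
  "mem V r = (\<Sum>i\<in>V. Suc (length (tape (r i))))"

text \<open>\<open>\<Omega> p xs m y\<close>: external procedure \<open>p\<close> on input \<open>xs\<close> returns \<open>y\<close> using \<open>m\<close> bits.\<close>

type_synonym externals = "nat \<Rightarrow> int list \<Rightarrow> nat \<Rightarrow> int \<Rightarrow> bool"

text \<open>\<open>exec \<Omega> \<Gamma> V xs m c f f'\<close>: with external procedures \<open>\<Omega>\<close> and procedures \<open>\<Gamma>\<close>, in a frame
  with registers \<open>V\<close> and inputs \<open>xs\<close>, command \<open>c\<close> started in \<open>f\<close> terminates in \<open>f'\<close>, and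
  after every step, the current frame and the frames of the calls it is waiting for take at
  most \<open>m\<close> bits.\<close>

inductive exec :: "externals \<Rightarrow> com list \<Rightarrow> nat set \<Rightarrow> int list \<Rightarrow> nat \<Rightarrow> com \<Rightarrow> frame \<Rightarrow> frame \<Rightarrow> bool"
  for \<Omega> :: externals and \<Gamma> :: "com list"
where
  Skip: "exec \<Omega> \<Gamma> V xs m Skip f f"
| Assign: "\<lbrakk> f = (r, h);
     r' = r(i := arith_val op (atom_val xs f a) (atom_val xs f b)); mem V r' \<le> m \<rbrakk>
   \<Longrightarrow> exec \<Omega> \<Gamma> V xs m (Assign i op a b) f (r', h)"
| Load: "\<lbrakk> j < length xs; r' = r(i := xs ! j); mem V r' \<le> m \<rbrakk>
   \<Longrightarrow> exec \<Omega> \<Gamma> V xs m (Load i j) (r, h) (r', h)"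
| MoveLeft: "exec \<Omega> \<Gamma> V xs m (MoveLeft j) (r, h) (r, h(j := h j - 1))"
| MoveRight: "j < length xs
   \<Longrightarrow> exec \<Omega> \<Gamma> V xs m (MoveRight j) (r, h)
         (r, h(j := min (Suc (h j)) (Suc (length (tape (xs ! j))))))"
| Seq: "\<lbrakk> exec \<Omega> \<Gamma> V xs m c f f'; exec \<Omega> \<Gamma> V xs m d f' f'' \<rbrakk>
   \<Longrightarrow> exec \<Omega> \<Gamma> V xs m (Seq c d) f f''"
| CondTrue: "\<lbrakk> test_val xs f t; exec \<Omega> \<Gamma> V xs m c f f' \<rbrakk>
   \<Longrightarrow> exec \<Omega> \<Gamma> V xs m (Cond t c d) f f'"
| CondFalse: "\<lbrakk> \<not> test_val xs f t; exec \<Omega> \<Gamma> V xs m d f f' \<rbrakk>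
   \<Longrightarrow> exec \<Omega> \<Gamma> V xs m (Cond t c d) f f'"
| WhileTrue: "\<lbrakk> test_val xs f t; exec \<Omega> \<Gamma> V xs m c f f'; exec \<Omega> \<Gamma> V xs m (While t c) f' f'' \<rbrakk>
   \<Longrightarrow> exec \<Omega> \<Gamma> V xs m (While t c) f f''"
| WhileFalse: "\<not> test_val xs f t
   \<Longrightarrow> exec \<Omega> \<Gamma> V xs m (While t c) f f"
| Call: "\<lbrakk> f = (r, h); p < length \<Gamma>;
     mem V r + m' \<le> m; mem (frame_regs (\<Gamma> ! p)) (fst fresh) \<le> m';
     exec \<Omega> \<Gamma> (frame_regs (\<Gamma> ! p)) (map (atom_val xs f) as) m' (\<Gamma> ! p) fresh (r1, h1);
     r' = r(i := r1 0); mem V r' \<le> m \<rbrakk>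
   \<Longrightarrow> exec \<Omega> \<Gamma> V xs m (Call i p as) f (r', h)"
| Query: "\<lbrakk> f = (r, h); mem V r + m' \<le> m; \<Omega> p (map (atom_val xs f) as) m' y;
     r' = r(i := y); mem V r' \<le> m \<rbrakk>
   \<Longrightarrow> exec \<Omega> \<Gamma> V xs m (Query i p as) f (r', h)"

definition computes :: "externals \<Rightarrow> com list \<Rightarrow> nat \<Rightarrow> int list \<Rightarrow> nat \<Rightarrow> int \<Rightarrow> bool" where
  "computes \<Omega> \<Gamma> p xs m y \<longleftrightarrow>
     p < length \<Gamma> \<and> mem (frame_regs (\<Gamma> ! p)) (fst fresh) \<le> m \<and>
     (\<exists>r h. exec \<Omega> \<Gamma> (frame_regs (\<Gamma> ! p)) xs m (\<Gamma> ! p) fresh (r, h) \<and> r 0 = y)"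

definition no_externals :: externals where
  "no_externals p xs m y \<longleftrightarrow> False"

text \<open>A program implements a data stream algorithm by its procedures 0 (transition function)
  and 1 (post-processing function). Only reachable states matter. The list \<open>ps\<close>
  consists of parameters that are available as read-only inputs besides state and update.\<close>

definition implements_in_space ::
  "externals \<Rightarrow> com list \<Rightarrow> int list \<Rightarrow> nat \<Rightarrow> stream_alg \<Rightarrow> nat \<Rightarrow> bool" where
  "implements_in_space \<Omega> \<Gamma> ps n A S \<longleftrightarrow>
     (\<forall>\<sigma>\<in>streams n. let q = final_state A \<sigma> in
        (\<forall>i<n. \<forall>\<Delta>. computes \<Omega> \<Gamma> 0 (ps @ [int q, int i, \<Delta>]) S (int (transition A q (i, \<Delta>)))) \<and>
        computes \<Omega> \<Gamma> 1 (ps @ [int q]) S (postproc A q))"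

text \<open>Access to an algorithm that is given by a program: its transition function and its
  post-processing function, and nothing else, can be run as subroutines.\<close>

definition access :: "com list \<Rightarrow> externals" where
  "access \<Gamma> p xs m y \<longleftrightarrow> p < 2 \<and> computes no_externals \<Gamma> p xs m y"

end

theory Submission
  imports Defs
begin

text \<open>
  Let \<open>W\<close> be a fixed walk that runs, for every code \<open>c < M\<close> of a sparse vector \<open>dec c\<close>, through a
  stream with frequency vector \<open>dec c\<close> and back through its negative. Iterating \<open>W\<close> from the initial
  state \<open>2^s\<close> times leads to a state \<open>start\<close> on a cycle of \<open>W\<close>. If the walk from \<open>start\<close> is in the same
  state after the excursions to \<open>dec c1\<close> and to \<open>dec c2\<close>, then \<open>start\<close> can be reached from itself by a stream with
  frequency vector \<open>dec c1 - dec c2\<close>, and also by one with the negative of it.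

  For \<open>i < n\<close> let \<open>d i\<close> be the least leading entry of such a collision vector \<open>\<rho> i\<close> whose last nonzero
  coordinate is \<open>i\<close> and whose earlier entries are smaller than \<open>d j\<close> in absolute value. By minimality the vectors
  of the box \<open>\<Prod>j. {0..<d j}\<close> lead to distinct states, so by the pigeonhole principle \<open>d i\<close> exists and
  \<open>\<Prod>j. d j \<le> 2^s\<close>. The sketch is the quotient of \<open>Z^n\<close> by the lattice spanned by the \<open>\<rho> i\<close>: every vector
  has a unique representative \<open>v\<close> in the box, stored as a mixed radix number, and the state after \<open>v\<close> from \<open>start\<close>
  is reached by some stream of every frequency vector in the class of \<open>v\<close>, so its output is valid for the whole class.

  Neither the lattice nor \<open>W\<close> is ever stored. At most \<open>s\<close> of the \<open>d j\<close> exceed 1, so the vector of the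
  \<open>d j - 1\<close> has a code of \<open>O(s + s log n)\<close> bits, and each \<open>\<rho> i\<close> is found by exhaustive search whenever it is needed.
  Addition in the quotient keeps the carries inside the coordinates and resolves the lowest one first,
  so that no coordinate leaves \<open>{-d j..<2 * d j}\<close>.
\<close>

subsection \<open>Weakest preconditions with a uniform register bound\<close>

text \<open>Opposite updates need not undo each other on states, so two streams meeting in one state
  do not yet give a loop, and nothing can be inverted. The fixed walk supplies the missing ways
  back: once it runs on a cycle, every point of it leads to \<open>start\<close> with frequency 0.
  It is determined by \<open>n\<close>, \<open>s\<close> and the given algorithm, so it needs no
  advice, and since only space is charged it can be rerun whenever one of its states is wanted. The
  search for a relation handles two codes and a leading entry at once, whence registers of
  \<open>b\<close> bits with \<open>M ^ 4 \<le> 2 ^ b\<close>. Calls nest at most nine deep in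
  frames of at most 14 registers, so the total stays linear in \<open>b + S\<close>. For
  \<open>s = 0\<close> the budget is of order \<open>S\<close> alone and need not hold even
  \<open>n\<close>; that case is treated separately.\<close>

lemma exec_mono:
  "exec \<Omega> \<Gamma> V xs m c f f' \<Longrightarrow> m \<le> m2 \<Longrightarrow> exec \<Omega> \<Gamma> V xs m2 c f f'"
proof (induction arbitrary: m2 rule: exec.induct)
  case (Call f r h p V m' m xs as r1 h1 r' i)
  show ?case
    by (rule exec.Call[OF Call.hyps(1-2) _ Call.hyps(4-5) Call.hyps(6)]) (use Call.hyps(3,7) Call.prems in linarith)+
next
  case (Query f r h V m' m p xs as y r' i)
  show ?case
    by (rule exec.Query[where m' = m' and y = y]) (use Query in auto)
next
  case MoveLeft
  show ?case by (rule exec.MoveLeft)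
next
  case MoveRight
  then show ?case by (intro exec.MoveRight)
qed (auto intro: exec.intros)

lemma computes_mono: "computes \<Omega> \<Gamma> p xs m y \<Longrightarrow> m \<le> m2 \<Longrightarrow> computes \<Omega> \<Gamma> p xs m2 y"
  unfolding computes_def using exec_mono by fastforce

lemma exec_mem:
  "exec \<Omega> \<Gamma> V xs m c f f' \<Longrightarrow> mem V (fst f) \<le> m \<Longrightarrow> mem V (fst f') \<le> m"
  by (induction rule: exec.induct) auto

lemma finite_frame_regs: "finite (frame_regs c)"
proof -
  have a: "finite (atom_regs a)" for a by (cases a) auto
  have t: "finite (test_regs t)" for t by (induction t) (auto simp: a)
  have "finite (com_regs c)" by (induction c) (auto simp: a t)
  then show ?thesis by (simp add: frame_regs_def)
qed

lemma length_binary: "k < 2 ^ b \<Longrightarrow> length (binary k) \<le> b"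
proof (induction b arbitrary: k)
  case 0
  then show ?case by (simp add: binary.simps)
next
  case (Suc b)
  then have "length (binary (k div 2)) \<le> b" by auto
  then show ?case by (subst binary.simps) auto
qed

lemma length_tape: "\<bar>x\<bar> < 2 ^ b \<Longrightarrow> length (tape x) \<le> b + 1"
  using length_binary[of "nat \<bar>x\<bar>" b] by (auto simp: tape_def nat_less_iff)

text \<open>The 2 beyond the \<open>b\<close> digits pays for a sign and for the extra cell that
  \<open>mem\<close> charges per register.\<close>

lemma mem_le:
  assumes "finite V" "\<And>i. \<bar>r i\<bar> < 2 ^ b"
  shows "mem V r \<le> card V * (b + 2)"
proof -
  have "mem V r \<le> (\<Sum>i\<in>V. b + 2)"
    unfolding mem_def by (rule sum_mono) (use length_tape[OF assms(2)] in auto)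
  then show ?thesis by simp
qed

definition small :: "nat \<Rightarrow> int \<Rightarrow> bool" where
  "small b x \<longleftrightarrow> \<bar>x\<bar> < 2 ^ b"

type_synonym call_spec = "nat \<Rightarrow> int list \<Rightarrow> int \<Rightarrow> bool"

text \<open>Every written value must satisfy \<open>small b\<close>, so that the memory of a frame
  depends only on its number of registers. Calls are known only through \<open>C\<close> and
  \<open>E\<close>, which lets procedures be verified one by one. The loop clause asks for a measure
  because \<open>exec\<close> derives terminating runs only.\<close>

primrec wp :: "call_spec \<Rightarrow> call_spec \<Rightarrow> nat \<Rightarrow> int list \<Rightarrow> com \<Rightarrow> (frame \<Rightarrow> bool) \<Rightarrow> frame \<Rightarrow> bool"
where
  "wp C E b xs Skip Q f = Q f"
| "wp C E b xs (Assign i op a a') Q f =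
     (small b (arith_val op (atom_val xs f a) (atom_val xs f a')) \<and>
      Q ((fst f)(i := arith_val op (atom_val xs f a) (atom_val xs f a')), snd f))"
| "wp C E b xs (Load i j) Q f =
     (j < length xs \<and> small b (xs ! j) \<and> Q ((fst f)(i := xs ! j), snd f))"
| "wp C E b xs (MoveLeft j) Q f = Q (fst f, (snd f)(j := snd f j - 1))"
| "wp C E b xs (MoveRight j) Q f =
     (j < length xs \<and> Q (fst f, (snd f)(j := min (Suc (snd f j)) (Suc (length (tape (xs ! j)))))))"
| "wp C E b xs (Seq c d) Q f = wp C E b xs c (wp C E b xs d Q) f"
| "wp C E b xs (Cond t c d) Q f =
     ((test_val xs f t \<longrightarrow> wp C E b xs c Q f) \<and> (\<not> test_val xs f t \<longrightarrow> wp C E b xs d Q f))"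
| "wp C E b xs (While t c) Q f =
     (\<exists>I (\<mu> :: frame \<Rightarrow> nat). I f \<and>
        (\<forall>f. I f \<and> test_val xs f t \<longrightarrow> wp C E b xs c (\<lambda>f'. I f' \<and> \<mu> f' < \<mu> f) f) \<and>
        (\<forall>f. I f \<and> \<not> test_val xs f t \<longrightarrow> Q f))"
| "wp C E b xs (Call i p as) Q f =
     (\<exists>y. C p (map (atom_val xs f) as) y \<and> small b y \<and> Q ((fst f)(i := y), snd f))"
| "wp C E b xs (Query i p as) Q f =
     (\<exists>y. E p (map (atom_val xs f) as) y \<and> small b y \<and> Q ((fst f)(i := y), snd f))"

lemma wp_While:
  fixes \<mu> :: "frame \<Rightarrow> nat"
  assumes "I f"
    and "\<And>r h. I (r, h) \<Longrightarrow> test_val xs (r, h) t \<Longrightarrow>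
           wp C E b xs c (\<lambda>f'. I f' \<and> \<mu> f' < \<mu> (r, h)) (r, h)"
    and "\<And>r h. I (r, h) \<Longrightarrow> \<not> test_val xs (r, h) t \<Longrightarrow> Q (r, h)"
  shows "wp C E b xs (While t c) Q f"
  unfolding wp.simps
  by (rule exI[of _ I], rule exI[of _ \<mu>]) (use assms in auto)

text \<open>A frame waits for one call at a time, so the budget \<open>m'\<close> of the callees is
  added once, however many calls the command makes.\<close>

lemma wp_sound:
  assumes C: "\<And>p as y. C p as y \<Longrightarrow> computes \<Omega> \<Gamma> p as m' y"
    and E: "\<And>p as y. E p as y \<Longrightarrow> \<Omega> p as m' y"
    and V: "finite V" "card V * (b + 2) + m' \<le> m"
    and bd: "\<And>i. \<bar>fst f i\<bar> < 2 ^ b"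
    and w: "wp C E b xs c Q f"
  shows "\<exists>f'. exec \<Omega> \<Gamma> V xs m c f f' \<and> (\<forall>i. \<bar>fst f' i\<bar> < 2 ^ b) \<and> Q f'"
proof -
  have mem: "mem V r + m' \<le> m" if "\<And>i. \<bar>r i\<bar> < 2 ^ b" for r
    using mem_le[OF V(1), of r b, OF that] V(2) by linarith
  show ?thesis using bd w
  proof (induction c arbitrary: Q f)
    case Skip
    then show ?case by (intro exI[of _ f]) (auto intro: exec.Skip)
  next
    case (Assign i op a a')
    obtain r h where f: "f = (r, h)" by force
    let ?r = "r(i := arith_val op (atom_val xs f a) (atom_val xs f a'))"
    have "mem V ?r + m' \<le> m" by (rule mem) (use Assign f in \<open>auto simp: small_def\<close>)
    then have "exec \<Omega> \<Gamma> V xs m (Assign i op a a') f (?r, h)" by (intro exec.Assign) (use f in auto)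
    then show ?case using Assign f by (intro exI[of _ "(?r, h)"]) (auto simp: small_def)
  next
    case (Load i j)
    obtain r h where f: "f = (r, h)" by force
    let ?r = "r(i := xs ! j)"
    have "mem V ?r + m' \<le> m" by (rule mem) (use Load f in \<open>auto simp: small_def\<close>)
    then have "exec \<Omega> \<Gamma> V xs m (Load i j) f (?r, h)"
      unfolding f by (intro exec.Load) (use Load in auto)
    then show ?case using Load f by (intro exI[of _ "(?r, h)"]) (auto simp: small_def)
  next
    case (MoveLeft j)
    show ?case
      by (rule exI[of _ "(fst f, (snd f)(j := snd f j - 1))"])
        (use MoveLeft exec.MoveLeft[of \<Omega> \<Gamma> V xs m j "fst f" "snd f"] in simp)
  next
    case (MoveRight j)
    show ?case
      by (rule exI[of _ "(fst f, (snd f)(j := min (Suc (snd f j)) (Suc (length (tape (xs ! j))))))"])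
        (use MoveRight exec.MoveRight[of j xs \<Omega> \<Gamma> V m "fst f" "snd f"] in simp)
  next
    case (Seq c1 c2)
    then have "wp C E b xs c1 (wp C E b xs c2 Q) f" by simp
    with Seq.IH(1)[OF Seq.prems(1)] obtain f1 where 1: "exec \<Omega> \<Gamma> V xs m c1 f f1"
      "\<And>i. \<bar>fst f1 i\<bar> < 2 ^ b" "wp C E b xs c2 Q f1" by blast
    from Seq.IH(2)[OF 1(2,3)] 1(1) show ?case using exec.Seq by blast
  next
    case (Cond t c1 c2)
    show ?case
    proof (cases "test_val xs f t")
      case True
      with Cond have "wp C E b xs c1 Q f" by simp
      from Cond.IH(1)[OF Cond.prems(1) this] True show ?thesis using exec.CondTrue by blast
    next
      case False
      with Cond have "wp C E b xs c2 Q f" by simp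
      from Cond.IH(2)[OF Cond.prems(1) this] False show ?thesis using exec.CondFalse by blast
    qed
  next
    case (While t c)
    from While.prems(2) obtain I and \<mu> :: "frame \<Rightarrow> nat" where I: "I f"
     "\<And>f. I f \<Longrightarrow> test_val xs f t \<Longrightarrow> wp C E b xs c (\<lambda>f'. I f' \<and> \<mu> f' < \<mu> f) f"
     "\<And>f. I f \<Longrightarrow> \<not> test_val xs f t \<Longrightarrow> Q f" unfolding wp.simps by blast
    from I(1) While.prems(1) show ?case
    proof (induction "\<mu> f" arbitrary: f rule: less_induct)
      case less
      show ?case
      proof (cases "test_val xs f t")
        case True
        from While.IH[OF less.prems(2) I(2)[OF less.prems(1) True]]
        obtain f1 where 1: "exec \<Omega> \<Gamma> V xs m c f f1" "\<And>i. \<bar>fst f1 i\<bar> < 2 ^ b"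
          "I f1" "\<mu> f1 < \<mu> f" by blast
        from less.hyps[OF 1(4,3,2)] 1(1) True show ?thesis using exec.WhileTrue by blast
      next
        case False
        then show ?thesis using exec.WhileFalse I(3) less.prems by blast
      qed
    qed
  next
    case (Call i p as)
    obtain r h where f: "f = (r, h)" by force
    from Call obtain y where y: "C p (map (atom_val xs f) as) y" "\<bar>y\<bar> < 2 ^ b"
      "Q ((fst f)(i := y), snd f)" by (auto simp: small_def)
    from C[OF y(1)] obtain r1 h1 where c: "p < length \<Gamma>"
      "mem (frame_regs (\<Gamma> ! p)) (fst fresh) \<le> m'"
      "exec \<Omega> \<Gamma> (frame_regs (\<Gamma> ! p)) (map (atom_val xs f) as) m' (\<Gamma> ! p) fresh (r1, h1)"
      "r1 0 = y" unfolding computes_def by blast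
    let ?r = "r(i := y)"
    have m0: "mem V r + m' \<le> m" by (rule mem) (use Call f in auto)
    have "mem V ?r + m' \<le> m" by (rule mem) (use Call f y in auto)
    then have "exec \<Omega> \<Gamma> V xs m (Call i p as) f (?r, h)"
      by (intro exec.Call[OF f c(1) m0 c(2,3)]) (use c in auto)
    then show ?case using Call y f by (intro exI[of _ "(?r, h)"]) auto
  next
    case (Query i p as)
    obtain r h where f: "f = (r, h)" by force
    from Query obtain y where y: "E p (map (atom_val xs f) as) y" "\<bar>y\<bar> < 2 ^ b"
      "Q ((fst f)(i := y), snd f)" by (auto simp: small_def)
    let ?r = "r(i := y)"
    have m0: "mem V r + m' \<le> m" by (rule mem) (use Query f in auto)
    have "mem V ?r + m' \<le> m" by (rule mem) (use Query f y in auto)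
    then have "exec \<Omega> \<Gamma> V xs m (Query i p as) f (?r, h)"
      by (intro exec.Query[where m' = m' and y = y]) (use f m0 E[OF y(1)] in auto)
    then show ?case using Query y f by (intro exI[of _ "(?r, h)"]) auto
  qed
qed

fun loads :: "nat \<Rightarrow> com" where
  "loads 0 = Skip"
| "loads (Suc k) = Seq (loads k) (Load (Suc k) k)"

definition loaded :: "nat \<Rightarrow> int list \<Rightarrow> (nat \<Rightarrow> int) \<Rightarrow> nat \<Rightarrow> int" where
  "loaded k xs r = (\<lambda>i. if 0 < i \<and> i \<le> k then xs ! (i - 1) else r i)"

lemma wp_loads:
  assumes "k \<le> length xs" "\<And>j. j < k \<Longrightarrow> small b (xs ! j)" "Q (loaded k xs r, h)"
  shows "wp C E b xs (loads k) Q (r, h)"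
  using assms
proof (induction k arbitrary: Q)
  case 0
  have "loaded 0 xs r = r" by (auto simp: loaded_def)
  with 0 show ?case by simp
next
  case (Suc k)
  have "(loaded k xs r)(Suc k := xs ! k) = loaded (Suc k) xs r"
    by (auto simp: loaded_def fun_eq_iff)
  with Suc show ?case by auto
qed

lemma com_regs_loads: "com_regs (loads k) = {0<..k}"
  by (induction k) auto

text \<open>\<open>R\<close> bounds the register names and hence the frame. Iterated along the call
  hierarchy, the rule gives a space bound linear in its depth.\<close>

lemma computesI:
  assumes p: "p < length \<Gamma>" "\<Gamma> ! p = Seq (loads k) c" "k < R" "com_regs c \<subseteq> {..<R}"
    and C: "\<And>p as y. C p as y \<Longrightarrow> computes \<Omega> \<Gamma> p as m' y"
    and E: "\<And>p as y. E p as y \<Longrightarrow> \<Omega> p as m' y"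
    and m: "R * (b + 2) + m' \<le> m"
    and xs: "k \<le> length xs" "\<And>j. j < k \<Longrightarrow> small b (xs ! j)"
    and w: "wp C E b xs c (\<lambda>f. fst f 0 = y) (loaded k xs (\<lambda>_. 0), \<lambda>_. 0)"
  shows "computes \<Omega> \<Gamma> p xs m y"
proof -
  let ?V = "frame_regs (\<Gamma> ! p)"
  have "?V \<subseteq> {..<R}"
    using p by (auto simp: frame_regs_def com_regs_loads)
  then have "card ?V \<le> R" using card_mono[of "{..<R}" ?V] by auto
  then have card: "card ?V * (b + 2) + m' \<le> m" using m
    by (meson add_le_mono1 le_trans mult_le_mono1)
  have fr: "\<bar>fst fresh i\<bar> < 2 ^ b" for i by (simp add: fresh_def)
  have "wp C E b xs (\<Gamma> ! p) (\<lambda>f. fst f 0 = y) fresh"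
    unfolding p wp.simps fresh_def by (rule wp_loads) (use xs w in simp_all)
  from wp_sound[of C \<Omega> \<Gamma> m' E ?V b m fresh, OF C E finite_frame_regs card fr this]
  obtain f' where "exec \<Omega> \<Gamma> ?V xs m (\<Gamma> ! p) fresh f'" "fst f' 0 = y" by auto
  moreover have "mem ?V (fst fresh) \<le> m"
    using mem_le[OF finite_frame_regs, of "fst fresh" b, OF fr] card by (meson add_leD1 le_trans)
  ultimately show ?thesis unfolding computes_def using p by (metis prod.collapse)
qed

subsection \<open>Sparse vectors as numbers\<close>

text \<open>A code is read in base \<open>B\<close> from the least significant digit. The digits 0 and 1 append a bit to
  the current value, 2 negates it, and \<open>3 + j\<close> assigns it to coordinate \<open>j\<close>. So a vector \<open>v\<close>
  takes \<open>O(\<Sum>j. log (\<bar>v j\<bar> + 1))\<close> digits, only one of which per nonzero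
  coordinate needs the whole alphabet.\<close>

fun getv :: "nat \<Rightarrow> nat \<Rightarrow> nat \<Rightarrow> int \<Rightarrow> int \<Rightarrow> int" where
  "getv B c j val res = (if c = 0 \<or> B < 2 then res
     else if c mod B < 2 then getv B (c div B) j (2 * val + int (c mod B)) res
     else if c mod B = 2 then getv B (c div B) j (- val) res
     else getv B (c div B) j 0 (if c mod B = 3 + j then val else res))"

declare getv.simps [simp del]

text \<open>A code works as a stack: the digit pushed last is read first. Pushing the least
  significant bit first presents the bits to \<open>getv\<close> in Horner order.\<close>

fun pbits :: "nat \<Rightarrow> nat \<Rightarrow> nat \<Rightarrow> nat" where
  "pbits B c v = (if v = 0 then c else pbits B (c * B + v mod 2) (v div 2))"

declare pbits.simps [simp del]

text \<open>The symbol \<open>3 + i\<close> goes below the sign and the bits, so it is read when the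
  value is complete. Being positive, it also keeps zero bits from getting lost on an empty
  code.\<close>

definition prep :: "nat \<Rightarrow> nat \<Rightarrow> nat \<Rightarrow> int \<Rightarrow> nat" where
  "prep B c i x = (if x = 0 then c
     else pbits B (if x < 0 then (c * B + (3 + i)) * B + 2 else c * B + (3 + i)) (nat \<bar>x\<bar>))"

fun vcode :: "nat \<Rightarrow> nat \<Rightarrow> (nat \<Rightarrow> int) \<Rightarrow> nat" where
  "vcode B 0 v = 0"
| "vcode B (Suc k) v = prep B (vcode B k v) k (v k)"

text \<open>Every number decodes to some vector, so the walk can run through all codes below a bound
  without testing them for validity.\<close>

definition dec :: "nat \<Rightarrow> nat \<Rightarrow> nat \<Rightarrow> int" where
  "dec n c j = getv (n + 3) c j 0 0"

lemma getv_digit: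
  assumes "a < B" "2 \<le> B" "0 < c * B + a"
  shows "getv B (c * B + a) j val res =
    (if a < 2 then getv B c j (2 * val + int a) res
     else if a = 2 then getv B c j (- val) res
     else getv B c j 0 (if a = 3 + j then val else res))"
proof -
  have "(c * B + a) div B = c" "(c * B + a) mod B = a" using assms(1) by auto
  moreover have "\<not> (c * B + a = 0 \<or> B < 2)" using assms by auto
  ultimately show ?thesis
    by (subst getv.simps) (simp only: if_False)
qed

lemma getv_pbits:
  assumes "2 \<le> B" "0 < c"
  shows "getv B (pbits B c v) j val res = getv B c j (val * 2 ^ length (binary v) + int v) res"
  using assms(2)
proof (induction v arbitrary: c rule: less_induct)
  case (less v)
  show ?case
  proof (cases "v = 0")
    case True
    then show ?thesis by (simp add: pbits.simps binary.simps)
  next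
    case False
    have b: "binary v = binary (v div 2) @ [int (v mod 2)]" using False by (subst binary.simps) simp
    have v: "int v = 2 * int (v div 2) + int (v mod 2)" by presburger
    have "getv B (pbits B c v) j val res = getv B (pbits B (c * B + v mod 2) (v div 2)) j val res"
      using False by (subst pbits.simps) simp
    also have "\<dots> = getv B (c * B + v mod 2) j (val * 2 ^ length (binary (v div 2)) + int (v div 2)) res"
      using less assms False by (intro less.IH) auto
    also have "\<dots> = getv B c j (2 * (val * 2 ^ length (binary (v div 2)) + int (v div 2)) + int (v mod 2)) res"
      using assms less.prems by (subst getv_digit) (auto simp: less_le_trans[of _ 2])
    also have "2 * (val * 2 ^ length (binary (v div 2)) + int (v div 2)) + int (v mod 2)
      = val * 2 ^ length (binary v) + int v"
      unfolding b by (subst v) (simp add: algebra_simps)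
    finally show ?thesis .
  qed
qed

text \<open>The part pushed last is read first; its value becomes the default \<open>res\<close>,
  which the older part of the code may still overwrite.\<close>

lemma getv_prep:
  assumes "i < n"
  shows "getv (n + 3) (prep (n + 3) c i x) j 0 res =
     getv (n + 3) c j 0 (if i = j \<and> x \<noteq> 0 then x else res)"
proof -
  have d: "getv (n + 3) (c * (n + 3) + (3 + i)) j val res =
     getv (n + 3) c j 0 (if i = j then val else res)" for val
    using assms by (subst getv_digit) auto
  have m: "getv (n + 3) ((c * (n + 3) + (3 + i)) * (n + 3) + 2) j val res =
     getv (n + 3) (c * (n + 3) + (3 + i)) j (- val) res" for val
    by (subst getv_digit) auto
  show ?thesis
    by (cases "x = 0"; cases "x < 0")
      (simp_all only: prep_def getv_pbits d m if_True if_False, simp_all add: getv_pbits d m del: add_2_eq_Suc')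
qed

lemma getv_vcode:
  "k \<le> n \<Longrightarrow> getv (n + 3) (vcode (n + 3) k v) j 0 res = (if j < k \<and> v j \<noteq> 0 then v j else res)"
proof (induction k arbitrary: res)
  case 0
  then show ?case by (simp add: getv.simps)
next
  case (Suc k)
  then show ?case by (auto simp: getv_prep less_Suc_eq)
qed

lemma dec_vcode: "k \<le> n \<Longrightarrow> dec n (vcode (n + 3) k v) j = (if j < k then v j else 0)"
  by (auto simp: dec_def getv_vcode)

lemma dec_0 [simp]: "dec n 0 j = 0"
  by (simp add: dec_def getv.simps)

section \<open>Lengths of codes and sizes of decoded values\<close>

definition nsym :: "int \<Rightarrow> nat" where
  "nsym x = (if x = 0 then 0 else length (binary (nat \<bar>x\<bar>)) + 2)"

lemma pow_length_binary: "0 < v \<Longrightarrow> 2 ^ length (binary v) \<le> 2 * v"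
proof (induction v rule: less_induct)
  case (less v)
  have b: "binary v = binary (v div 2) @ [int (v mod 2)]" using less by (subst binary.simps) simp
  show ?case
  proof (cases "v = 1")
    case True
    then show ?thesis by (simp add: b binary.simps)
  next
    case False
    then have "2 ^ length (binary (v div 2)) \<le> 2 * (v div 2)"
      using less by (intro less.IH) auto
    moreover have "2 * (v div 2) \<le> v" by simp
    ultimately show ?thesis unfolding b by simp
  qed
qed

text \<open>The exponent 3 is forced by \<open>|x| = 1\<close>, where both sides are 8. A power of
  \<open>|x| + 1\<close> as bound makes digit counts add up when the factors are multiplied.\<close>

lemma pow_nsym: "2 ^ nsym x \<le> (nat \<bar>x\<bar> + 1) ^ 3"
proof (cases "x = 0")
  case False
  define v where "v = nat \<bar>x\<bar>"
  have v: "0 < v" using False by (simp add: v_def)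
  have "(2::nat) ^ nsym x = 4 * 2 ^ length (binary v)" using False by (simp add: nsym_def v_def)
  also have "\<dots> \<le> 8 * v" using pow_length_binary[OF v] by simp
  also have "\<dots> \<le> (v + 1) ^ 3"
  proof -
    obtain w where "v = Suc w" using v by (cases v) auto
    then show ?thesis by (simp add: power3_eq_cube algebra_simps)
  qed
  finally show ?thesis by (simp add: v_def)
qed (simp add: nsym_def)

lemma pbits_less:
  assumes "2 \<le> B" "c < B ^ e"
  shows "pbits B c v < B ^ (e + length (binary v))"
  using assms(2)
proof (induction v arbitrary: c e rule: less_induct)
  case (less v)
  show ?case
  proof (cases "v = 0")
    case True
    then show ?thesis using less.prems by (simp add: pbits.simps[of B c 0] binary.simps[of 0])
  next
    case False
    have b: "binary v = binary (v div 2) @ [int (v mod 2)]" using False by (subst binary.simps) simp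
    have "Suc c * B \<le> B ^ e * B" using less.prems by (intro mult_le_mono1) auto
    then have "c * B + v mod 2 < B ^ Suc e" using assms(1) by (simp add: algebra_simps)
    then have "pbits B (c * B + v mod 2) (v div 2) < B ^ (Suc e + length (binary (v div 2)))"
      by (rule less.IH[rotated]) (use False in simp)
    moreover have "Suc e + length (binary (v div 2)) = e + length (binary v)" by (subst b) simp
    moreover have "pbits B c v = pbits B (c * B + v mod 2) (v div 2)"
      using False by (subst pbits.simps) simp
    ultimately show ?thesis by (simp only:)
  qed
qed

lemma pbits_ge: "1 \<le> B \<Longrightarrow> c \<le> pbits B c v"
proof (induction v arbitrary: c rule: less_induct)
  case (less v)
  have "c \<le> c * B + v mod 2" using less.prems by (metis mult.right_neutral mult_le_mono2 trans_le_add1)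
  also have "\<dots> \<le> pbits B (c * B + v mod 2) (v div 2)" if "v \<noteq> 0"
    using less that by auto
  finally show ?case by (subst pbits.simps) (cases "v = 0"; simp)
qed

lemma prep_less:
  assumes "i < n" "c < (n + 3) ^ e"
  shows "prep (n + 3) c i x < (n + 3) ^ (e + nsym x)"
proof -
  let ?B = "n + 3"
  have step: "c * ?B + a < ?B ^ Suc e" if "a < ?B" "c < ?B ^ e" for a c e
  proof -
    have "Suc c * ?B \<le> ?B ^ e * ?B" using that by (intro mult_le_mono1) auto
    then show ?thesis using that by (simp add: algebra_simps)
  qed
  have 1: "c * ?B + (3 + i) < ?B ^ Suc e" using assms by (intro step) auto
  have 2: "(c * ?B + (3 + i)) * ?B + 2 < ?B ^ Suc (Suc e)" by (intro step 1) auto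
  have "?B ^ Suc e \<le> ?B ^ Suc (Suc e)" by (intro power_increasing) auto
  with 1 have 3: "c * ?B + (3 + i) < ?B ^ Suc (Suc e)" by linarith
  have e: "Suc (Suc e) + length (binary (nat \<bar>x\<bar>)) = e + nsym x" if "x \<noteq> 0"
    using that by (simp add: nsym_def)
  show ?thesis
    using pbits_less[OF _ 2, of "nat \<bar>x\<bar>"] pbits_less[OF _ 3, of "nat \<bar>x\<bar>"] assms(2) e
    by (cases "x = 0") (auto simp: prep_def nsym_def)
qed

lemma prep_ge: "1 \<le> B \<Longrightarrow> c \<le> prep B c i x"
proof -
  assume B: "1 \<le> B"
  then have 1: "c \<le> c * B" for c :: nat by simp
  show ?thesis
  proof (cases "x < 0")
    case True
    have "c \<le> (c * B + (3 + i)) * B + 2" using 1[of c] 1[of "c * B + (3 + i)"] by linarith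
    then show ?thesis using pbits_ge[OF B] True by (auto simp: prep_def intro: order_trans)
  next
    case False
    have "c \<le> c * B + (3 + i)" using 1[of c] by linarith
    then show ?thesis using pbits_ge[OF B] False by (auto simp: prep_def intro: order_trans)
  qed
qed

lemma vcode_less:
  assumes "k \<le> n"
  shows "vcode (n + 3) k v < (n + 3) ^ (\<Sum>j<k. nsym (v j))"
  using assms
proof (induction k)
  case (Suc k)
  then show ?case using prep_less[of k n] by simp
qed simp

lemma vcode_mono: "1 \<le> B \<Longrightarrow> k \<le> l \<Longrightarrow> vcode B k v \<le> vcode B l v"
  by (induction l) (auto simp: le_Suc_eq intro: order_trans[OF _ prep_ge])

lemma vcode_cong: "(\<And>j. j < k \<Longrightarrow> v j = v' j) \<Longrightarrow> vcode B k v = vcode B k v'"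
  by (induction k) auto

text \<open>The product is the right measure of a sparse vector: zero entries contribute the factor
  1 and no digit, and by \<open>pow_nsym\<close> a product up to \<open>2 ^ a\<close> costs at most
  \<open>3 * a\<close> digits.\<close>

lemma vcode_bound:
  assumes "k \<le> n" "(\<Prod>j<k. nat \<bar>v j\<bar> + 1) \<le> 2 ^ a" "3 * a \<le> L"
  shows "vcode (n + 3) k v < (n + 3) ^ L"
proof -
  let ?e = "\<Sum>j<k. nsym (v j)"
  have "(2::nat) ^ ?e = (\<Prod>j<k. 2 ^ nsym (v j))" by (simp add: power_sum)
  also have "\<dots> \<le> (\<Prod>j<k. (nat \<bar>v j\<bar> + 1) ^ 3)"
    by (intro prod_mono) (use pow_nsym in auto)
  also have "\<dots> = (\<Prod>j<k. nat \<bar>v j\<bar> + 1) ^ 3" by (rule prod_power_distrib [symmetric])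
  also have "\<dots> \<le> (2 ^ a) ^ 3" by (intro power_mono assms) simp
  also have "\<dots> = 2 ^ (3 * a)" by (simp add: power_mult [symmetric] mult.commute)
  finally have "?e \<le> 3 * a" by (rule power_le_imp_le_exp[rotated]) simp
  then have "(n + 3) ^ ?e \<le> (n + 3) ^ L" using assms by (intro power_increasing) auto
  then show ?thesis using vcode_less[OF assms(1), of v] by linarith
qed

text \<open>The product of \<open>|val| + 1\<close> and \<open>c + 1\<close> is a potential: a digit
  at most doubles the first factor, while dividing a nonzero \<open>c\<close> by
  \<open>B \<ge> 4\<close> at least halves the second.\<close>

lemma getv_step_bound:
  assumes "(\<bar>val\<bar> + 1) * (int c + 1) \<le> m" "4 \<le> B" "c \<noteq> 0" "\<bar>val'\<bar> + 1 \<le> 2 * (\<bar>val\<bar> + 1)"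
  shows "(\<bar>val'\<bar> + 1) * (int (c div B) + 1) \<le> m"
proof -
  have aux: "2 * (q + 1) \<le> c + 1" if "4 * q \<le> c" for q :: nat using that assms(3) by presburger
  have "4 * (c div B) \<le> B * (c div B)" using assms by (intro mult_le_mono1) auto
  also have "\<dots> \<le> c" by simp
  finally have "int (2 * (c div B + 1)) \<le> int (c + 1)" using aux by (simp only: of_nat_le_iff)
  then have q: "2 * (int (c div B) + 1) \<le> int c + 1"
    by (simp only: of_nat_mult of_nat_add of_nat_numeral of_nat_1)
  have "(\<bar>val'\<bar> + 1) * (int (c div B) + 1) \<le> 2 * (\<bar>val\<bar> + 1) * (int (c div B) + 1)"
    using assms(4) by (intro mult_right_mono) auto
  also have "\<dots> = (\<bar>val\<bar> + 1) * (2 * (int (c div B) + 1))" by (simp only: ac_simps)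
  also have "\<dots> \<le> (\<bar>val\<bar> + 1) * (int c + 1)" using q by (intro mult_left_mono) auto
  finally show ?thesis using assms by linarith
qed

lemma getv_bound:
  assumes "(\<bar>val\<bar> + 1) * (int c + 1) \<le> m" "\<bar>res\<bar> < m" "4 \<le> B"
  shows "\<bar>getv B c j val res\<bar> < m"
  using assms
proof (induction B c j val res rule: getv.induct)
  case (1 B c j val res)
  show ?case
  proof (cases "c = 0")
    case True
    then show ?thesis using 1 by (simp add: getv.simps)
  next
    case False
    have val: "\<bar>val\<bar> < m" 
    proof -
      have "\<bar>val\<bar> + 1 \<le> (\<bar>val\<bar> + 1) * (int c + 1)"
        using mult_left_mono[of 1 "int c + 1" "\<bar>val\<bar> + 1"] by simp
      then show ?thesis using 1 by linarith
    qed
    have s: "(\<bar>val'\<bar> + 1) * (int (c div B) + 1) \<le> m" if "\<bar>val'\<bar> + 1 \<le> 2 * (\<bar>val\<bar> + 1)" for val'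
      using getv_step_bound that 1 False by blast
    have "\<not> (c = 0 \<or> B < 2)" using 1 False by auto
    note IH = "1.IH"[OF this]
    consider "c mod B < 2" | "c mod B = 2" | "\<not> c mod B < 2" "c mod B \<noteq> 2" by blast
    then show ?thesis
    proof cases
      case 1
      have "\<bar>2 * val + int a\<bar> + 1 \<le> 2 * (\<bar>val\<bar> + 1)" if "a < 2" for a
      proof -
        have "int a \<le> 1" using that by simp
        then show ?thesis using abs_triangle_ineq[of "2 * val" "int a"] by (simp add: abs_mult)
      qed
      from this[OF 1] have "\<bar>2 * val + int (c mod B)\<bar> + 1 \<le> 2 * (\<bar>val\<bar> + 1)" .
      from IH(1)[OF 1 s[OF this]] \<open>\<bar>res\<bar> < m\<close> \<open>4 \<le> B\<close> False 1 show ?thesis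
        by (subst getv.simps) auto
    next
      case 2
      with IH(2)[OF _ _ s] \<open>\<bar>res\<bar> < m\<close> \<open>4 \<le> B\<close> False show ?thesis
        by (subst getv.simps) auto
    next
      case 3
      with IH(3)[OF _ _ s] val \<open>\<bar>res\<bar> < m\<close> \<open>4 \<le> B\<close> False show ?thesis
        by (subst getv.simps) auto
    qed
  qed
qed

text \<open>With \<open>val = 0\<close> the potential starts at \<open>c + 1\<close>, so decoded
  entries need no more room than their code.\<close>

lemma dec_bound: "1 \<le> n \<Longrightarrow> \<bar>dec n c j\<bar> \<le> int c"
  unfolding dec_def using getv_bound[of 0 c "int c + 1" 0 "n + 3" j] by simp

subsection \<open>Mixed radix numbers\<close>

definition weight :: "(nat \<Rightarrow> nat) \<Rightarrow> nat \<Rightarrow> nat" where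
  "weight d k = (\<Prod>j<k. d j)"

definition rank :: "(nat \<Rightarrow> nat) \<Rightarrow> nat \<Rightarrow> (nat \<Rightarrow> int) \<Rightarrow> nat" where
  "rank d k v = (\<Sum>j<k. nat (v j) * weight d j)"

lemma weight_0 [simp]: "weight d 0 = 1"
  and weight_Suc [simp]: "weight d (Suc k) = weight d k * d k"
  by (simp_all add: weight_def)

lemma rank_0 [simp]: "rank d 0 v = 0"
  and rank_Suc [simp]: "rank d (Suc k) v = rank d k v + nat (v k) * weight d k"
  by (simp_all add: rank_def)

lemma weight_dvd: "j \<le> k \<Longrightarrow> weight d j dvd weight d k"
  by (induction k) (auto simp: le_Suc_eq)

lemma weight_pos: "(\<And>j. j < k \<Longrightarrow> 0 < d j) \<Longrightarrow> 0 < weight d k"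
  by (auto simp: weight_def intro!: prod_pos)

lemma rank_less:
  assumes "\<And>j. j < k \<Longrightarrow> v j < int (d j)" "\<And>j. j < k \<Longrightarrow> 0 < d j"
  shows "rank d k v < weight d k"
  using assms
proof (induction k)
  case (Suc k)
  then have r: "rank d k v < weight d k" by auto
  have "nat (v k) < d k" using Suc.prems(1)[of k] Suc.prems(2)[of k] by linarith
  then have "Suc (nat (v k)) * weight d k \<le> d k * weight d k" by (intro mult_le_mono1) auto
  with r show ?case by (simp add: algebra_simps)
qed simp

lemma rank_digit:
  assumes "\<And>j. j < k \<Longrightarrow> 0 \<le> v j \<and> v j < int (d j)" "i < k"
  shows "int ((rank d k v div weight d i) mod d i) = v i"
  using assms
proof (induction k)
  case (Suc k)
  have d: "0 < d j" if "j < Suc k" for j using Suc.prems(1)[OF that] by linarith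
  have w: "0 < weight d i" by (rule weight_pos) (use d Suc.prems in auto)
  show ?case
  proof (cases "i = k")
    case True
    have "rank d k v < weight d k" by (rule rank_less) (use Suc.prems d in auto)
    with True w Suc.prems(1)[of k] show ?thesis by (simp add: nat_less_iff)
  next
    case False
    with Suc.prems have i: "i < k" by simp
    \<comment> \<open>The digit at the higher place \<open>k\<close> contributes a multiple of
      \<open>weight d i * d i\<close>, which is invisible at place \<open>i\<close>.\<close>
    obtain e where e: "weight d k = weight d i * d i * e"
      using weight_dvd[of "Suc i" k d] i by (auto elim: dvdE)
    have "rank d (Suc k) v = rank d k v + weight d i * (d i * (e * nat (v k)))"
      by (simp add: e algebra_simps)
    then have "rank d (Suc k) v div weight d i = rank d k v div weight d i + d i * (e * nat (v k))"
      using w by (simp only: div_mult_self2 neq0_conv)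
    then show ?thesis using Suc i by simp
  qed
qed simp

lemma rank_cong:
  "(\<And>j. j < k \<Longrightarrow> d j = d' j) \<Longrightarrow> (\<And>j. j < k \<Longrightarrow> v j = v' j) \<Longrightarrow> rank d k v = rank d' k v'"
  unfolding rank_def weight_def by (intro sum.cong) auto

definition unrank :: "(nat \<Rightarrow> nat) \<Rightarrow> nat \<Rightarrow> nat \<Rightarrow> int" where
  "unrank d t j = int (t div weight d j mod d j)"

subsection \<open>Binary expansions\<close>

lemma foldl_binary: "foldl (\<lambda>a x. 2 * a + x) 0 (binary k) = int k"
proof (induction k rule: less_induct)
  case (less k)
  show ?case
  proof (cases "k = 0")
    case False
    then have "foldl (\<lambda>a x. 2 * a + x) 0 (binary k) = 2 * int (k div 2) + int (k mod 2)"
      using less[of "k div 2"] by (subst binary.simps) simp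
    then show ?thesis by presburger
  qed (simp add: binary.simps)
qed

lemma set_binary: "set (binary k) \<subseteq> {0, 1}"
proof (induction k rule: less_induct)
  case (less k)
  then show ?case by (subst binary.simps) auto
qed

subsection \<open>Paths between states and the lattice of loops\<close>

text \<open>Frequencies as functions on all of \<open>nat\<close>; they are compared only below
  \<open>n\<close>, where \<open>freq_index\<close> identifies them with
  \<open>freq\<close>.\<close>

fun fr :: "update list \<Rightarrow> nat \<Rightarrow> int" where
  "fr [] j = 0"
| "fr ((i, \<Delta>) # \<sigma>) j = (if i = j then \<Delta> else 0) + fr \<sigma> j"

lemma fr_append: "fr (\<sigma> @ \<tau>) j = fr \<sigma> j + fr \<tau> j"
  by (induction \<sigma>) auto

lemma freq_carrier [simp]: "freq n \<sigma> \<in> carrier_vec n"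
  by (induction \<sigma>) (auto simp: freq_def)

lemma freq_index: "j < n \<Longrightarrow> freq n \<sigma> $ j = fr \<sigma> j"
proof (induction \<sigma>)
  case (Cons u \<sigma>)
  obtain i \<Delta> where u: "u = (i, \<Delta>)" by force
  have "freq n (u # \<sigma>) = \<Delta> \<cdot>\<^sub>v unit_vec n i + freq n \<sigma>" by (simp add: freq_def u)
  with Cons show ?case by (auto simp: u carrier_vecD[OF freq_carrier] unit_vec_def)
qed (simp add: freq_def)

lemma streams_Nil [simp]: "[] \<in> streams n"
  and streams_Cons [simp]: "u # \<sigma> \<in> streams n \<longleftrightarrow> fst u < n \<and> \<sigma> \<in> streams n"
  and streams_append [simp]: "\<sigma> @ \<tau> \<in> streams n \<longleftrightarrow> \<sigma> \<in> streams n \<and> \<tau> \<in> streams n"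
  by (auto simp: streams_def) (metis SigmaI UNIV_I lessThan_iff prod.collapse)

text \<open>A positive \<open>s\<close> absorbs the additive constants in the exponent of
  \<open>M\<close>; the case \<open>s = 0\<close> is left to \<open>trivial_sketch\<close>.\<close>

locale automaton =
  fixes n s :: nat and A :: stream_alg
  assumes n1: "1 \<le> n" and s1: "1 \<le> s" and space: "space_between_updates n A s"
begin

definition path :: "nat \<Rightarrow> (nat \<Rightarrow> int) \<Rightarrow> nat \<Rightarrow> bool" where
  "path p x p' \<longleftrightarrow> (\<exists>\<sigma>\<in>streams n. foldl (transition A) p \<sigma> = p' \<and> (\<forall>j<n. fr \<sigma> j = x j))"

definition reach :: "nat \<Rightarrow> bool" where
  "reach p \<longleftrightarrow> (\<exists>x. path (initial A) x p)"

lemma reach_iff: "reach p \<longleftrightarrow> (\<exists>\<sigma>\<in>streams n. final_state A \<sigma> = p)"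
  by (auto simp: reach_def path_def final_state_def)

lemma reach_less: "reach p \<Longrightarrow> p < 2 ^ s"
  using space by (auto simp: reach_iff space_between_updates_def)

lemma path_cong: "path p x p' \<Longrightarrow> (\<And>j. j < n \<Longrightarrow> x j = y j) \<Longrightarrow> path p y p'"
  by (auto simp: path_def)

lemma path_refl: "path p (\<lambda>_. 0) p"
  unfolding path_def by (rule bexI[of _ "[]"]) auto

lemma path_trans: "path p x p' \<Longrightarrow> path p' y p'' \<Longrightarrow> path p (\<lambda>j. x j + y j) p''"
  unfolding path_def
proof (elim bexE conjE)
  fix \<sigma> \<tau> assume "\<sigma> \<in> streams n" "\<tau> \<in> streams n" "foldl (transition A) p \<sigma> = p'"
    "\<forall>j<n. fr \<sigma> j = x j" "foldl (transition A) p' \<tau> = p''" "\<forall>j<n. fr \<tau> j = y j"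
  then show "\<exists>\<sigma>\<in>streams n. foldl (transition A) p \<sigma> = p'' \<and> (\<forall>j<n. fr \<sigma> j = x j + y j)"
    by (intro bexI[of _ "\<sigma> @ \<tau>"]) (auto simp: fr_append)
qed

lemma path_update: "i < n \<Longrightarrow> path p (\<lambda>j. if j = i then \<Delta> else 0) (transition A p (i, \<Delta>))"
  unfolding path_def by (rule bexI[of _ "[(i, \<Delta>)]"]) auto

lemma reach_initial: "reach (initial A)"
  using path_refl by (auto simp: reach_def)

lemma reach_path: "reach p \<Longrightarrow> path p x p' \<Longrightarrow> reach p'"
  unfolding reach_def using path_trans by blast

text \<open>The sign \<open>-1\<close> cancels the frequency of the walk with sign \<open>1\<close>,
  but in general not its effect on the state.\<close>

fun walk :: "nat \<Rightarrow> nat \<Rightarrow> int \<Rightarrow> nat \<Rightarrow> nat" where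
  "walk p c \<epsilon> 0 = p"
| "walk p c \<epsilon> (Suc k) = transition A (walk p c \<epsilon> k) (k, \<epsilon> * dec n c k)"

lemma path_walk_aux: "k \<le> n \<Longrightarrow> path p (\<lambda>j. if j < k then \<epsilon> * dec n c j else 0) (walk p c \<epsilon> k)"
proof (induction k)
  case 0
  then show ?case using path_refl by simp
next
  case (Suc k)
  then have "path p (\<lambda>j. if j < k then \<epsilon> * dec n c j else 0) (walk p c \<epsilon> k)" by simp
  from path_trans[OF this path_update[of k _ "\<epsilon> * dec n c k"]] Suc.prems show ?case
    by (auto elim!: path_cong)
qed

lemma path_walk: "path p (\<lambda>j. \<epsilon> * dec n c j) (walk p c \<epsilon> n)"
  by (rule path_cong[OF path_walk_aux[OF le_refl]]) simp

lemma reach_walk: "k \<le> n \<Longrightarrow> reach p \<Longrightarrow> reach (walk p c \<epsilon> k)"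
  using path_walk_aux reach_path by blast

text \<open>\<open>lazy_code\<close> needs \<open>3 * (2 * s + 1)\<close> digits in base
  \<open>n + 3\<close>, at most \<open>9 * s\<close> for positive \<open>s\<close>; the codes in
  \<open>basis_exists\<close> need fewer.\<close>

definition M :: nat where
  "M = (n + 3) ^ (9 * s)"

text \<open>One round of the fixed walk from \<open>p\<close> ends in \<open>pre p M\<close>. The
  excursion to \<open>c\<close> begins in \<open>pre p c\<close> and turns around in
  \<open>mid p c\<close>.\<close>

fun pre :: "nat \<Rightarrow> nat \<Rightarrow> nat" where
  "pre p 0 = p"
| "pre p (Suc c) = walk (walk (pre p c) c 1 n) c (-1) n"

definition mid :: "nat \<Rightarrow> nat \<Rightarrow> nat" where
  "mid p c = walk (pre p c) c 1 n"

lemma path_mid: "path (pre p c) (dec n c) (mid p c)"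
  using path_walk[of "pre p c" 1 c] by (simp add: mid_def)

lemma path_mid': "path (mid p c) (\<lambda>j. - dec n c j) (pre p (Suc c))"
  using path_walk[of "mid p c" "-1" c] by (simp add: mid_def)

lemma path_pre: "c \<le> c' \<Longrightarrow> path (pre p c) (\<lambda>_. 0) (pre p c')"
proof (induction c')
  case 0
  then show ?case using path_refl by simp
next
  case (Suc c')
  have "path (pre p c') (\<lambda>_. 0) (pre p (Suc c'))"
    using path_trans[OF path_mid path_mid'] by simp
  from path_trans[OF _ this, of _ "\<lambda>_. 0"]
  have "path p' (\<lambda>_. 0) (pre p (Suc c'))" if "path p' (\<lambda>_. 0) (pre p c')" for p'
    using that by simp
  with Suc show ?case
    by (metis le_Suc_eq path_refl)
qed

lemma reach_pre: "reach p \<Longrightarrow> reach (pre p c)"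
  using path_pre[of 0 c p] reach_path by auto

lemma reach_mid: "reach p \<Longrightarrow> reach (mid p c)"
  using reach_pre path_mid reach_path by blast

section \<open>A start state on a cycle, and loops from collisions\<close>

definition start :: nat where
  "start = ((\<lambda>p. pre p M) ^^ (2 ^ s)) (initial A)"

lemma path_rounds: "path p (\<lambda>_. 0) (((\<lambda>p. pre p M) ^^ k) p)"
proof (induction k)
  case (Suc k)
  from path_trans[OF Suc.IH path_pre[of 0 M, simplified]] show ?case by simp
qed (simp add: path_refl)

lemma path_start: "path (initial A) (\<lambda>_. 0) start"
  unfolding start_def by (rule path_rounds)

lemma reach_start: "reach start"
  using path_start by (auto simp: reach_def)

text \<open>Two of the first \<open>2 ^ s + 1\<close> iterates agree, so after \<open>2 ^ s\<close>
  rounds the orbit is periodic. One round is split off because the return is wanted from the middle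
  of that round.\<close>

lemma start_on_cycle: "\<exists>e. ((\<lambda>p. pre p M) ^^ e) (pre start M) = start"
proof -
  let ?F = "\<lambda>p. pre p M"
  let ?g = "\<lambda>i. (?F ^^ i) (initial A)"
  have "?g ` {..2 ^ s} \<subseteq> {..<2 ^ s}"
    using reach_less[OF reach_path[OF reach_initial path_rounds]] by auto
  then have "card (?g ` {..2 ^ s}) < card {..(2::nat) ^ s}"
    using card_mono[of "{..<(2::nat) ^ s}"] by (fastforce simp: less_Suc_eq_le)
  then have "\<not> inj_on ?g {..2 ^ s}" using pigeonhole by blast
  then obtain i j where ij: "i < j" "j \<le> 2 ^ s" "?g i = ?g j"
    unfolding inj_on_def by (metis atMost_iff nat_neq_iff)
  have "start = (?F ^^ (2 ^ s - i)) (?g i)"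
    using ij funpow_add[of "2 ^ s - i" i ?F] by (simp add: start_def)
  \<comment> \<open>Replacing iterate \<open>i\<close> by the equal but later iterate
    \<open>j\<close> exhibits \<open>start\<close> as a point \<open>j - i\<close> rounds after
    itself.\<close>
  also have "\<dots> = (?F ^^ (2 ^ s - i)) (?g j)" using ij by simp
  also have "\<dots> = (?F ^^ (2 ^ s - i + j)) (initial A)" by (simp add: funpow_add)
  also have "2 ^ s - i + j = (j - i - 1) + Suc (2 ^ s)" using ij by simp
  also have "(?F ^^ \<dots>) (initial A) = (?F ^^ (j - i - 1)) (pre start M)"
    by (simp only: funpow_add comp_def funpow.simps start_def)
  finally show ?thesis by metis
qed

text \<open>Completing the current round and then the cycle leads back to \<open>start\<close>; all
  excursions on the way have frequency 0 in total.\<close>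

lemma path_return: "c \<le> M \<Longrightarrow> path (pre start c) (\<lambda>_. 0) start"
proof -
  assume c: "c \<le> M"
  obtain e where "((\<lambda>p. pre p M) ^^ e) (pre start M) = start" using start_on_cycle by blast
  with path_trans[OF path_pre[OF c, of start] path_rounds[of _ e]] show ?thesis by simp
qed

definition coll :: "(nat \<Rightarrow> int) \<Rightarrow> bool" where
  "coll x \<longleftrightarrow> (\<exists>c1<M. \<exists>c2<M. mid start c1 = mid start c2 \<and> (\<forall>j<n. x j = dec n c1 j - dec n c2 j))"

text \<open>Leave for the excursion to \<open>c1\<close>; at its turning point, which is also that
  of \<open>c2\<close>, follow the way back from \<open>c2\<close> and then around the
  cycle.\<close>

lemma coll_path:
  assumes "coll x"
  shows "path start x start"
proof -
  obtain c1 c2 where c: "c1 < M" "c2 < M" "mid start c1 = mid start c2"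
    "\<forall>j<n. x j = dec n c1 j - dec n c2 j" using assms by (auto simp: coll_def)
  have "path start (\<lambda>_. 0) (pre start c1)" using path_pre[of 0 c1 start] by simp
  note path_trans[OF path_trans[OF path_trans[OF this path_mid]
    path_mid'[of start c2, folded c(3)]] path_return[of "Suc c2"]]
  with c show ?thesis by (auto elim!: path_cong)
qed

lemma coll_uminus: "coll x \<Longrightarrow> coll (\<lambda>j. - x j)"
  unfolding coll_def by (metis minus_diff_eq)

subsection \<open>A triangular basis of relations\<close>

definition cand :: "nat \<Rightarrow> nat \<Rightarrow> nat \<Rightarrow> nat \<Rightarrow> int \<Rightarrow> int \<Rightarrow> bool" where
  "cand dm i t j x e \<longleftrightarrow> (if j < i then \<bar>x\<bar> \<le> e else if j = i then x = int (t div M div M) else x = 0)"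

text \<open>A relation is searched as one number \<open>t = (D * M + c1) * M + c2\<close> made of
  its leading entry \<open>D\<close> and the two codes of a collision. \<open>D\<close> is the most
  significant part, so that the least \<open>t\<close> also has the least \<open>D\<close>. The code
  \<open>dm\<close> holds the bounds \<open>d j - 1\<close> found so far.\<close>

definition ok :: "nat \<Rightarrow> nat \<Rightarrow> nat \<Rightarrow> bool" where
  "ok dm i t \<longleftrightarrow> mid start (t div M mod M) = mid start (t mod M) \<and> 0 < t div M div M \<and>
     (\<forall>j<n. cand dm i t j (dec n (t div M mod M) j - dec n (t mod M) j) (dec n dm j))"

definition rel :: "nat \<Rightarrow> nat \<Rightarrow> nat" where
  "rel dm i = (LEAST t. ok dm i t)"

fun dms :: "nat \<Rightarrow> nat" where
  "dms 0 = 0"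
| "dms (Suc i) = prep (n + 3) (dms i) i (int (rel (dms i) i div M div M) - 1)"

definition d :: "nat \<Rightarrow> nat" where
  "d i = rel (dms i) i div M div M"

definition \<rho> :: "nat \<Rightarrow> nat \<Rightarrow> int" where
  "\<rho> i j = dec n (rel (dms i) i div M mod M) j - dec n (rel (dms i) i mod M) j"

lemma M_pos: "0 < M" by (simp add: M_def)

lemma pow_le_M: "e \<le> 18 * s \<Longrightarrow> 2 ^ e \<le> M"
proof -
  assume e: "e \<le> 18 * s"
  have "(2::nat) ^ e \<le> 2 ^ (18 * s)" using e by (intro power_increasing) auto
  also have "\<dots> = 4 ^ (9 * s)" by (simp add: power_mult)
  also have "\<dots> \<le> M" unfolding M_def using n1 by (intro power_mono) auto
  finally show ?thesis .
qed

lemma dms_vcode: "dms i = vcode (n + 3) i (\<lambda>j. int (d j) - 1)"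
  by (induction i) (auto simp: d_def)

lemma dec_dms: "i \<le> n \<Longrightarrow> dec n (dms i) j = (if j < i then int (d j) - 1 else 0)"
  by (simp add: dms_vcode dec_vcode)

text \<open>Exchanging the two codes makes the leading entry positive, so that it can be packed into
  a natural number.\<close>

lemma ok_exists:
  assumes "i < n" "coll x" "\<And>j. i < j \<Longrightarrow> j < n \<Longrightarrow> x j = 0"
    "\<And>j. j < i \<Longrightarrow> \<bar>x j\<bar> < int (d j)" "x i \<noteq> 0"
  shows "\<exists>t. ok (dms i) i t \<and> t div M div M = nat \<bar>x i\<bar>"
proof -
  have pos: "\<exists>t. ok (dms i) i t \<and> t div M div M = nat (x i)"
    if x: "coll x" "\<And>j. i < j \<Longrightarrow> j < n \<Longrightarrow> x j = 0"
    "\<And>j. j < i \<Longrightarrow> \<bar>x j\<bar> < int (d j)" "0 < x i" for x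
  proof -
    obtain c1 c2 where c: "c1 < M" "c2 < M" "mid start c1 = mid start c2"
      "\<forall>j<n. x j = dec n c1 j - dec n c2 j" using x by (auto simp: coll_def)
    define t where "t = (nat (x i) * M + c1) * M + c2"
    have t1: "t div M = nat (x i) * M + c1" "t mod M = c2" using c by (auto simp: t_def)
    then have t2: "t div M mod M = c1" "t div M div M = nat (x i)" using c by auto
    have "cand (dms i) i t j (x j) (dec n (dms i) j)" if "j < n" for j
    proof -
      consider "j < i" | "j = i" | "i < j" by linarith
      then show ?thesis
      proof cases
        case 1
        with x(3)[OF 1] assms(1) show ?thesis by (simp add: cand_def dec_dms)
      next
        case 2
        with x(4) show ?thesis by (simp add: cand_def t2)
      next
        case 3
        with x(2)[OF 3 that] show ?thesis by (simp add: cand_def)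
      qed
    qed
    then show ?thesis
      unfolding ok_def by (intro exI[of _ t]) (use c x t1 t2 in auto)
  qed
  show ?thesis
  proof (cases "0 < x i")
    case True
    with pos[of x] assms show ?thesis by auto
  next
    case False
    with pos[OF coll_uminus[OF assms(2)]] assms show ?thesis by auto
  qed
qed

text \<open>Extracting the leading entry is a division, hence monotone, so the minimality of
  \<open>rel\<close> passes to \<open>d i\<close>.\<close>

lemma d_minimal:
  assumes "i < n" "coll x" "\<And>j. i < j \<Longrightarrow> j < n \<Longrightarrow> x j = 0"
    "\<And>j. j < i \<Longrightarrow> \<bar>x j\<bar> < int (d j)" "x i \<noteq> 0"
  shows "ok (dms i) i (rel (dms i) i) \<and> int (d i) \<le> \<bar>x i\<bar>"
proof -
  from ok_exists[OF assms] obtain t where t: "ok (dms i) i t" "t div M div M = nat \<bar>x i\<bar>"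
    by auto
  then have "rel (dms i) i \<le> t" unfolding rel_def by (intro Least_le)
  then have "d i \<le> nat \<bar>x i\<bar>" unfolding t(2)[symmetric] d_def by (intro div_le_mono)
  moreover have "ok (dms i) i (rel (dms i) i)" unfolding rel_def by (rule LeastI[of _ t]) (rule t)
  ultimately show ?thesis by auto
qed

text \<open>Pigeonhole on a box with sides \<open>d j\<close> for \<open>j < i\<close> and one new
  side \<open>c\<close>: two of its vectors lead to the same state. By minimality of the earlier
  \<open>d k\<close> their difference must be nonzero at \<open>i\<close>, where it is smaller than
  \<open>c\<close> in absolute value.\<close>

lemma basis_exists:
  "i \<le> n \<Longrightarrow> weight d i \<le> 2 ^ s \<and> (\<forall>k<i. ok (dms k) k (rel (dms k) k))"
proof (induction i)
  case (Suc i)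
  then have i: "i < n" and P: "weight d i \<le> 2 ^ s"
    and ok: "\<And>k. k < i \<Longrightarrow> ok (dms k) k (rel (dms k) k)" by auto
  have d0: "0 < d k" if "k < i" for k using ok[OF that] by (auto simp: ok_def d_def)
  have P0: "0 < weight d i" by (rule weight_pos) (rule d0)
  \<comment> \<open>The least side that gives the box more than \<open>2 ^ s\<close> points. A value
    below \<open>c\<close> is at most \<open>2 ^ s div weight d i\<close>, which preserves the bound
    on the product.\<close>
  define c where "c = 2 ^ s div weight d i + 1"
  have Pc1: "2 ^ s < weight d i * c"
    using P0 by (simp add: c_def dividend_less_times_div)
  have Pc2: "weight d i * c \<le> 2 ^ (s + 1)"
  proof -
    have "weight d i * c = weight d i * (2 ^ s div weight d i) + weight d i"
      by (simp add: c_def algebra_simps)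
    also have "\<dots> \<le> 2 ^ s + 2 ^ s"
      using P times_div_less_eq_dividend[of "weight d i" "2 ^ s"] by (rule add_mono[rotated])
    finally show ?thesis by simp
  qed
  define S where "S = (\<lambda>j. if j < i then {0..<int (d j)} else {0..<int c})"
  define Box where "Box = PiE {..<Suc i} S"
  have fin: "finite Box" unfolding Box_def by (intro finite_PiE) (auto simp: S_def)
  have "card Box = (\<Prod>j<Suc i. card (S j))" unfolding Box_def by (simp add: card_PiE)
  also have "\<dots> = weight d i * c" by (simp add: S_def weight_def)
  finally have card: "card Box = weight d i * c" .
  let ?code = "\<lambda>v. vcode (n + 3) (Suc i) v"
  have code: "?code v < M" if "v \<in> Box" for v
  proof -
    have v: "v j \<in> S j" if "j < Suc i" for j using that \<open>v \<in> Box\<close> by (auto simp: Box_def)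
    have "(\<Prod>j<i. nat \<bar>v j\<bar> + 1) \<le> weight d i"
      unfolding weight_def
    proof (rule prod_mono, intro conjI)
      fix j assume "j \<in> {..<i}"
      with v[of j] show "nat \<bar>v j\<bar> + 1 \<le> d j" by (auto simp: S_def)
    qed simp
    moreover have "nat \<bar>v i\<bar> + 1 \<le> c" using v[of i] by (auto simp: S_def)
    ultimately have "(\<Prod>j<Suc i. nat \<bar>v j\<bar> + 1) \<le> weight d i * c"
      unfolding prod.lessThan_Suc by (rule mult_le_mono)
    with Pc2 have "(\<Prod>j<Suc i. nat \<bar>v j\<bar> + 1) \<le> 2 ^ (s + 1)" by linarith
    then show ?thesis unfolding M_def by (rule vcode_bound[rotated]) (use i s1 in auto)
  qed
  have "(\<lambda>v. mid start (?code v)) ` Box \<subseteq> {..<2 ^ s}"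
    using reach_less[OF reach_mid[OF reach_start]] by auto
  then have "card ((\<lambda>v. mid start (?code v)) ` Box) \<le> card {..<(2::nat) ^ s}"
    by (rule card_mono[rotated]) simp
  then have "card ((\<lambda>v. mid start (?code v)) ` Box) < card Box"
    using Pc1 unfolding card card_lessThan by (rule le_less_trans)
  then have "\<not> inj_on (\<lambda>v. mid start (?code v)) Box" using pigeonhole by blast
  then obtain v v' where vv: "v \<in> Box" "v' \<in> Box" "v \<noteq> v'"
    "mid start (?code v) = mid start (?code v')" by (auto simp: inj_on_def)
  define x where "x = (\<lambda>j. if j < Suc i then v j - v' j else 0)"
  have coll: "coll x" unfolding coll_def
    by (rule exI[of _ "?code v"], rule conjI[OF code[OF vv(1)]],
        rule exI[of _ "?code v'"], rule conjI[OF code[OF vv(2)]])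
      (use vv i in \<open>simp add: x_def dec_vcode del: vcode.simps\<close>)
  have v: "v j \<in> S j" "v' j \<in> S j" if "j < Suc i" for j using that vv by (auto simp: Box_def)
  have xS: "\<bar>x j\<bar> < int (d j)" if "j < i" for j
    using v[of j] that by (auto simp: S_def x_def)
  have xi: "\<bar>x i\<bar> < int c" using v[of i] by (auto simp: S_def x_def)
  have "\<exists>j<Suc i. v j \<noteq> v' j"
    using vv by (metis Box_def PiE_ext lessThan_iff)
  then have ex: "\<exists>j<Suc i. x j \<noteq> 0" by (auto simp: x_def)
  have "x i \<noteq> 0"
  proof
    assume x0: "x i = 0"
    \<comment> \<open>If \<open>x i\<close> were 0, the last nonzero entry of \<open>x\<close> would
      sit at some \<open>k < i\<close> and be smaller than \<open>d k\<close>, against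
      \<open>d_minimal\<close>.\<close>
    define k where "k = Max {j. j < Suc i \<and> x j \<noteq> 0}"
    have "k \<in> {j. j < Suc i \<and> x j \<noteq> 0}" unfolding k_def by (rule Max_in) (use ex in auto)
    then have k: "k < i" "x k \<noteq> 0" using x0 by (auto simp: less_Suc_eq)
    have z: "x j = 0" if "k < j" for j
    proof (rule ccontr)
      assume "x j \<noteq> 0"
      then have "j \<in> {j. j < Suc i \<and> x j \<noteq> 0}" by (auto simp: x_def split: if_splits)
      then have "j \<le> k" unfolding k_def by (intro Max_ge) auto
      with that show False by simp
    qed
    have "int (d k) \<le> \<bar>x k\<bar>" using d_minimal[of k x] k i coll z xS by auto
    with xS[OF k(1)] show False by simp
  qed
  moreover have "x j = 0" if "i < j" for j using that by (simp add: x_def)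
  ultimately have "ok (dms i) i (rel (dms i) i)" "int (d i) \<le> \<bar>x i\<bar>"
    using d_minimal[OF i coll _ xS] by auto
  moreover from this(2) xi have "d i \<le> 2 ^ s div weight d i" by (simp add: c_def)
  then have "weight d i * d i \<le> weight d i * (2 ^ s div weight d i)" by (rule mult_le_mono2)
  then have "weight d (Suc i) \<le> 2 ^ s"
    unfolding weight_Suc using times_div_less_eq_dividend by (rule le_trans)
  ultimately show ?case using ok by (auto simp: less_Suc_eq)
qed simp

lemma ok_rel: "i < n \<Longrightarrow> ok (dms i) i (rel (dms i) i)"
  using basis_exists[of n] by simp

lemma weight_le: "i \<le> n \<Longrightarrow> weight d i \<le> 2 ^ s"
  using basis_exists[of i] by simp

lemma d_pos: "i < n \<Longrightarrow> 0 < d i"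
  using ok_rel by (auto simp: ok_def d_def)

lemma rho_diag: "i < n \<Longrightarrow> \<rho> i i = int (d i)"
  and rho_above: "i < j \<Longrightarrow> j < n \<Longrightarrow> \<rho> i j = 0"
  and rho_below: "i < n \<Longrightarrow> j < i \<Longrightarrow> \<bar>\<rho> i j\<bar> < int (d j)"
proof -
  have c: "cand (dms i) i (rel (dms i) i) j (\<rho> i j) (dec n (dms i) j)" if "j < n" "i < n" for i j
    using ok_rel[OF that(2)] that(1) by (auto simp: ok_def \<rho>_def)
  show "i < n \<Longrightarrow> \<rho> i i = int (d i)" using c[of i i] by (simp add: cand_def d_def)
  show "i < j \<Longrightarrow> j < n \<Longrightarrow> \<rho> i j = 0" using c[of j i] by (simp add: cand_def)
  show "i < n \<Longrightarrow> j < i \<Longrightarrow> \<bar>\<rho> i j\<bar> < int (d j)" using c[of j i] by (simp add: cand_def dec_dms)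
qed

lemma coll_rho: "i < n \<Longrightarrow> coll (\<rho> i)"
  using ok_rel[of i] M_pos unfolding coll_def ok_def \<rho>_def
  by (metis mod_less_divisor)

lemma d_le: "i < n \<Longrightarrow> d i \<le> 2 ^ s"
proof -
  assume i: "i < n"
  have "0 < weight d i" by (rule weight_pos) (use d_pos i in auto)
  then have "d i \<le> weight d i * d i" by simp
  also have "\<dots> \<le> 2 ^ s" using weight_le[of "Suc i"] i by simp
  finally show ?thesis .
qed

subsection \<open>The quotient\<close>

definition eqv :: "(nat \<Rightarrow> int) \<Rightarrow> (nat \<Rightarrow> int) \<Rightarrow> bool" where
  "eqv x y \<longleftrightarrow> (\<exists>a :: nat \<Rightarrow> int. \<forall>j<n. x j - y j = (\<Sum>i<n. a i * \<rho> i j))"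

definition box :: "(nat \<Rightarrow> int) \<Rightarrow> bool" where
  "box v \<longleftrightarrow> (\<forall>j<n. 0 \<le> v j \<and> v j < int (d j))"

lemma eqv_cong: "eqv x y \<Longrightarrow> (\<And>j. j < n \<Longrightarrow> x j = x' j) \<Longrightarrow> (\<And>j. j < n \<Longrightarrow> y j = y' j) \<Longrightarrow> eqv x' y'"
  by (auto simp: eqv_def)

lemma eqv_refl: "eqv x x"
  unfolding eqv_def by (rule exI[of _ "\<lambda>_. 0"]) simp

lemma eqv_add:
  assumes "eqv x y" "eqv x' y'"
  shows "eqv (\<lambda>j. x j + x' j) (\<lambda>j. y j + y' j)"
proof -
  from assms obtain a a' where
    "\<forall>j<n. x j - y j = (\<Sum>i<n. a i * \<rho> i j)" "\<forall>j<n. x' j - y' j = (\<Sum>i<n. a' i * \<rho> i j)"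
    unfolding eqv_def by blast
  then show ?thesis unfolding eqv_def
    by (intro exI[of _ "\<lambda>i. a i + a' i"]) (simp add: algebra_simps sum.distrib)
qed

lemma eqv_mult:
  assumes "eqv x y"
  shows "eqv (\<lambda>j. k * x j) (\<lambda>j. k * y j)"
proof -
  from assms obtain a where "\<forall>j<n. x j - y j = (\<Sum>i<n. a i * \<rho> i j)"
    unfolding eqv_def by blast
  then show ?thesis unfolding eqv_def
    by (intro exI[of _ "\<lambda>i. k * a i"])
      (simp add: right_diff_distrib[symmetric] sum_distrib_left mult.assoc)
qed

lemma eqv_sym:
  assumes "eqv x y" shows "eqv y x"
  using eqv_add[OF eqv_mult[OF assms, of "-1"] eqv_refl[of "\<lambda>j. x j + y j"]] by simp

lemma eqv_trans:
  assumes "eqv x y" "eqv y z" shows "eqv x z"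
  using eqv_add[OF eqv_add[OF assms] eqv_refl[of "\<lambda>j. - y j"]] by simp

lemma eqv_rho:
  assumes "i < n" shows "eqv (\<lambda>j. x j - a * \<rho> i j) x"
proof -
  have "(\<Sum>k<n. (if k = i then - a else 0) * \<rho> k j) = - a * \<rho> i j" for j
    using assms by (subst sum.mono_neutral_right[of _ "{i}"]) auto
  then show ?thesis unfolding eqv_def by (intro exI[of _ "\<lambda>k. if k = i then - a else 0"]) simp
qed

lemma loop_mult:
  assumes "path start x start" "path start (\<lambda>j. - x j) start"
  shows "path start (\<lambda>j. a * x j) start"
proof -
  have nat: "path start (\<lambda>j. int k * x j) start" if "path start x start" for k x
  proof (induction k)
    case (Suc k)
    from path_trans[OF this that] show ?case by (simp add: algebra_simps)
  qed (simp add: path_refl)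
  show ?thesis
    using nat[OF assms(1), of "nat a"] nat[OF assms(2), of "nat (- a)"]
    by (cases "0 \<le> a") auto
qed

text \<open>All loop frequencies form a monoid, but relations come in pairs \<open>\<plusminus>\<rho> i\<close> because the two
  codes of a collision may be exchanged.\<close>

lemma eqv_path:
  assumes "eqv x y" shows "path start (\<lambda>j. x j - y j) start"
proof -
  obtain a where a: "\<forall>j<n. x j - y j = (\<Sum>i<n. a i * \<rho> i j)"
    using assms unfolding eqv_def by blast
  have "path start (\<lambda>j. \<Sum>i<k. a i * \<rho> i j) start" if "k \<le> n" for k
    using that
  proof (induction k)
    case (Suc k)
    have "path start (\<lambda>j. a k * \<rho> k j) start"
      using Suc.prems by (intro loop_mult coll_path coll_rho coll_uminus) auto
    from path_trans[OF _ this] Suc show ?case by simp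
  qed (simp add: path_refl)
  from this[of n] a show ?thesis by (auto elim!: path_cong)
qed

text \<open>At the last index \<open>m\<close> with a nonzero coefficient only the diagonal entry
  contributes, so two box entries would differ by a nonzero multiple of \<open>d m\<close>.\<close>

lemma eqv_box_unique:
  assumes "box v" "box v'" "eqv v v'" "j < n"
  shows "v j = v' j"
proof -
  obtain a where a: "\<forall>j<n. v j - v' j = (\<Sum>i<n. a i * \<rho> i j)"
    using assms unfolding eqv_def by blast
  have "a k = 0" if "k < n" for k
  proof (rule ccontr)
    assume "a k \<noteq> 0"
    define m where "m = Max {k. k < n \<and> a k \<noteq> 0}"
    have "m \<in> {k. k < n \<and> a k \<noteq> 0}" unfolding m_def
      by (rule Max_in) (use that \<open>a k \<noteq> 0\<close> in auto)
    then have m: "m < n" "a m \<noteq> 0" by auto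
    have z: "a j = 0" if "m < j" "j < n" for j
    proof (rule ccontr)
      assume "a j \<noteq> 0"
      then have "j \<le> m" unfolding m_def by (intro Max_ge) (use that in auto)
      with that show False by simp
    qed
    have "a i * \<rho> i m = 0" if "i < n" "i \<noteq> m" for i
      using z[of i] rho_above[of i m] m that by (cases "i < m") auto
    then have "(\<Sum>i<n. a i * \<rho> i m) = a m * \<rho> m m"
      using m by (subst sum.mono_neutral_right[of _ "{m}"]) auto
    with a m have "v m - v' m = a m * int (d m)" by (simp add: rho_diag)
    moreover have "0 \<le> v m" "v m < int (d m)" "0 \<le> v' m" "v' m < int (d m)"
      using assms m by (auto simp: box_def)
    then have "\<bar>v m - v' m\<bar> < int (d m)" by linarith
    moreover have "int (d m) \<le> \<bar>a m * int (d m)\<bar>"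
      using m mult_right_mono[of 1 "\<bar>a m\<bar>" "int (d m)"] by (simp add: abs_mult)
    ultimately show False by simp
  qed
  with a assms show ?thesis by simp
qed

text \<open>Entries are reduced from the top down: a multiple of \<open>\<rho> i\<close> leaves the
  coordinates above \<open>i\<close> alone.\<close>

lemma eqv_box_exists: "\<exists>v. box v \<and> eqv x v"
proof -
  have "\<exists>v. (\<forall>j. n - k \<le> j \<and> j < n \<longrightarrow> 0 \<le> v j \<and> v j < int (d j)) \<and> eqv x v" if "k \<le> n" for k
    using that
  proof (induction k)
    case 0
    then show ?case using eqv_refl by auto
  next
    case (Suc k)
    then obtain v where v: "\<And>j. n - k \<le> j \<Longrightarrow> j < n \<Longrightarrow> 0 \<le> v j \<and> v j < int (d j)" "eqv x v"
      by auto
    define i where "i = n - Suc k"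
    have i: "i < n" using Suc.prems by (simp add: i_def)
    let ?v = "\<lambda>j. v j - (v i div int (d i)) * \<rho> i j"
    have "0 \<le> ?v j \<and> ?v j < int (d j)" if "n - Suc k \<le> j" "j < n" for j
    proof (cases "j = i")
      case True
      then have "?v j = v i mod int (d i)" using i by (simp add: rho_diag minus_div_mult_eq_mod)
      with d_pos[OF i] True show ?thesis by simp
    next
      case False
      then have "i < j" "n - k \<le> j" using that Suc.prems by (auto simp: i_def)
      with v(1)[of j] that show ?thesis by (simp add: rho_above)
    qed
    moreover have "eqv x ?v" using eqv_trans[OF v(2) eqv_sym[OF eqv_rho[OF i]]] .
    ultimately show ?case by (intro exI[of _ ?v]) auto
  qed
  from this[of n] show ?thesis by (auto simp: box_def)
qed

definition \<phi> :: "(nat \<Rightarrow> int) \<Rightarrow> nat" where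
  "\<phi> x = rank d n (SOME v. box v \<and> eqv x v)"

lemma phi_eq:
  assumes "box v" "eqv x v"
  shows "\<phi> x = rank d n v"
proof -
  define w where "w = (SOME v. box v \<and> eqv x v)"
  have w: "box w \<and> eqv x w" unfolding w_def
    by (rule someI[of "\<lambda>v. box v \<and> eqv x v" v]) (use assms in simp)
  have "eqv w v" using eqv_trans[OF eqv_sym[of x w] assms(2)] w by simp
  then have "w j = v j" if "j < n" for j
    using eqv_box_unique[of w v j] assms(1) w that by simp
  then show ?thesis unfolding \<phi>_def w_def[symmetric] by (intro rank_cong) auto
qed

lemma box_unrank_rank: "box v \<Longrightarrow> j < n \<Longrightarrow> unrank d (rank d n v) j = v j"
  unfolding unrank_def by (rule rank_digit) (auto simp: box_def)

lemma phi_unrank: "box (unrank d (\<phi> x)) \<and> eqv x (unrank d (\<phi> x))"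
proof -
  obtain v where v: "box v" "eqv x v" using eqv_box_exists by blast
  have j: "unrank d (\<phi> x) j = v j" if "j < n" for j
    using box_unrank_rank[OF v(1) that] phi_eq[OF v] by simp
  show ?thesis using v eqv_cong[OF v(2)] by (auto simp: box_def j)
qed

lemma phi_eqv:
  assumes "eqv x y"
  shows "\<phi> x = \<phi> y"
proof -
  obtain v where v: "box v" "eqv y v" using eqv_box_exists by blast
  then have "eqv x v" using assms eqv_trans by blast
  then show ?thesis using phi_eq[of v x] phi_eq[of v y] v by simp
qed

lemma phi_eq_iff: "\<phi> x = \<phi> y \<longleftrightarrow> eqv x y"
proof
  assume "\<phi> x = \<phi> y"
  then have "eqv x (unrank d (\<phi> y))" using phi_unrank[of x] by simp
  then show "eqv x y" using eqv_trans eqv_sym phi_unrank[of y] by blast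
qed (rule phi_eqv)

lemma phi_less: "\<phi> x < weight d n"
proof -
  obtain v where v: "box v" "eqv x v" using eqv_box_exists by blast
  show ?thesis unfolding phi_eq[OF v] by (rule rank_less) (use v in \<open>auto simp: box_def d_pos\<close>)
qed

lemma phi_less_pow: "\<phi> x < 2 ^ s"
  using phi_less[of x] weight_le[of n] by simp

lemma phi_0: "\<phi> (\<lambda>_. 0) = 0"
proof -
  have "\<phi> (\<lambda>_. 0) = rank d n (\<lambda>_. 0)"
    by (rule phi_eq) (auto simp: box_def d_pos eqv_refl)
  then show ?thesis by (simp add: rank_def)
qed

text \<open>Clearing coordinate \<open>i\<close> with \<open>\<rho> i\<close> leaves lower entries
  divisible by \<open>weight d i\<close>, hence by \<open>weight d (Suc m)\<close> for each
  \<open>m < i\<close>, and induction removes them. Thus \<open>weight d n\<close> annihilates every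
  unit vector and updates may be reduced modulo it.\<close>

lemma weight_unit_eqv:
  "i < n \<Longrightarrow> int (weight d (Suc i)) dvd k \<Longrightarrow> eqv (\<lambda>j. if j = i then k else 0) (\<lambda>_. 0)"
proof (induction i arbitrary: k rule: less_induct)
  case (less i)
  from less.prems(2) obtain l where "k = int (weight d (Suc i)) * l" by (rule dvdE)
  then have l: "k = int (weight d i) * l * int (d i)" by simp
  define k' where "k' = int (weight d i) * l"
  have lower: "eqv (\<lambda>j. if j < m then - (k' * \<rho> i j) else 0) (\<lambda>_. 0)" if "m \<le> i" for m
    using that
  proof (induction m)
    case (Suc m)
    have "int (weight d (Suc m)) dvd - (k' * \<rho> i m)"
      unfolding k'_def dvd_minus_iff using Suc.prems
      by (intro dvd_mult2) (metis of_nat_dvd_iff weight_dvd)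
    then have "eqv (\<lambda>j. if j = m then - (k' * \<rho> i m) else 0) (\<lambda>_. 0)"
      using Suc.prems less.prems by (intro less.IH) auto
    from eqv_add[OF _ this] Suc have
      "eqv (\<lambda>j. (if j < m then - (k' * \<rho> i j) else 0) + (if j = m then - (k' * \<rho> i m) else 0)) (\<lambda>_. 0)"
      by simp
    then show ?case by (rule eqv_cong) auto
  qed (simp add: eqv_refl)
  have "eqv (\<lambda>j. (if j = i then k else 0) - k' * \<rho> i j) (\<lambda>_. 0)"
    using lower[OF le_refl]
    by (rule eqv_cong) (use less.prems l k'_def rho_diag[of i] rho_above[of i] in
        \<open>auto simp: not_less le_less\<close>)
  from eqv_trans[OF eqv_sym[OF eqv_rho[OF less.prems(1)]] this] show ?case .
qed

lemma eqv_mod_weight: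
  assumes "i < n"
  shows "eqv (\<lambda>j. if j = i then \<Delta> else 0) (\<lambda>j. if j = i then \<Delta> mod int (weight d n) else 0)"
proof -
  have "int (weight d (Suc i)) dvd int (weight d n)"
    using weight_dvd[of "Suc i" n d] assms by (simp only: of_nat_dvd_iff Suc_le_eq)
  then have "int (weight d (Suc i)) dvd \<Delta> - \<Delta> mod int (weight d n)"
    by (meson dvd_minus_mod dvd_trans)
  from eqv_add[OF weight_unit_eqv[OF assms this]
      eqv_refl[of "\<lambda>j. if j = i then \<Delta> mod int (weight d n) else 0"]]
  show ?thesis by (rule eqv_cong) auto
qed

subsection \<open>Reduction by lazy carries\<close>

text \<open>Coordinates with \<open>d j = 1\<close> must stay 0, since a code has no room for many
  nonzero entries. The exception \<open>i\<close> is the coordinate being incremented, which may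
  hold 1 even if \<open>d i = 1\<close>.\<close>

definition lazy :: "nat \<Rightarrow> (nat \<Rightarrow> int) \<Rightarrow> bool" where
  "lazy i y \<longleftrightarrow> (\<forall>j<n. - int (d j) \<le> y j \<and> y j < 2 * int (d j) \<and> (d j = 1 \<and> j \<noteq> i \<longrightarrow> y j = 0))"

definition bad :: "(nat \<Rightarrow> int) \<Rightarrow> nat \<Rightarrow> bool" where
  "bad y k \<longleftrightarrow> y k < 0 \<or> int (d k) \<le> y k"

definition badness :: "(nat \<Rightarrow> int) \<Rightarrow> nat" where
  "badness y = (\<Sum>k | k < n \<and> bad y k. 2 ^ k)"

lemma box_iff_bad: "box y \<longleftrightarrow> (\<forall>k<n. \<not> bad y k)"
  by (auto simp: box_def bad_def not_less not_le)

text \<open>The entries below the lowest bad coordinate \<open>k\<close> lie in the box, so one copy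
  of \<open>\<rho> k\<close> keeps them in the lazy range. New bad coordinates arise only below
  \<open>k\<close>; their weights in \<open>badness\<close> sum to less than the
  \<open>2 ^ k\<close> removed.\<close>

lemma lazy_step:
  assumes "lazy i y" "k < n" "bad y k" "\<And>j. j < k \<Longrightarrow> \<not> bad y j"
  defines "y' \<equiv> \<lambda>j. y j - (if y k < 0 then - 1 else 1) * \<rho> k j"
  shows "lazy i y' \<and> eqv y' y \<and> badness y' < badness y"
proof (intro conjI)
  have k: "y' k = (if y k < 0 then y k + int (d k) else y k - int (d k))"
    using assms by (simp add: rho_diag)
  have above: "y' j = y j" if "k < j" "j < n" for j using that by (simp add: y'_def rho_above)
  have below: "- int (d j) \<le> y' j \<and> y' j < 2 * int (d j) \<and> (d j = 1 \<longrightarrow> y' j = 0)" if "j < k" for j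
    using rho_below[OF assms(2) that] assms(4)[OF that]
    by (auto simp: y'_def bad_def)
  have kk: "0 \<le> y' k" "y' k < int (d k)"
    using k assms(1-3) by (auto simp: lazy_def bad_def split: if_splits)
  show "lazy i y'"
    unfolding lazy_def
  proof (intro allI impI)
    fix j assume j: "j < n"
    consider "j < k" | "j = k" | "k < j" by linarith
    then show "- int (d j) \<le> y' j \<and> y' j < 2 * int (d j) \<and> (d j = 1 \<and> j \<noteq> i \<longrightarrow> y' j = 0)"
    proof cases
      case 1 then show ?thesis using below by blast
    next
      case 2 then show ?thesis using kk by auto
    next
      case 3 then show ?thesis using above[OF 3 j] assms(1) j by (simp add: lazy_def)
    qed
  qed
  show "eqv y' y" unfolding y'_def by (rule eqv_rho) (rule assms)
  have "{j. j < n \<and> bad y' j} \<subseteq> {..<k} \<union> ({j. j < n \<and> bad y j} - {k})"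
  proof
    fix j assume "j \<in> {j. j < n \<and> bad y' j}"
    then have j: "j < n" "bad y' j" by auto
    consider "j < k" | "j = k" | "k < j" by linarith
    then show "j \<in> {..<k} \<union> ({j. j < n \<and> bad y j} - {k})"
      using j kk above by cases (auto simp: bad_def)
  qed
  then have "badness y' \<le> (\<Sum>j\<in>{..<k} \<union> ({j. j < n \<and> bad y j} - {k}). 2 ^ j)"
    unfolding badness_def by (intro sum_mono2) auto
  also have "\<dots> \<le> (\<Sum>j<k. 2 ^ j) + (\<Sum>j\<in>{j. j < n \<and> bad y j} - {k}. (2::nat) ^ j)"
    using sum.union_inter[of "{..<k}" "{j. j < n \<and> bad y j} - {k}" "\<lambda>j. (2::nat) ^ j"] by simp
  also have "(\<Sum>j<k. (2::nat) ^ j) < 2 ^ k"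
    by (induction k) auto
  also have "2 ^ k + (\<Sum>j\<in>{j. j < n \<and> bad y j} - {k}. (2::nat) ^ j) = badness y"
    unfolding badness_def using assms by (subst sum.remove[of _ k]) auto
  finally show "badness y' < badness y" by simp
qed

lemma lazy_incr:
  assumes "box v"
  shows "lazy i (\<lambda>j. v j + (if j = i then 1 else 0))"
  unfolding lazy_def
proof (intro allI impI)
  fix j assume "j < n"
  then have "0 \<le> v j" "v j < int (d j)" using assms by (auto simp: box_def)
  then show "- int (d j) \<le> v j + (if j = i then 1 else 0) \<and>
    v j + (if j = i then 1 else 0) < 2 * int (d j) \<and>
    (d j = 1 \<and> j \<noteq> i \<longrightarrow> v j + (if j = i then 1 else 0) = 0)" by auto
qed

lemma box_lazy: "box v \<Longrightarrow> lazy i v"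
  unfolding box_def lazy_def by force

text \<open>For \<open>2 \<le> d j\<close> the factor \<open>|y j| + 1 \<le> 2 * d j\<close> is at
  most \<open>d j ^ 2\<close>; for \<open>d j = 1\<close> it is 1, except for a possible factor 2 at
  \<open>i\<close>. So the product is at most \<open>2 * (2 ^ s) ^ 2\<close>.\<close>

lemma lazy_code:
  assumes "lazy i y" "m \<le> n"
  shows "vcode (n + 3) m y < M"
proof -
  let ?f = "\<lambda>j. if j = i then 2 else 1 :: nat"
  have "(\<Prod>j<m. nat \<bar>y j\<bar> + 1) \<le> (\<Prod>j<m. ?f j * d j ^ 2)"
  proof (rule prod_mono, intro conjI)
    fix j assume "j \<in> {..<m}"
    then have j: "j < n" using assms by simp
    then have y: "- int (d j) \<le> y j" "y j < 2 * int (d j)" "d j = 1 \<Longrightarrow> j \<noteq> i \<Longrightarrow> y j = 0"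
      using assms by (auto simp: lazy_def)
    have d0: "0 < d j" using d_pos j by simp
    have le: "nat \<bar>y j\<bar> + 1 \<le> 2 * d j" using y d0 by linarith
    have sq: "d j \<le> d j ^ 2" using d0 by (simp add: power2_eq_square)
    consider "j = i" | "j \<noteq> i" "d j = 1" | "2 \<le> d j" using d0 by linarith
    then show "nat \<bar>y j\<bar> + 1 \<le> ?f j * d j ^ 2"
    proof cases
      case 1 then show ?thesis using le sq by auto
    next
      case 2 then show ?thesis using y by auto
    next
      case 3
      then have "2 * d j \<le> d j ^ 2" by (simp add: power2_eq_square)
      with le show ?thesis by auto
    qed
  qed simp
  also have "\<dots> = (\<Prod>j<m. ?f j) * (weight d m) ^ 2"
    by (simp add: prod.distrib weight_def prod_power_distrib)
  also have "\<dots> \<le> 2 * (2 ^ s) ^ 2"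
  proof (rule mult_le_mono)
    show "(\<Prod>j<m. ?f j) \<le> 2" by (simp add: prod.delta)
  qed (use weight_le[OF assms(2)] in \<open>auto intro: power_mono\<close>)
  also have "\<dots> = 2 ^ (2 * s + 1)" by (simp add: power_mult[symmetric] mult.commute)
  finally show ?thesis unfolding M_def by (rule vcode_bound[OF assms(2)]) (use s1 in auto)
qed

lemma dms_less: "i \<le> n \<Longrightarrow> dms i < M"
  unfolding dms_vcode
  by (rule lazy_code) (auto simp: lazy_def dest: d_pos)

end

subsection \<open>The program\<close>

fun seq :: "com list \<Rightarrow> com" where
  "seq [] = Skip"
| "seq (c # cs) = Seq c (seq cs)"

abbreviation "copy i j \<equiv> Assign i AddOp (Reg j) (Num 0)"
abbreviation "const i k \<equiv> Assign i AddOp (Num k) (Num 0)"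
abbreviation "incr i \<equiv> Assign i AddOp (Reg i) (Num 1)"
abbreviation "count_up i j c \<equiv> While (Less (Reg i) (Reg j)) (seq (c @ [incr i]))"

text \<open>Procedures are called by their position in \<open>sketch_program\<close> below, where \<^const>\<open>loads\<close> puts input
  \<open>j\<close> into register \<open>j + 1\<close>.\<close>

text \<open>Inputs: \<open>n, c, j\<close>; computes \<^const>\<open>dec\<close>.\<close>

definition get_body :: com where
  "get_body = seq [
     Assign 1 AddOp (Reg 1) (Num 3),
     While (Less (Num 0) (Reg 2)) (seq [
       Assign 5 ModOp (Reg 2) (Reg 1),
       Assign 2 DivOp (Reg 2) (Reg 1),
       Cond (Less (Reg 5) (Num 2))
         (seq [Assign 4 AddOp (Reg 4) (Reg 4), Assign 4 AddOp (Reg 4) (Reg 5)])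
         (Cond (Eq (Reg 5) (Num 2))
           (Assign 4 SubOp (Num 0) (Reg 4))
           (seq [Assign 5 SubOp (Reg 5) (Num 3),
                 Cond (Eq (Reg 5) (Reg 3)) (copy 0 4) Skip,
                 const 4 0]))])]"

text \<open>Inputs: \<open>n, c, i, x\<close>; computes \<^const>\<open>prep\<close>.\<close>

definition prep_body :: com where
  "prep_body = seq [
     copy 0 2,
     Cond (Eq (Reg 4) (Num 0)) Skip (seq [
       Assign 1 AddOp (Reg 1) (Num 3),
       Assign 0 MulOp (Reg 0) (Reg 1),
       Assign 3 AddOp (Reg 3) (Num 3),
       Assign 0 AddOp (Reg 0) (Reg 3),
       Cond (Less (Reg 4) (Num 0))
         (seq [Assign 0 MulOp (Reg 0) (Reg 1), Assign 0 AddOp (Reg 0) (Num 2),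
               Assign 4 SubOp (Num 0) (Reg 4)])
         Skip,
       While (Less (Num 0) (Reg 4)) (seq [
         Assign 5 ModOp (Reg 4) (Num 2),
         Assign 0 MulOp (Reg 0) (Reg 1),
         Assign 0 AddOp (Reg 0) (Reg 5),
         Assign 4 DivOp (Reg 4) (Num 2)])])]"

text \<open>Inputs: \<open>n, p, c, \<epsilon>\<close>; computes \<open>walk\<close>.\<close>

definition walk_body :: com where
  "walk_body = seq [
     copy 0 2,
     count_up 5 1 [
       Call 6 3 [Reg 1, Reg 3, Reg 5],
       Assign 6 MulOp (Reg 4) (Reg 6),
       Query 0 0 [Reg 0, Reg 5, Reg 6]]]"

text \<open>Inputs: \<open>n, p, c\<close>; compute \<open>pre\<close> and \<open>mid\<close>.\<close>

definition pre_body :: com where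
  "pre_body = seq [
     copy 0 2,
     count_up 4 3 [
       Call 0 5 [Reg 1, Reg 0, Reg 4, Num 1],
       Call 0 5 [Reg 1, Reg 0, Reg 4, Num (-1)]]]"

definition mid_body :: com where
  "mid_body = seq [
     Call 2 6 [Reg 1, Reg 2, Reg 3],
     Call 0 5 [Reg 1, Reg 2, Reg 3, Num 1]]"

definition pow_body :: com where
  "pow_body = seq [const 0 1, count_up 3 2 [Assign 0 MulOp (Reg 0) (Reg 1)]]"

text \<open>Inputs: \<open>n, M, 2^s\<close> and the initial state; computes \<open>start\<close>.\<close>

definition start_body :: com where
  "start_body = seq [copy 0 4, count_up 5 3 [Call 0 6 [Reg 1, Reg 0, Reg 2]]]"

text \<open>Inputs: \<open>n, M, start, dm, i, t\<close>; decides \<open>ok dm i t\<close>.\<close>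

definition ok_body :: com where
  "ok_body = seq [
     Assign 7 DivOp (Reg 6) (Reg 2),
     Assign 8 ModOp (Reg 7) (Reg 2),
     Assign 7 DivOp (Reg 7) (Reg 2),
     Assign 9 ModOp (Reg 6) (Reg 2),
     Call 11 7 [Reg 1, Reg 3, Reg 8],
     Call 12 7 [Reg 1, Reg 3, Reg 9],
     Cond (Conj (Eq (Reg 11) (Reg 12)) (Less (Num 0) (Reg 7))) (const 0 1) Skip,
     count_up 10 1 [
       Call 11 3 [Reg 1, Reg 8, Reg 10],
       Call 12 3 [Reg 1, Reg 9, Reg 10],
       Assign 11 SubOp (Reg 11) (Reg 12),
       Call 12 3 [Reg 1, Reg 4, Reg 10],
       Assign 13 SubOp (Num 0) (Reg 11),
       Cond (Less (Reg 10) (Reg 5))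
         (Cond (Conj (Neg (Less (Reg 12) (Reg 11))) (Neg (Less (Reg 12) (Reg 13)))) Skip (const 0 0))
         (Cond (Eq (Reg 10) (Reg 5))
           (Cond (Eq (Reg 11) (Reg 7)) Skip (const 0 0))
           (Cond (Eq (Reg 11) (Num 0)) Skip (const 0 0)))]]"

text \<open>Inputs: \<open>n, M, start, dm, i\<close>; computes \<open>rel\<close>.\<close>

definition rel_body :: com where
  "rel_body = seq [
     Call 6 10 [Reg 1, Reg 2, Reg 3, Reg 4, Reg 5, Reg 0],
     While (Eq (Reg 6) (Num 0)) (seq [
       incr 0,
       Call 6 10 [Reg 1, Reg 2, Reg 3, Reg 4, Reg 5, Reg 0]])]"

text \<open>Inputs: \<open>n, M, start\<close>; computes \<open>dms n\<close>.\<close>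

definition dms_body :: com where
  "dms_body = seq [
     count_up 4 1 [
       Call 5 11 [Reg 1, Reg 2, Reg 3, Reg 0, Reg 4],
       Assign 5 DivOp (Reg 5) (Reg 2),
       Assign 5 DivOp (Reg 5) (Reg 2),
       Assign 5 SubOp (Reg 5) (Num 1),
       Call 0 4 [Reg 1, Reg 0, Reg 4, Reg 5]]]"

text \<open>Inputs: \<open>n, y, \<epsilon>, c1, c2\<close>; computes \<open>y - \<epsilon> * (c1 - c2)\<close> on codes.\<close>

definition axpy_body :: com where
  "axpy_body = seq [
     count_up 6 1 [
       Call 7 3 [Reg 1, Reg 4, Reg 6],
       Call 8 3 [Reg 1, Reg 5, Reg 6],
       Assign 7 SubOp (Reg 7) (Reg 8),
       Assign 7 MulOp (Reg 3) (Reg 7),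
       Call 8 3 [Reg 1, Reg 2, Reg 6],
       Assign 7 SubOp (Reg 8) (Reg 7),
       Call 0 4 [Reg 1, Reg 0, Reg 6, Reg 7]]]"

text \<open>Inputs: \<open>n, dm, y\<close>; the least coordinate in which the vector is out of range, or \<open>n\<close>.\<close>

definition badx_body :: com where
  "badx_body = seq [
     copy 0 1,
     copy 4 1,
     While (Less (Num 0) (Reg 4)) (seq [
       Assign 4 SubOp (Reg 4) (Num 1),
       Call 5 3 [Reg 1, Reg 3, Reg 4],
       Call 6 3 [Reg 1, Reg 2, Reg 4],
       Cond (Less (Reg 5) (Num 0)) (copy 0 4)
         (Cond (Less (Reg 6) (Reg 5)) (copy 0 4) Skip)])]"

text \<open>Inputs: \<open>n, M, start, dm, y\<close>; reduces \<open>y\<close> modulo the lattice.\<close>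

definition norm_body :: com where
  "norm_body = seq [
     copy 0 5,
     Call 6 14 [Reg 1, Reg 4, Reg 0],
     While (Less (Reg 6) (Reg 1)) (seq [
       Call 7 11 [Reg 1, Reg 2, Reg 3, Reg 4, Reg 6],
       Assign 8 DivOp (Reg 7) (Reg 2),
       Assign 8 ModOp (Reg 8) (Reg 2),
       Assign 7 ModOp (Reg 7) (Reg 2),
       Call 9 3 [Reg 1, Reg 0, Reg 6],
       Cond (Less (Reg 9) (Num 0)) (const 9 (-1)) (const 9 1),
       Call 0 13 [Reg 1, Reg 0, Reg 9, Reg 8, Reg 7],
       Call 6 14 [Reg 1, Reg 4, Reg 0]])]"

text \<open>Inputs: \<open>n, dm\<close> and a number or a code; conversion between mixed radix and sparse codes.\<close>

definition unrank_body :: com where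
  "unrank_body = seq [
     const 4 1,
     count_up 5 1 [
       Call 6 3 [Reg 1, Reg 2, Reg 5],
       Assign 6 AddOp (Reg 6) (Num 1),
       Assign 7 DivOp (Reg 3) (Reg 4),
       Assign 7 ModOp (Reg 7) (Reg 6),
       Call 0 4 [Reg 1, Reg 0, Reg 5, Reg 7],
       Assign 4 MulOp (Reg 4) (Reg 6)]]"

definition rank_body :: com where
  "rank_body = seq [
     const 4 1,
     count_up 5 1 [
       Call 6 3 [Reg 1, Reg 2, Reg 5],
       Assign 6 AddOp (Reg 6) (Num 1),
       Call 7 3 [Reg 1, Reg 3, Reg 5],
       Assign 7 MulOp (Reg 7) (Reg 4),
       Assign 0 AddOp (Reg 0) (Reg 7),
       Assign 4 MulOp (Reg 4) (Reg 6)]]"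

text \<open>The order of the quotient, which is the modulus for incoming updates.\<close>

definition weight_body :: com where
  "weight_body = seq [
     const 0 1,
     count_up 3 1 [
       Call 4 3 [Reg 1, Reg 2, Reg 3],
       Assign 4 AddOp (Reg 4) (Num 1),
       Assign 0 MulOp (Reg 0) (Reg 4)]]"

text \<open>Inputs: \<open>n, M, start, dm, v, i, a\<close>; adds the \<open>i\<close>-th unit vector \<open>a\<close> times.\<close>

definition addn_body :: com where
  "addn_body = seq [
     copy 0 5,
     Call 8 4 [Reg 1, Num 0, Reg 6, Num 1],
     count_up 9 7 [
       Call 0 13 [Reg 1, Reg 0, Num (-1), Reg 8, Num 0],
       Call 0 15 [Reg 1, Reg 2, Reg 3, Reg 4, Reg 0]]]"

text \<open>From \<open>n\<close>, \<open>s\<close> and the initial state of the given algorithm in registers 1 to 3, put \<open>M\<close>,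
  \<open>start\<close> and \<open>dms n\<close> into registers 6 to 8.\<close>

definition prologue :: "com list" where
  "prologue = [
     Assign 6 AddOp (Reg 1) (Num 3),
     Assign 7 MulOp (Reg 2) (Num 9),
     Call 6 8 [Reg 6, Reg 7],
     Call 7 8 [Num 2, Reg 2],
     Call 7 9 [Reg 1, Reg 6, Reg 7, Reg 3],
     Call 8 12 [Reg 1, Reg 6, Reg 7]]"

text \<open>The update \<open>\<Delta>\<close> on input tape 5 is too long to be stored; it is reduced modulo the order of
  the quotient in register 9 while it is read.\<close>

definition mod_body :: "com list" where
  "mod_body = [
     const 10 0,
     const 11 0,
     MoveRight 5,
     Cond (Eq (Sym 5) (Num 2)) (seq [const 11 1, MoveRight 5]) Skip,
     While (Neg (Eq (Sym 5) (Num 3))) (seq [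
       Assign 10 AddOp (Reg 10) (Reg 10),
       Assign 10 AddOp (Reg 10) (Sym 5),
       Assign 10 ModOp (Reg 10) (Reg 9),
       MoveRight 5]),
     Cond (Eq (Reg 11) (Num 1))
       (seq [Assign 10 SubOp (Num 0) (Reg 10), Assign 10 ModOp (Reg 10) (Reg 9)]) Skip]"

text \<open>The budget for \<open>s = 0\<close> does not even allow to load \<open>n\<close>, hence the test before the other inputs
  are loaded.\<close>

definition trans_body :: com where
  "trans_body = Seq (Load 2 1) (Cond (Eq (Reg 2) (Num 0)) Skip (Seq (loads 5) (seq (prologue @ [Call 9 18 [Reg 1, Reg 8]] @ mod_body @ [
     Call 4 16 [Reg 1, Reg 8, Reg 4],
     Call 4 19 [Reg 1, Reg 6, Reg 7, Reg 8, Reg 4, Reg 5, Reg 10],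
     Call 0 17 [Reg 1, Reg 8, Reg 4]]))))"

definition post_body :: com where
  "post_body = Seq (Load 2 1) (Cond (Eq (Reg 2) (Num 0)) (Query 0 1 [Num 0]) (Seq (loads 4) (seq (prologue @ [
     Call 4 16 [Reg 1, Reg 8, Reg 4],
     Call 4 5 [Reg 1, Reg 7, Reg 4, Num 1],
     Query 0 1 [Reg 4]]))))"

text \<open>Position 2 supplies the initial state 0, which register 0 of a fresh frame already
  holds.\<close>

definition sketch_program :: "com list" where
  "sketch_program = [
     Seq (loads 0) trans_body, Seq (loads 0) post_body, Seq (loads 0) Skip,
     Seq (loads 3) get_body, Seq (loads 4) prep_body, Seq (loads 4) walk_body,
     Seq (loads 3) pre_body, Seq (loads 3) mid_body, Seq (loads 2) pow_body,
     Seq (loads 4) start_body, Seq (loads 6) ok_body, Seq (loads 5) rel_body,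
     Seq (loads 3) dms_body, Seq (loads 5) axpy_body, Seq (loads 3) badx_body,
     Seq (loads 5) norm_body, Seq (loads 3) unrank_body, Seq (loads 3) rank_body,
     Seq (loads 2) weight_body, Seq (loads 7) addn_body]"

lemma wp_mono:
  "wp C E b xs c Q f \<Longrightarrow> (\<And>f. Q f \<Longrightarrow> Q' f) \<Longrightarrow> wp C E b xs c Q' f"
proof (induction c arbitrary: Q Q' f)
  case (Seq c1 c2)
  from Seq.prems(1) have "wp C E b xs c1 (wp C E b xs c2 Q) f" by simp
  then have "wp C E b xs c1 (wp C E b xs c2 Q') f"
    by (rule Seq.IH(1)) (rule Seq.IH(2)[OF _ Seq.prems(2)])
  then show ?case by simp
next
  case (While t c)
  from While.prems show ?case unfolding wp.simps by blast
next
  case (Cond t c1 c2)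
  then show ?case by simp blast
next
  case (Call i p as)
  then show ?case by simp blast
next
  case (Query i p as)
  then show ?case by simp blast
qed simp_all

lemma wp_for:
  assumes "fst f v = 0" "J 0 (fst f)" "\<And>j r. J j r \<Longrightarrow> r w = int N"
    and "\<And>j r h. j < N \<Longrightarrow> r v = int j \<Longrightarrow> J j r \<Longrightarrow>
           wp C E b xs c (\<lambda>f'. fst f' v = int (Suc j) \<and> J (Suc j) (fst f')) (r, h)"
    and "\<And>r h. r v = int N \<Longrightarrow> J N r \<Longrightarrow> Q (r, h)"
  shows "wp C E b xs (While (Less (Reg v) (Reg w)) c) Q f"
proof (rule wp_While[where I = "\<lambda>f. \<exists>j\<le>N. fst f v = int j \<and> J j (fst f)" and
      \<mu> = "\<lambda>f. nat (int N - fst f v)"])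
  show "\<exists>j\<le>N. fst f v = int j \<and> J j (fst f)" using assms(1,2) by (intro exI[of _ 0]) auto
next
  fix r h
  assume "\<exists>j\<le>N. fst (r, h) v = int j \<and> J j (fst (r, h))"
    "test_val xs (r, h) (Less (Reg v) (Reg w))"
  then obtain j where j: "r v = int j" "J j r" "j < N" using assms(3) by fastforce
  have imp: "(\<exists>j\<le>N. fst f' v = int j \<and> J j (fst f')) \<and> nat (int N - fst f' v) < nat (int N - fst (r, h) v)"
    if "fst f' v = int (Suc j) \<and> J (Suc j) (fst f')" for f'
    using that j by (intro conjI exI[of _ "Suc j"]) auto
  show "wp C E b xs c (\<lambda>f'. (\<exists>j\<le>N. fst f' v = int j \<and> J j (fst f')) \<and>
    nat (int N - fst f' v) < nat (int N - fst (r, h) v)) (r, h)"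
    using wp_mono[OF assms(4)[OF j(3,1,2)] imp] .
next
  fix r h
  assume "\<exists>j\<le>N. fst (r, h) v = int j \<and> J j (fst (r, h))"
    "\<not> test_val xs (r, h) (Less (Reg v) (Reg w))"
  then obtain j where j: "r v = int j" "J j r" "j \<le> N" "\<not> r v < r w" by auto
  with assms(3)[of j r] have "j = N" by auto
  with j assms(5) show "Q (r, h)" by simp
qed

subsection \<open>Correctness and space of the program\<close>

lemma wp_Skip [simp]: "wp C E b xs Skip = (\<lambda>Q. Q)"
  by (intro ext) simp

text \<open>The largest register contents are packed relations, at most
  \<open>8 * M * M * M\<close>, which is below \<open>M ^ 4\<close>. The assumption
  \<open>S \<le> b\<close> makes room for an output of the given algorithm.\<close>

locale sketch = automaton +
  fixes \<Gamma> :: "com list" and S b :: nat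
  assumes impl: "implements_in_space no_externals \<Gamma> [] n A S" and b: "M ^ 4 \<le> 2 ^ b" and S_le_b: "S \<le> b"
begin

text \<open>\<open>k\<close> bounds the call depth: each level pays for 14 registers, and
  \<open>S\<close> is reserved for one run of the given algorithm. The lower bounds on
  \<open>k\<close> below are the depths of the procedures.\<close>

definition cmp :: "nat \<Rightarrow> call_spec" where
  "cmp k p as y \<longleftrightarrow> computes (access \<Gamma>) sketch_program p as (k * (14 * (b + 2)) + S) y"

definition ext :: "nat \<Rightarrow> call_spec" where
  "ext k p as y \<longleftrightarrow> access \<Gamma> p as (k * (14 * (b + 2)) + S) y"

lemma M_ge: "2 ^ 18 \<le> M" and n_le_M: "n + 3 \<le> M" and s_le_M: "9 * s \<le> M"
proof -
  have "(2::nat) ^ 18 \<le> 2 ^ (18 * s)" using s1 by (intro power_increasing) auto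
  then show "2 ^ 18 \<le> M" using pow_le_M[of "18 * s"] by linarith
  have "(n + 3) ^ 1 \<le> M" unfolding M_def using s1 by (intro power_increasing) auto
  then show "n + 3 \<le> M" by simp
  have "9 * s < 2 ^ (9 * s)" by (rule less_exp)
  also have "\<dots> \<le> M" by (rule pow_le_M) simp
  finally show "9 * s \<le> M" by simp
qed

lemma small_cube: "\<bar>x\<bar> \<le> int (8 * M * M * M) \<Longrightarrow> small b x"
proof -
  assume x: "\<bar>x\<bar> \<le> int (8 * M * M * M)"
  have "8 * M * M * M < M * (M * M * M)"
    using M_ge by (intro le_less_trans[OF _ mult_strict_right_mono[of 8 M]]) auto
  also have "\<dots> = M ^ 4" by (simp add: power4_eq_xxxx algebra_simps)
  also have "\<dots> \<le> 2 ^ b" by (rule b)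
  finally have "int (8 * M * M * M) < int (2 ^ b)" by (simp only: of_nat_less_iff)
  with x show ?thesis by (simp add: small_def)
qed

lemma small_M: "\<bar>x\<bar> \<le> 8 * int M \<Longrightarrow> small b x"
proof -
  assume "\<bar>x\<bar> \<le> 8 * int M"
  also have "8 * M * 1 * 1 \<le> 8 * M * M * M" using M_pos by (intro mult_le_mono) auto
  then have "8 * int M \<le> int (8 * M * M * M)" by linarith
  finally show ?thesis by (rule small_cube)
qed

lemma small_nat: "x \<le> 8 * M \<Longrightarrow> small b (int x)"
  by (rule small_M) linarith

lemma small_const [simp]: "small b 0" "small b 1" "small b 2" "small b (- 1)"
  using M_ge by (auto intro!: small_M)

lemma procI:
  assumes "0 < k" "p < length sketch_program" "sketch_program ! p = Seq (loads l) c" "l < 14"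
    "com_regs c \<subseteq> {..<14}" "l \<le> length xs" "\<And>j. j < l \<Longrightarrow> small b (xs ! j)"
    "wp (cmp (k - 1)) (ext (k - 1)) b xs c (\<lambda>f. fst f 0 = y) (loaded l xs (\<lambda>_. 0), \<lambda>_. 0)"
  shows "cmp k p xs y"
proof -
  obtain k' where k: "k = Suc k'" using assms(1) by (cases k) auto
  show ?thesis unfolding cmp_def
    by (rule computesI[where C = "cmp k'" and E = "ext k'", OF assms(2-5) _ _ _ assms(6,7)])
      (use assms(8) in \<open>auto simp: cmp_def ext_def k\<close>)
qed

lemma ext_transition:
  assumes "reach p" "i < n"
  shows "ext k 0 [int p, int i, x] (int (transition A p (i, x)))"
proof -
  have "computes no_externals \<Gamma> 0 [int p, int i, x] S (int (transition A p (i, x)))"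
    using impl assms by (auto simp: implements_in_space_def reach_iff Let_def)
  then show ?thesis unfolding ext_def access_def by (auto elim: computes_mono)
qed

lemma small_reach: "reach p \<Longrightarrow> small b (int p)"
proof -
  assume "reach p"
  then have "p < 2 ^ s" by (rule reach_less)
  also have "\<dots> \<le> M" by (rule pow_le_M) simp
  finally show ?thesis by (intro small_nat) simp
qed

section \<open>Decoding and extending codes\<close>

lemma get_ok:
  assumes k: "1 \<le> k" and c: "c < M" and j: "j \<le> n"
  shows "cmp k 3 [int n, int c, int j] (dec n c j)"
proof (rule procI[where l = 3 and c = get_body])
  let ?xs = "[int n, int c, int j]"
  show "small b (?xs ! i)" if "i < 3" for i
    using that c j n_le_M by (auto simp: less_Suc_eq numeral_3_eq_3 intro!: small_nat)
  define B where "B = n + 3"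
  \<comment> \<open>The potential of \<open>getv_step_bound\<close> bounds the partial value and the
    unread code at the same time.\<close>
  let ?I = "\<lambda>f :: frame. fst f 1 = int B \<and> fst f 3 = int j \<and> 0 \<le> fst f 2 \<and>
    getv B (nat (fst f 2)) j (fst f 4) (fst f 0) = dec n c j \<and>
    (\<bar>fst f 4\<bar> + 1) * (fst f 2 + 1) \<le> int M \<and> \<bar>fst f 0\<bar> < int M"
  have B: "int n + 3 = int B" "4 \<le> B" "B \<le> M" using n1 n_le_M by (auto simp: B_def)
  show "wp (cmp (k - 1)) (ext (k - 1)) b ?xs get_body (\<lambda>f. fst f 0 = dec n c j) (loaded 3 ?xs (\<lambda>_. 0), \<lambda>_. 0)"
  proof (unfold get_body_def seq.simps wp.simps(1-7), intro conjI, goal_cases)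
    case 1
    show ?case using B by (auto simp: loaded_def intro!: small_nat)
  next
    case 2
    show ?case
    proof (rule wp_While[where I = ?I and \<mu> = "\<lambda>f. nat (fst f 2)"], goal_cases)
      case 1
      show ?case using c B by (simp add: loaded_def dec_def B_def[symmetric])
    next
      case (2 r h)
      note I = 2(1) and t = 2(2)
    define e where "e = nat (r 2)"
    define a where "a = e mod B"
    define q where "q = e div B"
    have r: "r 1 = int B" "r 3 = int j" "r 2 = int e" "0 < e" using I t by (auto simp: e_def)
    have aq: "int e mod int B = int a" "int e div int B = int q" "a < B" "q < e"
      using B r by (auto simp: a_def q_def zmod_int zdiv_int)
    have inv: "getv B e j (r 4) (r 0) = dec n c j" "(\<bar>r 4\<bar> + 1) * (int e + 1) \<le> int M" "\<bar>r 0\<bar> < int M"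
      using I r by auto
    have step: "(\<bar>v\<bar> + 1) * (int q + 1) \<le> int M" if "\<bar>v\<bar> + 1 \<le> 2 * (\<bar>r 4\<bar> + 1)" for v
      unfolding q_def by (rule getv_step_bound[OF inv(2) B(2) _ that]) (use r in auto)
    have r4: "\<bar>r 4\<bar> < int M"
    proof -
      have "\<bar>r 4\<bar> + 1 \<le> (\<bar>r 4\<bar> + 1) * (int e + 1)"
        using mult_left_mono[of 1 "int e + 1" "\<bar>r 4\<bar> + 1"] by simp
      with inv(2) show ?thesis by linarith
    qed
    have eM: "int e + 1 \<le> int M"
    proof -
      have "int e + 1 \<le> (\<bar>r 4\<bar> + 1) * (int e + 1)"
        using mult_right_mono[of 1 "\<bar>r 4\<bar> + 1" "int e + 1"] by simp
      with inv(2) show ?thesis by linarith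
    qed
    have sm: "small b (int a)" "small b (int q)" "small b (r 4)" "small b (- r 4)" "small b (r 4 + r 4)"
      "a < 2 \<Longrightarrow> small b (r 4 + r 4 + int a)" "small b (int a - 3)"
      using aq B r4 eM by (auto intro!: small_M)
    note get = getv.simps[of B e j "r 4" "r 0", folded a_def q_def, unfolded inv(1)]
    have nB: "\<not> (e = 0 \<or> B < 2)" using r B by auto
    consider "a < 2" | "a = 2" | "3 \<le> a" "a = j + 3" | "3 \<le> a" "a \<noteq> j + 3" by linarith
    then show ?case
    proof cases
      case 1
      have "\<bar>r 4 + r 4 + int a\<bar> + 1 \<le> 2 * (\<bar>r 4\<bar> + 1)"
      proof -
        have "int a \<le> 1" using 1 by simp
        then show ?thesis using abs_triangle_ineq[of "2 * r 4" "int a"] by (simp add: abs_mult)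
      qed
      from step[OF this] 1 get nB r aq sm inv show ?thesis by simp
    next
      case 2
      from step[of "- r 4"] 2 get nB r aq sm inv show ?thesis by simp
    next
      case 3
      from step[of 0] 3 get nB r aq sm inv r4 show ?thesis by simp
    next
      case 4
      from step[of 0] 4 get nB r aq sm inv r4 show ?thesis by simp
    qed
    next
      case (3 r h)
      then have "r 2 = 0" by auto
      with 3 show ?case by (simp add: getv.simps)
    qed
  qed
qed (use k in \<open>auto simp: sketch_program_def get_body_def\<close>)

lemma exC: "cmp k p as y \<Longrightarrow> P y \<Longrightarrow> \<exists>y. cmp k p as y \<and> P y"
  by auto

text \<open>Pushing digits never decreases a code, so the bound on the final code covers all
  intermediate ones.\<close>

lemma prep_ok:
  assumes k: "1 \<le> k" and c: "prep (n + 3) c i x < M" and i: "i < n" and x: "\<bar>x\<bar> \<le> 8 * int M"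
  shows "cmp k 4 [int n, int c, int i, x] (int (prep (n + 3) c i x))"
proof (rule procI[where l = 4 and c = prep_body])
  let ?xs = "[int n, int c, int i, x]"
  have cM: "c < M" using c prep_ge[of "n + 3" c i x] by simp
  show "small b (?xs ! j)" if "j < 4" for j
    using that cM i n_le_M x by (auto simp: less_Suc_eq numeral_eq_Suc intro!: small_nat small_M)
  define B where "B = n + 3"
  have B: "int n + 3 = int B" "4 \<le> B" "B \<le> M" using n1 n_le_M by (auto simp: B_def)
  define c1 where "c1 = (if x < 0 then (c * B + (3 + i)) * B + 2 else c * B + (3 + i))"
  let ?I = "\<lambda>f :: frame. fst f 1 = int B \<and> 0 \<le> fst f 0 \<and> 0 \<le> fst f 4 \<and> \<bar>fst f 4\<bar> \<le> 8 * int M \<and>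
    pbits B (nat (fst f 0)) (nat (fst f 4)) = prep (n + 3) c i x"
  let ?loop = "While (Less (Num 0) (Reg 4)) (seq [
         Assign 5 ModOp (Reg 4) (Num 2),
         Assign 0 MulOp (Reg 0) (Reg 1),
         Assign 0 AddOp (Reg 0) (Reg 5),
         Assign 4 DivOp (Reg 4) (Num 2)])"
  have loop: "wp (cmp (k - 1)) (ext (k - 1)) b ?xs ?loop (\<lambda>f. fst f 0 = int (prep (n + 3) c i x)) (r, h)"
    if "?I (r, h)" for r h
  proof (rule wp_While[where I = ?I and \<mu> = "\<lambda>f. nat (fst f 4)"], goal_cases)
    case 1
    show ?case by (rule that)
  next
    case (2 r h)
    define e where "e = nat (r 0)"
    define v where "v = nat (r 4)"
    have r: "r 1 = int B" "r 0 = int e" "r 4 = int v" "0 < v" using 2 by (auto simp: e_def v_def)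
    define a where "a = v mod 2"
    define q where "q = v div 2"
    have aq: "int v mod 2 = int a" "int v div 2 = int q" "a < 2" "q < v"
      using r by (simp_all add: a_def q_def zmod_int zdiv_int)
    have p: "pbits B (e * B + a) q = prep (n + 3) c i x"
      using 2 r by (subst (asm) pbits.simps) (simp add: a_def q_def)
    have "e * B + a \<le> prep (n + 3) c i x" unfolding p[symmetric] using B by (intro pbits_ge) simp
    then have le: "e * B + a < M" using c by simp
    have "v \<le> 8 * M" using 2 r by auto
    with aq have q: "q \<le> 8 * M" by simp
    have sm: "small b (int (e * B))" "small b (int (e * B + a))" "small b (int a)" "small b (int q)"
      using le q by (auto intro!: small_nat simp del: of_nat_add of_nat_mult)
    have n1: "nat (int e * int B + int a) = e * B + a"
      by (simp add: nat_add_distrib nat_mult_distrib)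
    show ?case using r p sm aq q n1 by simp
  next
    case (3 r h)
    then have "r 4 = 0" by auto
    with 3 show ?case by (simp add: pbits.simps) arith
  qed
  show "wp (cmp (k - 1)) (ext (k - 1)) b ?xs prep_body (\<lambda>f. fst f 0 = int (prep (n + 3) c i x)) (loaded 4 ?xs (\<lambda>_. 0), \<lambda>_. 0)"
  proof (cases "x = 0")
    case True
    then show ?thesis using small_nat[of c] cM by (simp add: prep_body_def loaded_def prep_def)
  next
    case False
    have p: "prep (n + 3) c i x = pbits B c1 (nat \<bar>x\<bar>)"
      using False by (simp add: prep_def c1_def B_def)
    have "c1 \<le> prep (n + 3) c i x" unfolding p using B by (intro pbits_ge) simp
    then have c1: "c1 < M" using c by simp
    define c2 where "c2 = c * B + (3 + i)"
    have c2: "c2 \<le> c1" "c * B \<le> c1" "x < 0 \<Longrightarrow> c2 * B \<le> c1" "x < 0 \<Longrightarrow> c1 = c2 * B + 2" "\<not> x < 0 \<Longrightarrow> c1 = c2"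
    proof -
      have "c2 * 1 \<le> c2 * B" using B by (intro mult_le_mono) auto
      moreover show eq: "x < 0 \<Longrightarrow> c1 = c2 * B + 2" "\<not> x < 0 \<Longrightarrow> c1 = c2"
        by (auto simp: c1_def c2_def)
      ultimately show "c2 \<le> c1" by (cases "x < 0") linarith+
      moreover have "c * B \<le> c2" by (simp add: c2_def)
      ultimately show "c * B \<le> c1" by (rule le_trans[rotated])
      show "x < 0 \<Longrightarrow> c2 * B \<le> c1" using eq by simp
    qed
    define i3 where "i3 = i + 3"
    have e: "int i + 3 = int i3" "int c * int B + int i3 = int c2" by (auto simp: c2_def i3_def)
    have sm: "small b (int c)" "small b (int c * int B)" "small b (int c2)" "small b (int i3)" "small b (int B)"
      "small b (- x)" "small b x"
      using c1 c2(1,2) cM i n_le_M B x i3_def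
      by (auto intro!: small_nat small_M simp del: of_nat_add simp: of_nat_mult[symmetric] simp del: of_nat_mult)
    show ?thesis
    proof (cases "x < 0")
      case True
      have sm2: "small b (int c2 * int B)" "small b (int c2 * int B + 2)"
        using c1 c2(3,4) True small_nat[of "c2 * B"] small_nat[of c1] by (auto simp: add.commute)
      have I: "?I (r, h)" if "r 1 = int B" "r 0 = int c2 * int B + 2" "r 4 = - x" for r h
      proof -
        have "nat (int c2 * int B + 2) = c1" using c2(4) True
          by (simp add: nat_add_distrib nat_mult_distrib)
        then have "pbits B (nat (r 0)) (nat (r 4)) = prep (n + 3) c i x"
          using that True p by simp
        moreover have "0 \<le> r 0" unfolding that by simp
        ultimately show ?thesis using that True x by simp
      qed
      show ?thesis
        using False True sm sm2 B e
        by (simp add: prep_body_def loaded_def del: wp.simps(8) One_nat_def)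
          (rule loop[unfolded seq.simps], rule I; simp)
    next
      case nonneg: False
      have I: "?I (r, h)" if "r 1 = int B" "r 0 = int c2" "r 4 = x" for r h
        using that nonneg x p c2(5) by auto
      show ?thesis
        using False nonneg sm B e
        by (simp add: prep_body_def loaded_def del: wp.simps(8) One_nat_def)
          (rule loop[unfolded seq.simps], rule I; simp)
    qed
  qed
qed (use k in \<open>auto simp: sketch_program_def prep_body_def\<close>)

end

text \<open>Register 1 and the level \<open>k - 1\<close> must keep their form under simplification.\<close>

declare One_nat_def [simp del]

context sketch
begin

lemma small_le_n: "j \<le> n \<Longrightarrow> small b (int j)"
  using n_le_M by (intro small_nat) simp

lemma dec_small: "c < M \<Longrightarrow> \<bar>dec n c j\<bar> < int M"
  using dec_bound[OF n1, of c j] by linarith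

lemma small_dec: "c < M \<Longrightarrow> small b (dec n c j)"
  using dec_small[of c j] by (intro small_M) linarith

section \<open>Walks, powers and the start state\<close>

lemma walk_ok:
  assumes k: "2 \<le> k" and p: "reach p" and c: "c < M" and e: "\<epsilon> = 1 \<or> \<epsilon> = - 1"
  shows "cmp k 5 [int n, int p, int c, \<epsilon>] (int (walk p c \<epsilon> n))"
proof (rule procI[where l = 4 and c = walk_body])
  let ?xs = "[int n, int p, int c, \<epsilon>]"
  have sm: "small b (int c)" using c by (intro small_nat) simp
  show "small b (?xs ! j)" if "j < 4" for j
    using that small_reach[OF p] sm small_le_n[of n] e
    by (auto simp: less_Suc_eq numeral_eq_Suc)
  show "wp (cmp (k - 1)) (ext (k - 1)) b ?xs walk_body (\<lambda>f. fst f 0 = int (walk p c \<epsilon> n)) (loaded 4 ?xs (\<lambda>_. 0), \<lambda>_. 0)"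
  proof (unfold walk_body_def seq.simps append.simps wp.simps(2-7) wp_Skip, intro conjI, goal_cases)
    case 1
    show ?case using small_reach[OF p] by (simp add: loaded_def)
  next
    case 2
    show ?case
    proof (rule wp_for[where N = n and J = "\<lambda>j r. r 1 = int n \<and> r 3 = int c \<and> r 4 = \<epsilon> \<and>
        r 0 = int (walk p c \<epsilon> j)"], goal_cases)
      case (4 j r h)
      have g: "cmp (k - 1) 3 [int n, int c, int j] (dec n c j)"
        using 4 k c by (intro get_ok) auto
      have q: "ext (k - 1) 0 [int (walk p c \<epsilon> j), int j, \<epsilon> * dec n c j] (int (walk p c \<epsilon> (Suc j)))"
        using 4 ext_transition[OF reach_walk[OF _ p]] by simp
      have s1: "small b (\<epsilon> * dec n c j)" "small b (int (walk p c \<epsilon> (Suc j)))" "small b (int j + 1)"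
        using dec_small[OF c, of j] e small_reach[OF reach_walk[OF _ p, of "Suc j"]] 4 small_le_n[of "Suc j"]
        by (auto intro!: small_M simp del: walk.simps simp: add.commute)
      show ?case
        using 4 s1 q small_dec[OF c, of j]
        by (simp del: walk.simps, intro exC[OF g], simp del: walk.simps)
    qed (auto simp: loaded_def)
  qed
qed (use k in \<open>auto simp: sketch_program_def walk_body_def\<close>)

lemma pre_ok:
  assumes k: "3 \<le> k" and p: "reach p" and c: "c \<le> M"
  shows "cmp k 6 [int n, int p, int c] (int (pre p c))"
proof (rule procI[where l = 3 and c = pre_body])
  let ?xs = "[int n, int p, int c]"
  have sm: "small b (int c)" using c by (intro small_nat) simp
  show "small b (?xs ! j)" if "j < 3" for j
    using that small_reach[OF p] sm small_le_n[of n] by (auto simp: less_Suc_eq numeral_eq_Suc)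
  show "wp (cmp (k - 1)) (ext (k - 1)) b ?xs pre_body (\<lambda>f. fst f 0 = int (pre p c)) (loaded 3 ?xs (\<lambda>_. 0), \<lambda>_. 0)"
  proof (unfold pre_body_def seq.simps append.simps wp.simps(2-7) wp_Skip, intro conjI, goal_cases)
    case 1
    show ?case using small_reach[OF p] by (simp add: loaded_def)
  next
    case 2
    show ?case
    proof (rule wp_for[where N = c and J = "\<lambda>j r. r 1 = int n \<and> r 3 = int c \<and> r 0 = int (pre p j)"], goal_cases)
      case (4 j r h)
      have rp: "reach (pre p j)" by (rule reach_pre[OF p])
      have rw: "reach (walk (pre p j) j 1 n)" by (rule reach_walk[OF le_refl rp])
      have w1: "cmp (k - 1) 5 [int n, int (pre p j), int j, 1] (int (walk (pre p j) j 1 n))"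
        using 4 k c rp by (intro walk_ok) auto
      have w2: "cmp (k - 1) 5 [int n, int (walk (pre p j) j 1 n), int j, - 1] (int (pre p (Suc j)))"
        using 4 k c rw walk_ok[of "k - 1" _ j "- 1"] by simp
      have sm: "small b (int j + 1)" using small_nat[of "Suc j"] 4 c by (simp add: add.commute)
      show ?case
        using 4 sm w2 small_reach[OF rw] small_reach[OF reach_pre[OF p, of "Suc j"]]
        by (simp del: pre.simps, intro exC[OF w1], simp del: pre.simps)
    qed (auto simp: loaded_def)
  qed
qed (use k in \<open>auto simp: sketch_program_def pre_body_def\<close>)

lemma mid_ok:
  assumes k: "4 \<le> k" and p: "reach p" and c: "c < M"
  shows "cmp k 7 [int n, int p, int c] (int (mid p c))"
proof (rule procI[where l = 3 and c = mid_body])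
  let ?xs = "[int n, int p, int c]"
  have sm: "small b (int c)" using c by (intro small_nat) simp
  show "small b (?xs ! j)" if "j < 3" for j
    using that small_reach[OF p] sm small_le_n[of n] by (auto simp: less_Suc_eq numeral_eq_Suc)
  have p1: "cmp (k - 1) 6 [int n, int p, int c] (int (pre p c))"
    using k p c by (intro pre_ok) auto
  have w: "cmp (k - 1) 5 [int n, int (pre p c), int c, 1] (int (mid p c))"
    unfolding mid_def using k p c reach_pre by (intro walk_ok) auto
  show "wp (cmp (k - 1)) (ext (k - 1)) b ?xs mid_body (\<lambda>f. fst f 0 = int (mid p c)) (loaded 3 ?xs (\<lambda>_. 0), \<lambda>_. 0)"
    using w small_reach[OF reach_pre[OF p, of c]] small_reach[OF reach_mid[OF p, of c]]
    by (simp add: mid_body_def loaded_def, intro exC[OF p1], simp)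
qed (use k in \<open>auto simp: sketch_program_def mid_body_def\<close>)

lemma pow_ok:
  assumes k: "1 \<le> k" and x: "1 \<le> x" "x \<le> M" and e: "x ^ e \<le> M" "e \<le> M"
  shows "cmp k 8 [int x, int e] (int (x ^ e))"
proof (rule procI[where l = 2 and c = pow_body])
  let ?xs = "[int x, int e]"
  show "small b (?xs ! j)" if "j < 2" for j
    using that x e by (auto simp: less_Suc_eq numeral_eq_Suc intro!: small_nat)
  show "wp (cmp (k - 1)) (ext (k - 1)) b ?xs pow_body (\<lambda>f. fst f 0 = int (x ^ e)) (loaded 2 ?xs (\<lambda>_. 0), \<lambda>_. 0)"
  proof (unfold pow_body_def seq.simps append.simps wp.simps(2-7) wp_Skip, intro conjI, goal_cases)
    case 2
    show ?case
    proof (rule wp_for[where N = e and J = "\<lambda>j r. r 1 = int x \<and> r 2 = int e \<and> r 0 = int (x ^ j)"], goal_cases)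
      case (4 j r h)
      have "x ^ Suc j \<le> x ^ e" using 4 x by (intro power_increasing) auto
      then have "small b (int (x ^ Suc j))" using e by (intro small_nat) simp
      moreover have "small b (int (Suc j))" using 4 e by (intro small_nat) simp
      ultimately show ?case using 4 by (simp add: ac_simps)
    qed (auto simp: loaded_def)
  qed simp
qed (use k in \<open>auto simp: sketch_program_def pow_body_def\<close>)

lemma start_ok:
  assumes k: "4 \<le> k"
  shows "cmp k 9 [int n, int M, int (2 ^ s), int (initial A)] (int start)"
proof (rule procI[where l = 4 and c = start_body])
  let ?xs = "[int n, int M, int (2 ^ s), int (initial A)]"
  have s2: "2 ^ s \<le> M" by (rule pow_le_M) simp
  then have sm: "small b (int (2 ^ s))" "small b (int M)" by (auto intro!: small_nat simp del: of_nat_power)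
  show "small b (?xs ! j)" if "j < 4" for j
    using that small_reach[OF reach_initial] sm small_le_n[of n] by (auto simp: less_Suc_eq numeral_eq_Suc)
  let ?g = "\<lambda>j. ((\<lambda>p. pre p M) ^^ j) (initial A)"
  have rg: "reach (?g j)" for j by (rule reach_path[OF reach_initial path_rounds])
  show "wp (cmp (k - 1)) (ext (k - 1)) b ?xs start_body (\<lambda>f. fst f 0 = int start) (loaded 4 ?xs (\<lambda>_. 0), \<lambda>_. 0)"
  proof (unfold start_body_def seq.simps append.simps wp.simps(2-7) wp_Skip, intro conjI, goal_cases)
    case 1
    show ?case using small_reach[OF reach_initial] by (simp add: loaded_def)
  next
    case 2
    show ?case
    proof (rule wp_for[where N = "2 ^ s" and J = "\<lambda>j r. r 1 = int n \<and> r 2 = int M \<and> r 3 = int (2 ^ s) \<and>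
        r 0 = int (?g j)"], goal_cases)
      case (4 j r h)
      have p: "cmp (k - 1) 6 [int n, int (?g j), int M] (int (?g (Suc j)))"
        using k rg pre_ok[of "k - 1" "?g j" M] by simp
      have sm: "small b (int j + 1)" using small_nat[of "Suc j"] 4 s2 by (simp add: add.commute)
      show ?case
        using 4 sm p small_reach[OF rg[of "Suc j"]] by (simp del: funpow.simps)
    qed (auto simp: loaded_def start_def)
  qed
qed (use k in \<open>auto simp: sketch_program_def start_body_def\<close>)

section \<open>Search for the relations\<close>

lemma small_cube_nat: "t \<le> 8 * M * M * M \<Longrightarrow> small b (int t)"
proof -
  assume "t \<le> 8 * M * M * M"
  then have "int t \<le> int (8 * M * M * M)" by (simp only: of_nat_le_iff)
  then show ?thesis by (intro small_cube) (simp only: abs_of_nat)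
qed

lemma ok_ok:
  assumes k: "5 \<le> k" and dm: "dm < M" and i: "i \<le> n" and t: "t \<le> 8 * M * M * M"
  shows "cmp k 10 [int n, int M, int start, int dm, int i, int t] (if ok dm i t then 1 else 0)"
proof (rule procI[where l = 6 and c = ok_body])
  let ?xs = "[int n, int M, int start, int dm, int i, int t]"
  have "small b (int dm)" "small b (int M)" using dm by (auto intro!: small_nat)
  then show "small b (?xs ! j)" if "j < 6" for j
    using that small_reach[OF reach_start] small_le_n[of n] small_le_n[OF i] small_cube_nat[OF t]
    by (auto simp: less_Suc_eq numeral_eq_Suc)
  define tM where "tM = t div M"
  define c1 where "c1 = tM mod M"
  define D where "D = tM div M"
  define c2 where "c2 = t mod M"
  have M0: "0 < M" by (rule M_pos)
  have c: "c1 < M" "c2 < M" using M0 by (auto simp: c1_def c2_def)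
  have z: "int t div int M = int tM" "int tM mod int M = int c1" "int tM div int M = int D"
    "int t mod int M = int c2"
    by (simp_all add: tM_def c1_def c2_def D_def zdiv_int zmod_int)
  have "tM \<le> t" "D \<le> tM" by (simp_all add: tM_def D_def)
  then have sm: "small b (int tM)" "small b (int D)" "small b (int c1)" "small b (int c2)"
    using t c small_cube_nat[of tM] small_cube_nat[of D] small_nat[of c1] small_nat[of c2] by auto
  have m: "cmp (k - 1) 7 [int n, int start, int c] (int (mid start c))" if "c < M" for c
    using k that reach_start by (intro mid_ok) auto
  have g: "cmp (k - 1) 3 [int n, int c, int j] (dec n c j)" if "c < M" "j < n" for c j
    using k that by (intro get_ok) auto
  have sm_mid: "small b (int (mid start c))" for c by (rule small_reach[OF reach_mid[OF reach_start]])
  define G where "G j \<longleftrightarrow> cand dm i t j (dec n c1 j - dec n c2 j) (dec n dm j)" for j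
  \<comment> \<open>The loop can only clear the flag in register 0, so after \<open>j\<close> rounds
    it records the initial tests and the first \<open>j\<close> conditions.\<close>
  define F where "F j \<longleftrightarrow> mid start c1 = mid start c2 \<and> 0 < D \<and> (\<forall>j'<j. G j')" for j
  have FS: "F (Suc j) \<longleftrightarrow> F j \<and> G j" for j by (auto simp: F_def less_Suc_eq)
  define fl :: "nat \<Rightarrow> int" where "fl j = (if F j then 1 else 0)" for j
  have Fn: "F n = ok dm i t" by (simp add: F_def G_def ok_def c1_def c2_def tM_def D_def)
  \<comment> \<open>The machine has no absolute value, so \<open>|x| \<le> e\<close> is tested by
    two comparisons.\<close>
  have G: "G j \<longleftrightarrow> (if j < i then \<not> dec n dm j < dec n c1 j - dec n c2 j \<and>
      \<not> dec n dm j < - (dec n c1 j - dec n c2 j)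
    else if j = i then dec n c1 j - dec n c2 j = int D else dec n c1 j - dec n c2 j = 0)" for j
    by (auto simp: G_def cand_def D_def tM_def abs_le_iff not_less)
  have loop: "wp (cmp (k - 1)) (ext (k - 1)) b ?xs (count_up 10 1 [
       Call 11 3 [Reg 1, Reg 8, Reg 10],
       Call 12 3 [Reg 1, Reg 9, Reg 10],
       Assign 11 SubOp (Reg 11) (Reg 12),
       Call 12 3 [Reg 1, Reg 4, Reg 10],
       Assign 13 SubOp (Num 0) (Reg 11),
       Cond (Less (Reg 10) (Reg 5))
         (Cond (Conj (Neg (Less (Reg 12) (Reg 11))) (Neg (Less (Reg 12) (Reg 13)))) Skip (const 0 0))
         (Cond (Eq (Reg 10) (Reg 5))
           (Cond (Eq (Reg 11) (Reg 7)) Skip (const 0 0))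
           (Cond (Eq (Reg 11) (Num 0)) Skip (const 0 0)))])
     (\<lambda>f. fst f 0 = fl n) (r, h)"
    if "r 1 = int n" "r 4 = int dm" "r 5 = int i" "r 7 = int D" "r 8 = int c1" "r 9 = int c2"
      "r 10 = 0" "r 0 = fl 0" for r h
  proof (rule wp_for[where N = n and J = "\<lambda>j r. r 1 = int n \<and> r 4 = int dm \<and> r 5 = int i \<and>
      r 7 = int D \<and> r 8 = int c1 \<and> r 9 = int c2 \<and> r 0 = fl j"], goal_cases)
    case (4 j r h)
    have s: "small b (dec n c1 j - dec n c2 j)" "small b (- (dec n c1 j - dec n c2 j))"
        "small b (int j + 1)" "small b (dec n dm j)" "small b (dec n c1 j)" "small b (dec n c2 j)"
      using dec_small[OF c(1), of j] dec_small[OF c(2), of j] small_le_n[of "Suc j"] 4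
        small_dec[OF dm, of j] small_dec[OF c(1), of j] small_dec[OF c(2), of j]
      by (auto intro!: small_M simp: add.commute)
    note g1 = g[OF c(1) 4(1)] and g2 = g[OF c(2) 4(1)] and g3 = g[OF dm 4(1)]
    show ?case
    proof (cases "G j")
      case True
      then have Gj: "if j < i then \<not> dec n dm j < dec n c1 j - dec n c2 j \<and>
          \<not> dec n dm j < - (dec n c1 j - dec n c2 j)
        else if j = i then dec n c1 j - dec n c2 j = int D else dec n c1 j - dec n c2 j = 0"
        using G by simp
      have "fl (Suc j) = fl j" using True FS by (simp add: fl_def)
      then show ?thesis
        using 4 s by (simp, intro exC[OF g1], simp, intro exC[OF g2], simp, intro exC[OF g3])
          (use Gj in \<open>auto split: if_splits\<close>)
    next
      case False
      then have Gj: "\<not> (if j < i then \<not> dec n dm j < dec n c1 j - dec n c2 j \<and>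
          \<not> dec n dm j < - (dec n c1 j - dec n c2 j)
        else if j = i then dec n c1 j - dec n c2 j = int D else dec n c1 j - dec n c2 j = 0)"
        using G by simp
      have "fl (Suc j) = 0" using False FS by (simp add: fl_def)
      then show ?thesis
        using 4 s by (simp, intro exC[OF g1], simp, intro exC[OF g2], simp, intro exC[OF g3])
          (use Gj in \<open>auto split: if_splits\<close>)
    qed
  qed (use that in auto)
  have F0: "fl 0 = (if mid start c1 = mid start c2 \<and> 0 < D then 1 else 0)" by (simp add: F_def fl_def)
  have fn: "(if ok dm i t then 1 else 0) = fl n" by (simp add: fl_def Fn)
  show "wp (cmp (k - 1)) (ext (k - 1)) b ?xs ok_body (\<lambda>f. fst f 0 = (if ok dm i t then 1 else 0)) (loaded 6 ?xs (\<lambda>_. 0), \<lambda>_. 0)"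
    unfolding fn using z sm sm_mid
    by (simp add: ok_body_def loaded_def del: wp.simps(8), intro exC[OF m[OF c(1)]],
        simp del: wp.simps(8), intro exC[OF m[OF c(2)]], simp del: wp.simps(8))
      (intro conjI impI; rule loop[unfolded seq.simps append.simps]; simp add: F0)
qed (use k in \<open>auto simp: sketch_program_def ok_body_def\<close>)

text \<open>The search counts up from 0 and stops at the first success, so existence and size of
  \<open>rel dm i\<close> give termination and the space bound.\<close>

lemma rel_ok:
  assumes k: "6 \<le> k" and dm: "dm < M" and i: "i \<le> n"
    and T: "ok dm i (rel dm i)" "rel dm i \<le> 8 * M * M * M"
  shows "cmp k 11 [int n, int M, int start, int dm, int i] (int (rel dm i))"
proof (rule procI[where l = 5 and c = rel_body])
  let ?xs = "[int n, int M, int start, int dm, int i]"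
  have "small b (int dm)" "small b (int M)" using dm by (auto intro!: small_nat)
  then show "small b (?xs ! j)" if "j < 5" for j
    using that small_reach[OF reach_start] small_le_n[of n] small_le_n[OF i]
    by (auto simp: less_Suc_eq numeral_eq_Suc)
  let ?T = "rel dm i"
  have o: "cmp (k - 1) 10 [int n, int M, int start, int dm, int i, int t] (if ok dm i t then 1 else 0)"
    if "t \<le> ?T" for t
    using k dm i that T by (intro ok_ok) auto
  let ?I = "\<lambda>f :: frame. fst f 1 = int n \<and> fst f 2 = int M \<and> fst f 3 = int start \<and> fst f 4 = int dm \<and>
    fst f 5 = int i \<and> 0 \<le> fst f 0 \<and> fst f 0 \<le> int ?T \<and> fst f 6 = (if ok dm i (nat (fst f 0)) then 1 else 0)"
  have loop: "wp (cmp (k - 1)) (ext (k - 1)) b ?xs (While (Eq (Reg 6) (Num 0)) (seq [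
       incr 0,
       Call 6 10 [Reg 1, Reg 2, Reg 3, Reg 4, Reg 5, Reg 0]])) (\<lambda>f. fst f 0 = int ?T) (r, h)"
    if "?I (r, h)" for r h
  proof (rule wp_While[where I = ?I and \<mu> = "\<lambda>f. nat (int ?T - fst f 0)"], goal_cases)
    case 1
    show ?case by (rule that)
  next
    case (2 r h)
    define t where "t = nat (r 0)"
    have r: "r 0 = int t" "t \<le> ?T" "\<not> ok dm i t" using 2 by (auto simp: t_def split: if_splits)
    then have t: "t < ?T" using T(1) by (metis le_neq_implies_less)
    have o1: "cmp (k - 1) 10 [int n, int M, int start, int dm, int i, int t + 1] (if ok dm i (Suc t) then 1 else 0)"
      using o[of "Suc t"] t by (simp add: add.commute)
    have sm: "small b (int t + 1)" using small_cube_nat[of "Suc t"] t T(2) by (simp add: add.commute)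
    have nt: "nat (int t + 1) = Suc t" by simp
    have "small b (if ok dm i (Suc t) then 1 else 0)" by simp
    then show ?case using 2 r t sm nt o1 by simp
  next
    case (3 r h)
    define t where "t = nat (r 0)"
    have r: "r 0 = int t" "t \<le> ?T" "ok dm i t" using 3 by (auto simp: t_def split: if_splits)
    have "?T \<le> t" unfolding rel_def by (rule Least_le) (rule r(3))
    with r show ?case by simp
  qed
  show "wp (cmp (k - 1)) (ext (k - 1)) b ?xs rel_body (\<lambda>f. fst f 0 = int ?T) (loaded 5 ?xs (\<lambda>_. 0), \<lambda>_. 0)"
    using o[of 0]
    by (simp add: rel_body_def loaded_def del: wp.simps(8), intro exC[OF o[of 0, simplified]])
      (auto simp del: wp.simps(8) intro!: loop[unfolded seq.simps])
qed (use k in \<open>auto simp: sketch_program_def rel_body_def\<close>)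

text \<open>The bounds in \<open>dm\<close> are inspected only below coordinate \<open>i\<close>, so
  the complete code \<open>dms n\<close> serves the search for every \<open>i\<close>.\<close>

lemma ok_dms: "i \<le> m \<Longrightarrow> m \<le> n \<Longrightarrow> ok (dms m) i = ok (dms i) i"
proof (intro ext)
  fix t
  assume "i \<le> m" "m \<le> n"
  then have "cand (dms m) i t j x (dec n (dms m) j) = cand (dms i) i t j x (dec n (dms i) j)" for j x
    by (auto simp: cand_def dec_dms)
  then show "ok (dms m) i t = ok (dms i) i t" unfolding ok_def by simp
qed

lemma rel_dms:
  assumes "i \<le> m" "m \<le> n"
  shows "rel (dms m) i = rel (dms i) i"
  unfolding rel_def using ok_dms[OF assms] by simp

lemma d_le_M: "i < n \<Longrightarrow> d i \<le> M"
  using d_le[of i] pow_le_M[of s] by simp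

lemma rel_le: "i < n \<Longrightarrow> rel (dms i) i \<le> 8 * M * M * M"
proof -
  assume i: "i < n"
  let ?t = "rel (dms i) i"
  have "?t = (?t div M div M * M + ?t div M mod M) * M + ?t mod M" by (simp only: div_mult_mod_eq)
  also have "\<dots> = (d i * M + ?t div M mod M) * M + ?t mod M" by (simp only: d_def)
  also have "\<dots> \<le> (M * M + M) * M + M"
    using d_le_M[OF i] M_pos by (intro add_mono mult_le_mono) (auto intro: less_imp_le)
  also have "\<dots> \<le> 8 * M * M * M"
  proof -
    have "M * 1 * 1 \<le> M * M * M" "M * M * 1 \<le> M * M * M" using M_pos by (auto intro!: mult_le_mono)
    moreover have "(M * M + M) * M + M = M * M * M + M * M + M" by (simp add: algebra_simps)
    ultimately show ?thesis by linarith
  qed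
  finally show ?thesis .
qed

lemma rel_dms_ok:
  assumes "6 \<le> k" "i \<le> m" "m \<le> n" "i < n"
  shows "cmp k 11 [int n, int M, int start, int (dms m), int i] (int (rel (dms i) i))"
proof -
  have "ok (dms m) i (rel (dms m) i)"
    using ok_rel[OF assms(4)] by (simp only: ok_dms[OF assms(2,3)] rel_dms[OF assms(2,3)])
  then show ?thesis
    using rel_ok[of k "dms m" i] rel_dms[OF assms(2,3)] rel_le[OF assms(4)] assms dms_less[of m]
    by simp
qed

lemma dms_ok:
  assumes k: "7 \<le> k"
  shows "cmp k 12 [int n, int M, int start] (int (dms n))"
proof (rule procI[where l = 3 and c = dms_body])
  let ?xs = "[int n, int M, int start]"
  have "small b (int M)" by (auto intro!: small_nat)
  then show "small b (?xs ! j)" if "j < 3" for j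
    using that small_reach[OF reach_start] small_le_n[of n] by (auto simp: less_Suc_eq numeral_eq_Suc)
  show "wp (cmp (k - 1)) (ext (k - 1)) b ?xs dms_body (\<lambda>f. fst f 0 = int (dms n)) (loaded 3 ?xs (\<lambda>_. 0), \<lambda>_. 0)"
  proof (unfold dms_body_def seq.simps append.simps wp.simps(2-7) wp_Skip)
    show "wp (cmp (k - 1)) (ext (k - 1)) b ?xs (While (Less (Reg 4) (Reg 1))
      (Seq (Call 5 11 [Reg 1, Reg 2, Reg 3, Reg 0, Reg 4])
        (Seq (Assign 5 DivOp (Reg 5) (Reg 2)) (Seq (Assign 5 DivOp (Reg 5) (Reg 2))
          (Seq (Assign 5 SubOp (Reg 5) (Num 1)) (Seq (Call 0 4 [Reg 1, Reg 0, Reg 4, Reg 5])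
            (Seq (incr 4) Skip)))))))
      (\<lambda>f. fst f 0 = int (dms n)) (loaded 3 ?xs (\<lambda>_. 0), \<lambda>_. 0)"
    proof (rule wp_for[where N = n and J = "\<lambda>j r. r 1 = int n \<and> r 2 = int M \<and> r 3 = int start \<and>
        r 0 = int (dms j)"], goal_cases)
      case (4 j r h)
      define t where "t = rel (dms j) j"
      define tM where "tM = t div M"
      have z: "int t div int M = int tM" "int tM div int M = int (d j)"
        by (simp_all add: tM_def t_def d_def zdiv_int)
      have r: "cmp (k - 1) 11 [int n, int M, int start, int (dms j), int j] (int t)"
        unfolding t_def using k 4 by (intro rel_dms_ok) auto
      have t: "t \<le> 8 * M * M * M" unfolding t_def by (rule rel_le) (rule 4)
      have "tM \<le> t" by (simp add: tM_def)
      then have sm: "small b (int t)" "small b (int tM)" "small b (int (d j))" "small b (int (d j) - 1)"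
        using t d_le_M[OF 4(1)] d_pos[OF 4(1)] small_cube_nat[of t] small_cube_nat[of tM]
          small_nat[of "d j"] small_M[of "int (d j) - 1"] by auto
      have dS: "dms (Suc j) = prep (n + 3) (dms j) j (int (d j) - 1)" by (simp add: d_def)
      have lt: "dms (Suc j) < M" using 4 by (intro dms_less) simp
      then have sm2: "small b (int (dms (Suc j)))" by (intro small_nat) simp
      have p: "cmp (k - 1) 4 [int n, int (dms j), int j, int (d j) - 1] (int (dms (Suc j)))"
        unfolding dS using k 4 lt[unfolded dS] d_le_M[OF 4(1)] d_pos[OF 4(1)] by (intro prep_ok) auto
      show ?case
        using 4 sm sm2 p z small_le_n[of "Suc j"]
        by (simp del: dms.simps, intro exC[OF r]) (simp add: add.commute del: dms.simps)
    qed (auto simp: loaded_def)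
  qed
qed (use k in \<open>auto simp: sketch_program_def dms_body_def\<close>)

section \<open>Arithmetic on representatives\<close>

abbreviation "code z \<equiv> vcode (n + 3) n z"

lemma code_cong: "(\<And>j. j < n \<Longrightarrow> z j = z' j) \<Longrightarrow> code z = code z'"
  by (rule vcode_cong)

lemma axpy_ok:
  assumes k: "2 \<le> k" and y: "y < M" "c1 < M" "c2 < M" and e: "\<epsilon> = 1 \<or> \<epsilon> = - 1"
    and lt: "code z < M" and z: "\<And>j. j < n \<Longrightarrow> z j = dec n y j - \<epsilon> * (dec n c1 j - dec n c2 j)"
  shows "cmp k 13 [int n, int y, \<epsilon>, int c1, int c2] (int (code z))"
proof (rule procI[where l = 5 and c = axpy_body])
  let ?xs = "[int n, int y, \<epsilon>, int c1, int c2]"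
  have "small b (int y)" "small b (int c1)" "small b (int c2)" using y by (auto intro!: small_nat)
  then show "small b (?xs ! j)" if "j < 5" for j
    using that small_le_n[of n] e by (auto simp: less_Suc_eq numeral_eq_Suc)
  have g: "cmp (k - 1) 3 [int n, int c, int j] (dec n c j)" if "c < M" "j < n" for c j
    using k that by (intro get_ok) auto
  show "wp (cmp (k - 1)) (ext (k - 1)) b ?xs axpy_body (\<lambda>f. fst f 0 = int (code z)) (loaded 5 ?xs (\<lambda>_. 0), \<lambda>_. 0)"
  proof (unfold axpy_body_def seq.simps append.simps wp.simps(2-7) wp_Skip,
      rule wp_for[where N = n and J = "\<lambda>j r. r 1 = int n \<and> r 2 = int y \<and> r 3 = \<epsilon> \<and> r 4 = int c1 \<and>
        r 5 = int c2 \<and> r 0 = int (vcode (n + 3) j z)"], goal_cases)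
    case (4 j r h)
    \<comment> \<open>Codes of prefixes grow with the prefix, so the bound on the final code covers
      the partial results.\<close>
    have "vcode (n + 3) (Suc j) z \<le> code z" using 4 by (intro vcode_mono) auto
    then have lt: "vcode (n + 3) (Suc j) z < M" using lt by simp
    note ds = dec_small[OF y(1), of j] dec_small[OF y(2), of j] dec_small[OF y(3), of j]
    have s: "small b (dec n c1 j - dec n c2 j)" "small b (\<epsilon> * (dec n c1 j - dec n c2 j))"
        "small b (int j + 1)" "small b (dec n y j)" "small b (dec n c1 j)" "small b (dec n c2 j)"
        "small b (z j)" "\<bar>z j\<bar> \<le> 8 * int M"
      using ds small_le_n[of "Suc j"] 4 e
      by (auto intro!: small_M simp: add.commute z)
    have p: "cmp (k - 1) 4 [int n, int (vcode (n + 3) j z), int j, z j] (int (vcode (n + 3) (Suc j) z))"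
      using k 4 lt s(8) prep_ok[of "k - 1" "vcode (n + 3) j z" j "z j"] by simp
    have sm: "small b (int (vcode (n + 3) (Suc j) z))" using lt by (intro small_nat) simp
    show ?case
      using 4 s p sm z[of j]
      by (simp del: vcode.simps, intro exC[OF g[OF y(2)]], simp, simp del: vcode.simps,
        intro exC[OF g[OF y(3)]], simp, simp del: vcode.simps,
        intro exC[OF g[OF y(1)]], simp, simp del: vcode.simps)
  qed (auto simp: loaded_def)
qed (use k in \<open>auto simp: sketch_program_def axpy_body_def\<close>)

definition fbad :: "(nat \<Rightarrow> int) \<Rightarrow> nat" where
  "fbad v = (LEAST j. j = n \<or> bad v j)"

lemma fbad:
  shows fbad_le: "fbad v \<le> n" and fbad_bad: "fbad v < n \<Longrightarrow> bad v (fbad v)"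
    and fbad_least: "j < fbad v \<Longrightarrow> \<not> bad v j"
proof -
  have "fbad v = n \<or> bad v (fbad v)" unfolding fbad_def by (rule LeastI[of _ n]) simp
  then show "fbad v < n \<Longrightarrow> bad v (fbad v)" by auto
  show "fbad v \<le> n" unfolding fbad_def by (rule Least_le) simp
  show "j < fbad v \<Longrightarrow> \<not> bad v j" unfolding fbad_def using not_less_Least by blast
qed

lemma badx_ok:
  assumes k: "2 \<le> k" and y: "y < M" and v: "\<And>j. j < n \<Longrightarrow> dec n y j = v j"
  shows "cmp k 14 [int n, int (dms n), int y] (int (fbad v))"
proof (rule procI[where l = 3 and c = badx_body])
  let ?xs = "[int n, int (dms n), int y]"
  have dm: "dms n < M" by (rule dms_less) simp
  then have "small b (int y)" "small b (int (dms n))" using y by (auto intro!: small_nat)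
  then show "small b (?xs ! j)" if "j < 3" for j
    using that small_le_n[of n] by (auto simp: less_Suc_eq numeral_eq_Suc)
  have g: "cmp (k - 1) 3 [int n, int c, int j] (dec n c j)" if "c < M" "j < n" for c j
    using k that by (intro get_ok) auto
  \<comment> \<open>The scan runs downwards, so that the last assignment names the lowest bad
    coordinate.\<close>
  let ?I = "\<lambda>f :: frame. fst f 1 = int n \<and> fst f 2 = int (dms n) \<and> fst f 3 = int y \<and>
    0 \<le> fst f 4 \<and> fst f 4 \<le> int n \<and> (\<exists>x\<le>n. fst f 0 = int x \<and> (x < n \<longrightarrow> bad v x) \<and>
      (\<forall>j. nat (fst f 4) \<le> j \<and> j < x \<longrightarrow> \<not> bad v j))"
  have loop: "wp (cmp (k - 1)) (ext (k - 1)) b ?xs (While (Less (Num 0) (Reg 4)) (seq [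
       Assign 4 SubOp (Reg 4) (Num 1),
       Call 5 3 [Reg 1, Reg 3, Reg 4],
       Call 6 3 [Reg 1, Reg 2, Reg 4],
       Cond (Less (Reg 5) (Num 0)) (copy 0 4)
         (Cond (Less (Reg 6) (Reg 5)) (copy 0 4) Skip)])) (\<lambda>f. fst f 0 = int (fbad v)) (r, h)"
    if "?I (r, h)" for r h
  proof (rule wp_While[where I = ?I and \<mu> = "\<lambda>f. nat (fst f 4)"], goal_cases)
    case 1
    show ?case by (rule that)
  next
    case (2 r h)
    define j where "j = nat (r 4) - 1"
    have j: "r 4 = int (Suc j)" "j < n" using 2 by (auto simp: j_def)
    obtain x where x: "x \<le> n" "r 0 = int x" "x < n \<longrightarrow> bad v x" "\<forall>j'. Suc j \<le> j' \<and> j' < x \<longrightarrow> \<not> bad v j'"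
    proof -
      have "nat (r 4) = Suc j" using j by simp
      then have "\<exists>x\<le>n. r 0 = int x \<and> (x < n \<longrightarrow> bad v x) \<and> (\<forall>j'. Suc j \<le> j' \<and> j' < x \<longrightarrow> \<not> bad v j')"
        using 2(1) by (simp only: fst_conv)
      then show ?thesis using that by blast
    qed
    have r: "r 1 = int n" "r 2 = int (dms n)" "r 3 = int y" using 2 by auto
    have s: "small b (int j)" "small b (v j)" "small b (int (d j) - 1)"
      using small_le_n[of j] j small_dec[OF y, of j] v[of j] small_dec[OF dm, of j]
      by (simp_all add: dec_dms)
    have d: "dec n (dms n) j = int (d j) - 1" using j by (simp add: dec_dms)
    have b: "bad v j \<longleftrightarrow> v j < 0 \<or> int (d j) - 1 < v j" by (auto simp: bad_def)
    have x': "\<exists>x\<le>n. int j = int x \<and> (x < n \<longrightarrow> bad v x) \<and> (\<forall>j'. j \<le> j' \<and> j' < x \<longrightarrow> \<not> bad v j')" if "bad v j"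
      using that j by (intro exI[of _ j]) auto
    have x'': "\<exists>x\<le>n. r 0 = int x \<and> (x < n \<longrightarrow> bad v x) \<and> (\<forall>j'. j \<le> j' \<and> j' < x \<longrightarrow> \<not> bad v j')" if "\<not> bad v j"
    proof (intro exI[of _ x] conjI x allI impI)
      fix j' assume "j \<le> j' \<and> j' < x"
      then show "\<not> bad v j'" using that x(4) by (cases "j' = j") auto
    qed
    show ?case
    proof (cases "bad v j")
      case True
      then have "v j < 0 \<or> int (d j) - 1 < v j" using b by simp
      with s r j x'[OF True] show ?thesis
        by (simp, intro exC[OF g[OF y, of j, unfolded v[OF j(2)]]], simp, simp, 
            intro exC[OF g[OF dm, of j, unfolded d]], simp) auto
    next
      case False
      then have "\<not> v j < 0" "\<not> int (d j) - 1 < v j" using b by auto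
      with s r j x''[OF False] show ?thesis
        by (simp, intro exC[OF g[OF y, of j, unfolded v[OF j(2)]]], simp, simp, 
            intro exC[OF g[OF dm, of j, unfolded d]], simp) auto
    qed
  next
    case (3 r h)
    then obtain x where x: "x \<le> n" "r 0 = int x" "x < n \<longrightarrow> bad v x" "\<forall>j. j < x \<longrightarrow> \<not> bad v j" by auto
    have "fbad v = x" unfolding fbad_def
      by (rule Least_equality) (use x in \<open>auto simp: not_less[symmetric]\<close>)
    with x show ?case by simp
  qed
  show "wp (cmp (k - 1)) (ext (k - 1)) b ?xs badx_body (\<lambda>f. fst f 0 = int (fbad v)) (loaded 3 ?xs (\<lambda>_. 0), \<lambda>_. 0)"
    using small_le_n[of n]
    by (simp add: badx_body_def loaded_def del: wp.simps(8)) (rule loop[unfolded seq.simps], auto)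
qed (use k in \<open>auto simp: sketch_program_def badx_body_def\<close>)

definition canon :: "(nat \<Rightarrow> int) \<Rightarrow> nat \<Rightarrow> int" where
  "canon x = unrank d (\<phi> x)"

lemma box_canon: "box (canon x)" and eqv_canon: "eqv x (canon x)"
  using phi_unrank[of x] by (auto simp: canon_def)

lemma canon_eqv: "eqv x y \<Longrightarrow> canon x = canon y"
  by (simp add: canon_def phi_eqv)

lemma canon_box: "box v \<Longrightarrow> j < n \<Longrightarrow> canon v j = v j"
  using eqv_box_unique[OF _ _ eqv_sym[OF eqv_canon]] box_canon by blast

lemma code_less: "lazy i z \<Longrightarrow> code z < M"
  by (rule lazy_code) simp_all

lemma badness_cong: "(\<And>j. j < n \<Longrightarrow> z j = z' j) \<Longrightarrow> badness z = badness z'"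
  unfolding badness_def by (rule sum.cong) (auto simp: bad_def)

text \<open>Each round stays in the class of \<open>z\<close>. A vector without bad coordinates lies
  in the box, hence agrees with the canonical representative by uniqueness.\<close>

lemma norm_ok:
  assumes k: "7 \<le> k" and z: "lazy i z"
  shows "cmp k 15 [int n, int M, int start, int (dms n), int (code z)] (int (code (canon z)))"
proof (rule procI[where l = 5 and c = norm_body])
  let ?xs = "[int n, int M, int start, int (dms n), int (code z)]"
  have dm: "dms n < M" by (rule dms_less) simp
  have "small b (int (code z))" "small b (int (dms n))" "small b (int M)"
    using dm code_less[OF z] by (auto intro!: small_nat)
  then show "small b (?xs ! j)" if "j < 5" for j
    using that small_reach[OF reach_start] small_le_n[of n] by (auto simp: less_Suc_eq numeral_eq_Suc)
  have bx: "cmp (k - 1) 14 [int n, int (dms n), int (code z)] (int (fbad z))" if "lazy i z" for z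
    using k code_less[OF that] by (intro badx_ok) (auto simp: dec_vcode)
  let ?J = "\<lambda>f z'. fst f 0 = int (code z') \<and> lazy i z' \<and> eqv z' z \<and> fst f 6 = int (fbad z')"
  let ?I = "\<lambda>f :: frame. fst f 1 = int n \<and> fst f 2 = int M \<and> fst f 3 = int start \<and>
    fst f 4 = int (dms n) \<and> (\<exists>z'. ?J f z')"
  \<comment> \<open>The current vector is only known to exist, so the measure decodes it from
    register 0.\<close>
  let ?\<mu> = "\<lambda>f :: frame. badness (dec n (nat (fst f 0)))"
  have mu: "badness (dec n (code z)) = badness z" for z
    by (rule badness_cong) (simp add: dec_vcode)
  have loop: "wp (cmp (k - 1)) (ext (k - 1)) b ?xs (While (Less (Reg 6) (Reg 1)) (seq [
       Call 7 11 [Reg 1, Reg 2, Reg 3, Reg 4, Reg 6],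
       Assign 8 DivOp (Reg 7) (Reg 2),
       Assign 8 ModOp (Reg 8) (Reg 2),
       Assign 7 ModOp (Reg 7) (Reg 2),
       Call 9 3 [Reg 1, Reg 0, Reg 6],
       Cond (Less (Reg 9) (Num 0)) (const 9 (-1)) (const 9 1),
       Call 0 13 [Reg 1, Reg 0, Reg 9, Reg 8, Reg 7],
       Call 6 14 [Reg 1, Reg 4, Reg 0]])) (\<lambda>f. fst f 0 = int (code (canon z))) (r, h)"
    if "?I (r, h)" for r h
  proof (rule wp_While[where I = ?I and \<mu> = ?\<mu>], goal_cases)
    case 1
    show ?case by (rule that)
  next
    case (2 r h)
    then obtain w where w: "r 0 = int (code w)" "lazy i w" "eqv w z" "r 6 = int (fbad w)" by auto
    have r: "r 1 = int n" "r 2 = int M" "r 3 = int start" "r 4 = int (dms n)" "fbad w < n"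
      using 2 w by auto
    define q where "q = fbad w"
    have q: "q < n" "bad w q" "\<And>j. j < q \<Longrightarrow> \<not> bad w j"
      using r(5) fbad_bad[of w] fbad_least[of _ w] by (auto simp: q_def)
    define \<epsilon> where "\<epsilon> = (if w q < 0 then - 1 else 1 :: int)"
    define w' where "w' = (\<lambda>j. w j - \<epsilon> * \<rho> q j)"
    have w': "lazy i w'" "eqv w' w" "badness w' < badness w"
      using lazy_step[OF w(2) q] by (auto simp: w'_def \<epsilon>_def)
    define t where "t = rel (dms q) q"
    define tM where "tM = t div M"
    define c1 where "c1 = tM mod M"
    define c2 where "c2 = t mod M"
    have zz: "int t div int M = int tM" "int tM mod int M = int c1" "int t mod int M = int c2"
      by (simp_all add: tM_def c1_def c2_def zdiv_int zmod_int)
    have c: "c1 < M" "c2 < M" using M_pos by (auto simp: c1_def c2_def)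
    have t: "t \<le> 8 * M * M * M" unfolding t_def by (rule rel_le[OF q(1)])
    have "tM \<le> t" by (simp add: tM_def)
    then have sm: "small b (int t)" "small b (int tM)" "small b (int c1)" "small b (int c2)"
        "small b (int (code w'))" "small b (int (fbad w'))" "small b \<epsilon>"
      using t c small_cube_nat[of t] small_cube_nat[of tM] small_nat[of c1] small_nat[of c2]
        small_nat[of "code w'"] code_less[OF w'(1)] small_le_n[OF fbad_le]
      by (auto simp: \<epsilon>_def)
    have call1: "cmp (k - 1) 11 [int n, int M, int start, int (dms n), int q] (int t)"
      unfolding t_def using k q by (intro rel_dms_ok) auto
    have call2: "cmp (k - 1) 3 [int n, int (code w), int q] (w q)"
      using get_ok[of "k - 1" "code w" q] k q code_less[OF w(2)] by (simp add: dec_vcode)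
    have smw: "small b (w q)"
      using small_dec[OF code_less[OF w(2)], of q] q by (simp add: dec_vcode)
    have call3: "cmp (k - 1) 13 [int n, int (code w), \<epsilon>, int c1, int c2] (int (code w'))"
    proof (rule axpy_ok)
      show "code w < M" "code w' < M" by (rule code_less[OF w(2)], rule code_less[OF w'(1)])
      show "w' j = dec n (code w) j - \<epsilon> * (dec n c1 j - dec n c2 j)" if "j < n" for j
        using that by (simp add: dec_vcode w'_def \<rho>_def c1_def c2_def tM_def t_def)
    qed (use k c in \<open>auto simp: \<epsilon>_def\<close>)
    have call4: "cmp (k - 1) 14 [int n, int (dms n), int (code w')] (int (fbad w'))"
      by (rule bx[OF w'(1)])
    have ex: "\<exists>z'. int (code w') = int (code z') \<and> lazy i z' \<and> eqv z' z \<and> int (fbad w') = int (fbad z')"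
      using w' w(3) eqv_trans by blast
    have mm: "badness (dec n (code w')) < badness (dec n (code w))" using w'(3) by (simp add: mu)
    note r' = r(1-4) w(1) w(4)[folded q_def]
    show ?case
    proof (cases "w q < 0")
      case True
      then have e: "\<epsilon> = - 1" by (simp add: \<epsilon>_def)
      show ?thesis
        using r' zz sm smw True
        by (simp, intro exC[OF call1], simp, intro exC[OF call2], simp,
            intro exC[OF call3[unfolded e]], simp, intro exC[OF call4]) (use ex mm in simp)
    next
      case False
      then have e: "\<epsilon> = 1" by (simp add: \<epsilon>_def)
      show ?thesis
        using r' zz sm smw False
        by (simp, intro exC[OF call1], simp, intro exC[OF call2], simp,
            intro exC[OF call3[unfolded e]], simp, intro exC[OF call4]) (use ex mm in simp)
    qed
  next
    case (3 r h)
    then obtain w where w: "r 0 = int (code w)" "lazy i w" "eqv w z" "r 6 = int (fbad w)" by auto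
    then have "fbad w = n" using 3 fbad_le[of w] by auto
    then have "box w" using fbad_least[of _ w] by (simp add: box_iff_bad)
    then have "canon z j = w j" if "j < n" for j
      using canon_eqv[OF w(3)] canon_box[of w j] that by simp
    then have "code (canon z) = code w" by (rule code_cong)
    with w show ?case by simp
  qed
  have ex: "\<exists>z'. code z = code z' \<and> lazy i z' \<and> eqv z' z \<and> fbad z = fbad z'"
    using z eqv_refl by blast
  show "wp (cmp (k - 1)) (ext (k - 1)) b ?xs norm_body (\<lambda>f. fst f 0 = int (code (canon z))) (loaded 5 ?xs (\<lambda>_. 0), \<lambda>_. 0)"
    using small_nat[of "code z"] code_less[OF z] small_le_n[OF fbad_le, of z]
    by (simp add: norm_body_def loaded_def del: wp.simps(8), intro exC[OF bx[OF z]], simp del: wp.simps(8))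
      (rule loop[unfolded seq.simps], simp add: ex)
qed (use k in \<open>auto simp: sketch_program_def norm_body_def\<close>)

section \<open>Mixed radix conversion and repeated addition\<close>

lemma weight_le_M: "j \<le> n \<Longrightarrow> weight d j \<le> M"
  using weight_le[of j] pow_le_M[of s] by simp

lemma dms_get:
  assumes "2 \<le> k" "j < n"
  shows "cmp (k - 1) 3 [int n, int (dms n), int j] (int (d j) - 1)"
  using get_ok[of "k - 1" "dms n" j] dms_less[of n] assms by (simp add: dec_dms)

lemma small_d: "j < n \<Longrightarrow> small b (int (d j) - 1)" "j < n \<Longrightarrow> small b (int (d j))"
  using d_le_M[of j] d_pos[of j] by (auto intro!: small_M)

lemma small_weight: "j \<le> n \<Longrightarrow> small b (int (weight d j))"
  using weight_le_M[of j] by (intro small_nat) simp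

lemma small_args:
  assumes "t \<le> M" "j < 3"
  shows "small b ([int n, int (dms n), int t] ! j)"
proof -
  have "small b (int t)" "small b (int (dms n))"
    using assms dms_less[of n] by (auto intro!: small_nat)
  then show ?thesis using assms small_le_n[of n] by (auto simp: less_Suc_eq numeral_eq_Suc)
qed

lemma unrank_ok:
  assumes k: "2 \<le> k" and t: "t < weight d n"
  shows "cmp k 16 [int n, int (dms n), int t] (int (code (unrank d t)))"
proof (rule procI[where l = 3 and c = unrank_body])
  let ?xs = "[int n, int (dms n), int t]"
  have "t \<le> M" using t weight_le_M[of n] by simp
  then show "small b (?xs ! j)" if "j < 3" for j using that by (rule small_args)
  have box: "box (unrank d t)" unfolding box_def unrank_def using d_pos by simp
  show "wp (cmp (k - 1)) (ext (k - 1)) b ?xs unrank_body (\<lambda>f. fst f 0 = int (code (unrank d t))) (loaded 3 ?xs (\<lambda>_. 0), \<lambda>_. 0)"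
  proof (unfold unrank_body_def seq.simps append.simps wp.simps(2-7) wp_Skip, intro conjI, goal_cases)
    case 2
    show ?case
    proof (rule wp_for[where N = n and J = "\<lambda>j r. r 1 = int n \<and> r 2 = int (dms n) \<and> r 3 = int t \<and>
        r 4 = int (weight d j) \<and> r 0 = int (vcode (n + 3) j (unrank d t))"], goal_cases)
      case (4 j r h)
      define u where "u = t div weight d j"
      define v where "v = u mod d j"
      have z: "int t div int (weight d j) = int u" "int u mod int (d j) = int v"
        by (simp_all add: u_def v_def zdiv_int zmod_int)
      have un: "unrank d t j = int v" by (simp add: unrank_def u_def v_def)
      have lt: "vcode (n + 3) (Suc j) (unrank d t) < M"
        using 4 by (intro lazy_code[OF box_lazy[OF box]]) simp
      have v: "v < d j" using d_pos[OF 4(1)] by (simp add: v_def)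
      have "u \<le> t" by (simp add: u_def)
      then have sm: "small b (int u)" "small b (int v)" "small b (int (vcode (n + 3) (Suc j) (unrank d t)))"
        "small b (int j + 1)"
        using v d_le_M[OF 4(1)] lt \<open>t \<le> M\<close> 4 small_le_n[of "Suc j"] small_nat[of u] small_nat[of v]
          small_nat[of "vcode (n + 3) (Suc j) (unrank d t)"]
        by (auto simp: add.commute)
      have p: "cmp (k - 1) 4 [int n, int (vcode (n + 3) j (unrank d t)), int j, int v]
          (int (vcode (n + 3) (Suc j) (unrank d t)))"
        using prep_ok[of "k - 1" "vcode (n + 3) j (unrank d t)" j "int v"] k 4 lt un v d_le_M[OF 4(1)] by simp
      have W: "int (weight d j) * int (d j) = int (weight d (Suc j))" by simp
      show ?case
        using 4 z sm W p small_d[OF 4(1)] small_weight[of "Suc j"]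
        by (simp del: vcode.simps weight_Suc, intro exC[OF dms_get[OF k 4(1)]], simp del: vcode.simps weight_Suc)
    qed (auto simp: loaded_def)
  qed simp
qed (use k in \<open>auto simp: sketch_program_def unrank_body_def\<close>)

lemma rank_ok:
  assumes k: "2 \<le> k" and v: "box v"
  shows "cmp k 17 [int n, int (dms n), int (code v)] (int (rank d n v))"
proof (rule procI[where l = 3 and c = rank_body])
  let ?xs = "[int n, int (dms n), int (code v)]"
  have lt: "code v < M" by (rule code_less[OF box_lazy[OF v]])
  show "small b (?xs ! j)" if "j < 3" for j using small_args lt that by (simp add: less_imp_le)
  show "wp (cmp (k - 1)) (ext (k - 1)) b ?xs rank_body (\<lambda>f. fst f 0 = int (rank d n v)) (loaded 3 ?xs (\<lambda>_. 0), \<lambda>_. 0)"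
  proof (unfold rank_body_def seq.simps append.simps wp.simps(2-7) wp_Skip, intro conjI, goal_cases)
    case 2
    show ?case
    proof (rule wp_for[where N = n and J = "\<lambda>j r. r 1 = int n \<and> r 2 = int (dms n) \<and> r 3 = int (code v) \<and>
        r 4 = int (weight d j) \<and> r 0 = int (rank d j v)"], goal_cases)
      case (4 j r h)
      have g: "cmp (k - 1) 3 [int n, int (code v), int j] (v j)"
        using get_ok[of "k - 1" "code v" j] k 4 lt by (simp add: dec_vcode)
      have vj: "0 \<le> v j" "v j < int (d j)" using v 4 by (auto simp: box_def)
      have "rank d (Suc j) v < weight d (Suc j)"
        by (rule rank_less) (use v 4 d_pos in \<open>auto simp: box_def\<close>)
      then have rl: "rank d (Suc j) v \<le> M" using weight_le_M[of "Suc j"] 4 by simp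
      have rS: "int (rank d j v) + v j * int (weight d j) = int (rank d (Suc j) v)" using vj by simp
      have "small b (int (rank d (Suc j) v))" using rl by (intro small_nat) simp
      \<comment> \<open>The product is a summand of the rank and inherits its bound.\<close>
      moreover have "small b (v j * int (weight d j))"
      proof (rule small_M)
        have "0 \<le> v j * int (weight d j)" using vj by simp
        then show "\<bar>v j * int (weight d j)\<bar> \<le> 8 * int M" using rS rl by linarith
      qed
      moreover have "small b (int j + 1)" using small_le_n[of "Suc j"] 4 by (simp add: add.commute)
      moreover have "small b (v j)" using vj d_le_M[OF 4(1)] by (intro small_M) simp
      moreover have W: "int (weight d j) * int (d j) = int (weight d (Suc j))" by simp
      ultimately show ?case
        using 4 rS small_d[OF 4(1)] small_weight[of "Suc j"]
        by (simp del: rank_Suc weight_Suc, intro exC[OF dms_get[OF k 4(1)]], simp del: rank_Suc weight_Suc,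
            intro exC[OF g], simp del: rank_Suc weight_Suc)
    qed (auto simp: loaded_def)
  qed simp
qed (use k in \<open>auto simp: sketch_program_def rank_body_def\<close>)

lemma weight_ok:
  assumes k: "2 \<le> k"
  shows "cmp k 18 [int n, int (dms n)] (int (weight d n))"
proof (rule procI[where l = 2 and c = weight_body])
  let ?xs = "[int n, int (dms n)]"
  show "small b (?xs ! j)" if "j < 2" for j
    using small_args[of 0 j] that by (auto simp: less_Suc_eq numeral_eq_Suc)
  show "wp (cmp (k - 1)) (ext (k - 1)) b ?xs weight_body (\<lambda>f. fst f 0 = int (weight d n)) (loaded 2 ?xs (\<lambda>_. 0), \<lambda>_. 0)"
  proof (unfold weight_body_def seq.simps append.simps wp.simps(2-7) wp_Skip, intro conjI, goal_cases)
    case 2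
    show ?case
    proof (rule wp_for[where N = n and J = "\<lambda>j r. r 1 = int n \<and> r 2 = int (dms n) \<and>
        r 0 = int (weight d j)"], goal_cases)
      case (4 j r h)
      have "small b (int j + 1)" using small_le_n[of "Suc j"] 4 by (simp add: add.commute)
      moreover have W: "int (weight d j) * int (d j) = int (weight d (Suc j))" by simp
      ultimately show ?case
        using 4 small_d[OF 4(1)] small_weight[of "Suc j"]
        by (simp del: weight_Suc, intro exC[OF dms_get[OF k 4(1)]], simp del: weight_Suc)
    qed (auto simp: loaded_def)
  qed simp
qed (use k in \<open>auto simp: sketch_program_def weight_body_def\<close>)

text \<open>Adding \<open>a\<close> at once could leave the lazy range; a single unit does not, so
  every unit is followed by a full reduction.\<close>

lemma addn_ok:
  assumes k: "8 \<le> k" and v: "box v" and i: "i < n" and a: "a < weight d n"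
  shows "cmp k 19 [int n, int M, int start, int (dms n), int (code v), int i, int a]
    (int (code (canon (\<lambda>j. v j + (if j = i then int a else 0)))))"
proof (rule procI[where l = 7 and c = addn_body])
  let ?xs = "[int n, int M, int start, int (dms n), int (code v), int i, int a]"
  let ?w = "\<lambda>m. canon (\<lambda>j. v j + (if j = i then int m else 0))"
  have am: "a \<le> M" using a weight_le_M[of n] by simp
  have lt: "code v < M" by (rule code_less[OF box_lazy[OF v]])
  have "small b (int (code v))" "small b (int (dms n))" "small b (int M)" "small b (int a)"
    using lt am dms_less[of n] by (auto intro!: small_nat)
  then show "small b (?xs ! j)" if "j < 7" for j
    using that small_reach[OF reach_start] small_le_n[of n] small_le_n[of i] i
    by (auto simp: less_Suc_eq numeral_eq_Suc)
  define e where "e = prep (n + 3) 0 i 1"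
  have dec_e: "dec n e j = (if j = i then 1 else 0)" for j
    unfolding dec_def e_def getv_prep[OF i] by (simp add: getv.simps)
  have "e < (n + 3) ^ (0 + nsym 1)" unfolding e_def by (rule prep_less[OF i]) simp
  also have "nsym 1 = 3" by (simp add: nsym_def binary.simps)
  then have "(n + 3) ^ (0 + nsym 1) \<le> M" unfolding M_def using s1 by (intro power_increasing) auto
  finally have e: "e < M" .
  have call1: "cmp (k - 1) 4 [int n, 0, int i, 1] (int e)"
    using prep_ok[of "k - 1" 0 i 1] k i e M_pos by (simp add: e_def)
  have "(\<lambda>j. v j + (if j = i then int 0 else 0)) = v" by auto
  \<comment> \<open>A vector of the box is its own representative below \<open>n\<close>, so the
    invariant holds before the first round.\<close>
  then have w0: "code (?w 0) = code v" using canon_box[OF v] by (auto intro: code_cong)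
  show "wp (cmp (k - 1)) (ext (k - 1)) b ?xs addn_body (\<lambda>f. fst f 0 = int (code (?w a))) (loaded 7 ?xs (\<lambda>_. 0), \<lambda>_. 0)"
    using small_nat[of "code v"] lt small_nat[of e] e
  proof (simp add: addn_body_def loaded_def del: wp.simps(8), intro exC[OF call1],
      simp del: wp.simps(8), goal_cases)
    case 1
    show ?case
    proof (rule wp_for[where N = a and J = "\<lambda>m r. r 1 = int n \<and> r 2 = int M \<and> r 3 = int start \<and>
        r 4 = int (dms n) \<and> r 7 = int a \<and> r 8 = int e \<and> r 0 = int (code (?w m))"], goal_cases)
      case 2
      show ?case using w0 by simp
    next
      case (4 m r h)
      define z where "z = (\<lambda>j. ?w m j + (if j = i then 1 else 0))"
      have z: "lazy i z" unfolding z_def by (rule lazy_incr[OF box_canon])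
      have "eqv z (\<lambda>j. v j + (if j = i then int (Suc m) else 0))"
        using eqv_add[OF eqv_sym[OF eqv_canon] eqv_refl[of "\<lambda>j. if j = i then 1 else 0"]]
        unfolding z_def by (rule eqv_cong) auto
      then have cz: "canon z = ?w (Suc m)" by (rule canon_eqv)
      have wl: "code (?w m) < M" by (rule code_less[OF box_lazy[OF box_canon]])
      have call2: "cmp (k - 1) 13 [int n, int (code (?w m)), - 1, int e, 0] (int (code z))"
        using axpy_ok[of "k - 1" "code (?w m)" e 0 "- 1" z] k wl e M_pos code_less[OF z]
        by (simp add: dec_vcode dec_e z_def)
      have call3: "cmp (k - 1) 15 [int n, int M, int start, int (dms n), int (code z)] (int (code (?w (Suc m))))"
        unfolding cz[symmetric] using k z by (intro norm_ok) auto
      have sm: "small b (int (code z))" "small b (int (code (?w (Suc m))))" "small b (int m + 1)"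
        using code_less[OF z] code_less[OF box_lazy[OF box_canon], of "\<lambda>j. v j + (if j = i then int (Suc m) else 0)"]
          4 am small_nat[of "Suc m"] small_nat[of "code z"] small_nat[of "code (?w (Suc m))"]
        by (simp_all only: le_less) (auto simp: add.commute)
      show ?case
        using 4 sm call3 by (simp, intro exC[OF call2], simp)
    qed (auto simp: loaded_def)
  qed
qed (use k in \<open>auto simp: sketch_program_def addn_body_def\<close>)

end

section \<open>The update and output procedures\<close>

lemma length_binary_ge: "k < 2 ^ length (binary k)"
proof (induction k rule: less_induct)
  case (less k)
  show ?case
  proof (cases "k = 0")
    case False
    then have b: "binary k = binary (k div 2) @ [int (k mod 2)]" by (subst binary.simps) simp
    have "k div 2 < 2 ^ length (binary (k div 2))" using False by (intro less) simp
    then show ?thesis unfolding b by simp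
  qed (simp add: binary.simps)
qed

text \<open>The result is left in register 0, whose digits belong to the charged memory. This bounds
  the outputs of the given post-processing function, whose values are otherwise arbitrary.\<close>

lemma computes_result_small:
  assumes "computes \<Omega> G p xs m y"
  shows "\<bar>y\<bar> < 2 ^ m"
proof -
  from assms obtain r h where rh: "mem (frame_regs (G ! p)) (fst fresh) \<le> m"
    "exec \<Omega> G (frame_regs (G ! p)) xs m (G ! p) fresh (r, h)" "r 0 = y"
    by (auto simp: computes_def)
  have "mem (frame_regs (G ! p)) r \<le> m" using exec_mem[OF rh(2,1)] by simp
  moreover have "Suc (length (tape (r 0))) \<le> mem (frame_regs (G ! p)) r"
    unfolding mem_def by (rule member_le_sum) (use finite_frame_regs[of "G ! p"] in \<open>auto simp: frame_regs_def\<close>)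
  ultimately have "length (binary (nat \<bar>y\<bar>)) \<le> m" using rh(3) by (simp add: tape_def)
  then have "(2::nat) ^ length (binary (nat \<bar>y\<bar>)) \<le> 2 ^ m" by (intro power_increasing) auto
  then have "nat \<bar>y\<bar> < 2 ^ m" using length_binary_ge[of "nat \<bar>y\<bar>"] by linarith
  then show ?thesis by (simp add: nat_less_iff)
qed

lemma wp_seq_append: "wp C E b xs (seq (cs @ ds)) = (\<lambda>Q. wp C E b xs (seq cs) (wp C E b xs (seq ds) Q))"
proof (induction cs)
  case (Cons c cs)
  have "wp C E b xs (Seq c d) = (\<lambda>Q. wp C E b xs c (wp C E b xs d Q))" for c d
    by (intro ext) simp
  with Cons show ?case by simp
qed simp

context sketch
begin

text \<open>Only the sketch survives between updates, so these three numbers are recomputed at every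
  update and at the output.\<close>

lemma prologue_wp:
  assumes k: "9 \<le> k" and r: "r 1 = int n" "r 2 = int s" "r 3 = int (initial A)"
    and Q: "\<And>r'. (\<And>i. i \<notin> {6, 7, 8} \<Longrightarrow> r' i = r i) \<Longrightarrow> r' 6 = int M \<Longrightarrow> r' 7 = int start \<Longrightarrow>
      r' 8 = int (dms n) \<Longrightarrow> Q (r', h)"
  shows "wp (cmp (k - 1)) (ext (k - 1)) b xs (seq prologue) Q (r, h)"
proof -
  have s2: "2 ^ s \<le> M" by (rule pow_le_M) simp
  have p1: "cmp (k - 1) 8 [int (n + 3), int (9 * s)] (int M)"
    unfolding M_def using k n_le_M s_le_M by (intro pow_ok) (auto simp: M_def)
  have p2: "cmp (k - 1) 8 [2, int s] (int (2 ^ s))"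
    using pow_ok[of "k - 1" 2 s] k s2 s_le_M M_ge by simp
  have p3: "cmp (k - 1) 9 [int n, int M, int (2 ^ s), int (initial A)] (int start)"
    using k by (intro start_ok) simp
  have p4: "cmp (k - 1) 12 [int n, int M, int start] (int (dms n))"
    using k by (intro dms_ok) simp
  have e: "int n + 3 = int (n + 3)" "int s * 9 = int (9 * s)" by simp_all
  have sm: "small b (int (n + 3))" "small b (int (9 * s))" "small b (int M)" "small b (int (2 ^ s))"
    "small b (int start)" "small b (int (dms n))"
    using n_le_M s_le_M s2 dms_less[of n] small_reach[OF reach_start]
    by (auto intro!: small_nat simp del: of_nat_add of_nat_mult of_nat_power)
  show ?thesis
    unfolding prologue_def
    using r sm
    by (simp add: e del: of_nat_add of_nat_mult of_nat_power, intro exC[OF p1],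
      simp del: of_nat_add of_nat_mult of_nat_power, intro exC[OF p2],
      simp del: of_nat_add of_nat_mult of_nat_power, intro exC[OF p3],
      simp del: of_nat_add of_nat_mult of_nat_power, intro exC[OF p4])
     (simp del: of_nat_add of_nat_mult of_nat_power, rule Q, auto)
qed

lemma mod_wp:
  assumes D: "0 < D" "D \<le> M" "r 9 = int D" and xs: "length xs = 6" "xs ! 5 = \<Delta>" and h: "h 5 = 0"
    and Q: "\<And>r' h'. (\<And>i. i \<notin> {10, 11} \<Longrightarrow> r' i = r i) \<Longrightarrow> r' 10 = \<Delta> mod int D \<Longrightarrow> Q (r', h')"
  shows "wp (cmp k) (ext k) b xs (seq mod_body) Q (r, h)"
proof -
  define bs where "bs = binary (nat \<bar>\<Delta>\<bar>)"
  define sg where "sg = (if \<Delta> < 0 then 1 else 0 :: nat)"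
  have tape: "tape \<Delta> = (if \<Delta> < 0 then [2] else []) @ bs" by (simp add: tape_def bs_def)
  have sym: "tape_at \<Delta> (sg + m + 1) = (if m < length bs then bs ! m else 3)" for m
    by (auto simp: tape_at_def tape sg_def)
  have len: "length (tape \<Delta>) = sg + length bs" by (simp add: tape sg_def)
  have bit: "m < length bs \<Longrightarrow> bs ! m = 0 \<or> bs ! m = 1" for m
    using subsetD[OF set_binary nth_mem[of m bs, unfolded bs_def]] by (simp add: bs_def)
  \<comment> \<open>Horner's rule modulo \<open>D\<close> on the digits read so far; intermediate
    values stay below \<open>2 * D\<close>.\<close>
  define H where "H m = foldl (\<lambda>a x. 2 * a + x) 0 (take m bs) mod int D" for m
  have HS: "H (Suc m) = (H m + H m + bs ! m) mod int D" if "m < length bs" for m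
  proof -
    let ?a = "foldl (\<lambda>a x. 2 * a + x) 0 (take m bs)"
    have "H (Suc m) = (2 * ?a + bs ! m) mod int D"
      using that by (simp add: H_def take_Suc_conv_app_nth)
    also have "\<dots> = (2 * (?a mod int D) + bs ! m) mod int D"
      by (metis mod_add_left_eq mod_mult_right_eq)
    also have "2 * (?a mod int D) + bs ! m = H m + H m + bs ! m" by (simp add: H_def)
    finally show ?thesis .
  qed
  have Hn: "H (length bs) = \<bar>\<Delta>\<bar> mod int D" by (simp add: H_def foldl_binary bs_def)
  have H: "0 \<le> H m" "H m < int D" for m using D by (simp_all add: H_def)
  have smH: "small b (H m)" "small b (H m + H m)" "small b (- H m)"
    "m' < length bs \<Longrightarrow> small b (H m + H m + bs ! m')" for m m'
    using H[of m] D(2) bit[of m'] M_ge by (auto intro!: small_M)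
  \<comment> \<open>Position 0 is the left blank and \<open>sg\<close> counts the minus sign, so
    with \<open>m\<close> digits read the head is at \<open>sg + m + 1\<close>.\<close>
  let ?I = "\<lambda>f :: frame. (\<forall>i. i \<notin> {10, 11} \<longrightarrow> fst f i = r i) \<and> fst f 11 = int sg \<and>
    (\<exists>m\<le>length bs. snd f 5 = sg + m + 1 \<and> fst f 10 = H m)"
  let ?fin = "Seq (Cond (Eq (Reg 11) (Num 1))
       (Seq (Assign 10 SubOp (Num 0) (Reg 10)) (Seq (Assign 10 ModOp (Reg 10) (Reg 9)) Skip)) Skip) Skip"
  have loop: "wp (cmp k) (ext k) b xs (While (Neg (Eq (Sym 5) (Num 3))) (seq [
       Assign 10 AddOp (Reg 10) (Reg 10),
       Assign 10 AddOp (Reg 10) (Sym 5),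
       Assign 10 ModOp (Reg 10) (Reg 9),
       MoveRight 5])) (wp (cmp k) (ext k) b xs ?fin Q) (r', h')" if "?I (r', h')" for r' h'
  proof (rule wp_While[where I = ?I and \<mu> = "\<lambda>f. sg + length bs + 1 - snd f 5"], goal_cases)
    case 1
    show ?case by (rule that)
  next
    case (2 r2 h2)
    then obtain m where m: "m \<le> length bs" "h2 5 = sg + m + 1" "r2 10 = H m" by auto
    have sy: "tape_at (xs ! 5) (h2 5) = (if m < length bs then bs ! m else 3)"
      unfolding xs m by (rule sym)
    then have lt: "m < length bs" using 2(2) xs by (auto split: if_splits)
    have sy: "tape_at \<Delta> (h2 5) = bs ! m" using sy lt xs by simp
    have r: "r2 9 = int D" "r2 11 = int sg" using 2(1) D(3) by auto
    have I: "\<forall>i. i \<noteq> 10 \<and> i \<noteq> 11 \<longrightarrow> r2 i = r i" using 2(1) by auto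
    have ex: "\<exists>m'\<le>length bs. min (h2 5) (length (tape \<Delta>)) = sg + m' \<and> H (Suc m) = H m'"
      using lt m(2) len by (intro exI[of _ "Suc m"]) auto
    have mi: "sg + length bs - min (h2 5) (length (tape \<Delta>)) < sg + length bs + 1 - h2 5"
      using lt m(2) len by auto
    show ?case
      using m(3) r I sy xs smH(1,2)[of m] smH(1)[of "Suc m"] smH(4)[OF lt, of m] HS[OF lt, symmetric]
      by simp (use ex mi in simp)
  next
    case (3 r1 h1)
    then obtain m where m: "m \<le> length bs" "h1 5 = sg + m + 1" "r1 10 = H m" by auto
    have sy: "tape_at (xs ! 5) (h1 5) = (if m < length bs then bs ! m else 3)"
      unfolding xs m by (rule sym)
    have "m = length bs" using 3(2) xs sy m(1) bit[of m] by (auto split: if_splits)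
    then have r10: "r1 10 = \<bar>\<Delta>\<bar> mod int D" using m Hn by simp
    have r: "r1 9 = int D" "r1 11 = int sg" "\<And>i. i \<notin> {10, 11} \<Longrightarrow> r1 i = r i" using 3(1) D(3) by auto
    have "0 \<le> \<Delta> mod int D" "\<Delta> mod int D < int D" using D by simp_all
    then have "small b (\<Delta> mod int D)" using D(2) by (intro small_M) linarith
    then have sm: "small b (- (\<bar>\<Delta>\<bar> mod int D))" "small b (\<Delta> mod int D)"
      using smH(3)[of "length bs"] unfolding Hn by simp_all
    show ?case
    proof (cases "\<Delta> < 0")
      case True
      have "(- (\<bar>\<Delta>\<bar> mod int D)) mod int D = \<Delta> mod int D" using True by (simp add: mod_minus_eq)
      with r(1,2) r10 sm True show ?thesis
        by (simp add: sg_def) (rule Q; simp add: r(3) r10)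
    next
      case False
      with r(2) show ?thesis
        by (simp add: sg_def) (rule Q; simp add: r(3) r10)
    qed
  qed
  show ?thesis
  proof (cases "\<Delta> < 0")
    case True
    have t: "tape_at \<Delta> 1 = 2" using True by (simp add: tape_at_def tape)
    have l: "1 \<le> length (tape \<Delta>)" using True by (simp add: len sg_def)
    show ?thesis
      unfolding mod_body_def
      by (simp add: xs h t t[unfolded One_nat_def] del: wp.simps(8) One_nat_def, rule loop[unfolded seq.simps])
        (use l True in \<open>auto simp: sg_def H_def intro!: exI[of _ 0]\<close>)
  next
    case False
    have t: "tape_at \<Delta> 1 \<noteq> 2" using sym[of 0] False bit[of 0] by (auto simp: sg_def)
    show ?thesis
      unfolding mod_body_def
      by (simp add: xs h t t[unfolded One_nat_def] del: wp.simps(8) One_nat_def, rule loop[unfolded seq.simps])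
        (use False in \<open>auto simp: sg_def H_def intro!: exI[of _ 0]\<close>)
  qed
qed

lemma phi_rank: "\<phi> x = rank d n (canon x)"
  by (rule phi_eq[OF box_canon eqv_canon])

lemma trans_ok:
  assumes k: "9 \<le> k" and i: "i < n"
  shows "cmp k 0 [int n, int s, int (initial A), int (\<phi> x), int i, \<Delta>]
    (int (\<phi> (\<lambda>j. x j + (if j = i then \<Delta> else 0))))"
proof (rule procI[where l = 0 and c = trans_body])
  let ?xs = "[int n, int s, int (initial A), int (\<phi> x), int i, \<Delta>]"
  let ?y = "\<phi> (\<lambda>j. x j + (if j = i then \<Delta> else 0))"
  define D where "D = weight d n"
  have D: "0 < D" "D \<le> M" using weight_pos[of n d] d_pos weight_le_M[of n] by (auto simp: D_def)
  define a where "a = nat (\<Delta> mod int D)"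
  have a: "\<Delta> mod int D = int a" "a < D" using D by (simp_all add: a_def nat_less_iff)
  let ?v = "\<lambda>j. canon x j + (if j = i then int a else 0)"
  have "eqv ?v (\<lambda>j. x j + (if j = i then \<Delta> else 0))"
    using eqv_add[OF eqv_sym[OF eqv_canon[of x]] eqv_sym[OF eqv_mod_weight[OF i, of \<Delta>]]]
    unfolding D_def[symmetric] a by simp
  then have y: "rank d n (canon ?v) = ?y" unfolding phi_rank[symmetric] by (rule phi_eqv)
  have ph: "\<phi> x \<le> M" using phi_less[of x] weight_le_M[of n] by simp
  \<comment> \<open>Tape 5 is excluded: \<open>\<Delta>\<close> may be longer than any register and
    is read only through its head.\<close>
  have pa: "small b (?xs ! j)" if "j < 5" for j
    using that small_reach[OF reach_initial] small_le_n[of n] small_le_n[of i] i small_nat[of s]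
      s_le_M small_nat[OF order_trans[OF ph]]
    by (auto simp: less_Suc_eq numeral_eq_Suc)
  have c1: "cmp (k - 1) 18 [int n, int (dms n)] (int D)"
    unfolding D_def using k by (intro weight_ok) simp
  have c2: "cmp (k - 1) 16 [int n, int (dms n), int (\<phi> x)] (int (code (canon x)))"
    unfolding canon_def using k phi_less by (intro unrank_ok) auto
  have c3: "cmp (k - 1) 19 [int n, int M, int start, int (dms n), int (code (canon x)), int i, int a]
      (int (code (canon ?v)))"
    using k i a box_canon by (intro addn_ok) (auto simp: D_def)
  have c4: "cmp (k - 1) 17 [int n, int (dms n), int (code (canon ?v))] (int ?y)"
    unfolding y[symmetric] using k box_canon by (intro rank_ok) auto
  have sm: "small b (int D)" "small b (int (code (canon x)))" "small b (int (code (canon ?v)))" "small b (int ?y)"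
  proof -
    have "code (canon z) \<le> 8 * M" for z using code_less[OF box_lazy[OF box_canon], of z] by simp
    moreover have "\<phi> z \<le> 8 * M" for z using phi_less_pow[of z] pow_le_M[of s] by simp
    ultimately show "small b (int D)" "small b (int (code (canon x)))" "small b (int (code (canon ?v)))"
      "small b (int ?y)" using D by (auto intro!: small_nat)
  qed
  let ?C = "cmp (k - 1)" and ?E = "ext (k - 1)"
  let ?Q = "\<lambda>f :: frame. fst f 0 = int ?y"
  have fin: "wp ?C ?E b ?xs (seq [
     Call 4 16 [Reg 1, Reg 8, Reg 4],
     Call 4 19 [Reg 1, Reg 6, Reg 7, Reg 8, Reg 4, Reg 5, Reg 10],
     Call 0 17 [Reg 1, Reg 8, Reg 4]]) ?Q (r, h)"
    if "r 1 = int n" "r 4 = int (\<phi> x)" "r 5 = int i" "r 6 = int M" "r 7 = int start" "r 8 = int (dms n)"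
      "r 10 = int a" for r h
    using that sm c4 by (simp, intro exC[OF c2], simp, intro exC[OF c3], simp)
  have "wp ?C ?E b ?xs (seq (prologue @ [Call 9 18 [Reg 1, Reg 8]] @ mod_body @ [
     Call 4 16 [Reg 1, Reg 8, Reg 4],
     Call 4 19 [Reg 1, Reg 6, Reg 7, Reg 8, Reg 4, Reg 5, Reg 10],
     Call 0 17 [Reg 1, Reg 8, Reg 4]])) ?Q (r, h)"
    if r: "r 1 = int n" "r 2 = int s" "r 3 = int (initial A)" "r 4 = int (\<phi> x)" "r 5 = int i" and h: "h 5 = 0"
    for r h
    unfolding wp_seq_append
  proof (rule prologue_wp[OF k r(1-3)], goal_cases)
    case (1 r1)
    note r1 = 1
    have r1': "r1 1 = int n" "r1 4 = int (\<phi> x)" "r1 5 = int i" using r1(1) r by auto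
    have "wp ?C ?E b ?xs (seq mod_body) (wp ?C ?E b ?xs (seq [
       Call 4 16 [Reg 1, Reg 8, Reg 4],
       Call 4 19 [Reg 1, Reg 6, Reg 7, Reg 8, Reg 4, Reg 5, Reg 10],
       Call 0 17 [Reg 1, Reg 8, Reg 4]]) ?Q) (r1(9 := int D), h)"
    proof (rule mod_wp[where \<Delta> = \<Delta>, OF D(1,2)], goal_cases)
      case (5 r2 h2)
      show ?case by (rule fin) (use 5 r1 r1' a in auto)
    qed (use h in auto)
    then show ?case
      using r1 r1' sm by (simp del: append.simps, intro exC[OF c1]) simp
  qed
  from this[of "loaded 5 ?xs ((\<lambda>_. 0)(2 := int s))" "\<lambda>_. 0"]
  have "wp ?C ?E b ?xs (Seq (loads 5) (seq (prologue @ [Call 9 18 [Reg 1, Reg 8]] @ mod_body @ [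
     Call 4 16 [Reg 1, Reg 8, Reg 4],
     Call 4 19 [Reg 1, Reg 6, Reg 7, Reg 8, Reg 4, Reg 5, Reg 10],
     Call 0 17 [Reg 1, Reg 8, Reg 4]]))) ?Q ((\<lambda>_. 0)(2 := int s), \<lambda>_. 0)"
    unfolding wp.simps(6) by (intro wp_loads pa) (auto simp: loaded_def)
  moreover have "small b (int s)" using pa[of 1] by simp
  moreover have "loaded 0 ?xs (\<lambda>_. 0) = (\<lambda>_. 0)" by (auto simp: loaded_def)
  ultimately show "wp ?C ?E b ?xs trans_body ?Q (loaded 0 ?xs (\<lambda>_. 0), \<lambda>_. 0)"
    unfolding trans_body_def using s1 by (simp del: seq.simps append.simps loads.simps wp.simps(6), simp add: wp.simps(6)[of _ _ _ _ "Load 2 1"] del: seq.simps append.simps loads.simps wp.simps(6))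
qed (use k in \<open>auto simp: sketch_program_def trans_body_def prologue_def mod_body_def com_regs_loads\<close>)

lemma ext_postproc:
  assumes "reach p"
  shows "ext k 1 [int p] (postproc A p)" "small b (postproc A p)"
proof -
  have c: "computes no_externals \<Gamma> 1 [int p] S (postproc A p)"
    using impl assms by (auto simp: implements_in_space_def reach_iff Let_def)
  then show "ext k 1 [int p] (postproc A p)" unfolding ext_def access_def by (auto elim: computes_mono)
  have "(2::int) ^ S \<le> 2 ^ b" using S_le_b by (intro power_increasing) auto
  with computes_result_small[OF c] show "small b (postproc A p)" unfolding small_def by linarith
qed

lemma post_ok:
  assumes k: "9 \<le> k"
  shows "cmp k 1 [int n, int s, int (initial A), int (\<phi> x)] (postproc A (walk start (code (canon x)) 1 n))"
proof (rule procI[where l = 0 and c = post_body])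
  let ?xs = "[int n, int s, int (initial A), int (\<phi> x)]"
  let ?p = "walk start (code (canon x)) 1 n"
  have ph: "\<phi> x \<le> M" using phi_less[of x] weight_le_M[of n] by simp
  have pa: "small b (?xs ! j)" if "j < 4" for j
    using that small_reach[OF reach_initial] small_le_n[of n] small_nat[of s]
      s_le_M small_nat[OF order_trans[OF ph]]
    by (auto simp: less_Suc_eq numeral_eq_Suc)
  have lt: "code (canon x) < M" by (rule code_less[OF box_lazy[OF box_canon]])
  have rp: "reach ?p" by (rule reach_walk[OF le_refl reach_start])
  have c2: "cmp (k - 1) 16 [int n, int (dms n), int (\<phi> x)] (int (code (canon x)))"
    unfolding canon_def using k phi_less by (intro unrank_ok) auto
  have c3: "cmp (k - 1) 5 [int n, int start, int (code (canon x)), 1] (int ?p)"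
    using k reach_start lt by (intro walk_ok) auto
  let ?C = "cmp (k - 1)" and ?E = "ext (k - 1)"
  let ?Q = "\<lambda>f :: frame. fst f 0 = postproc A ?p"
  let ?cs = "[Call 4 16 [Reg 1, Reg 8, Reg 4], Call 4 5 [Reg 1, Reg 7, Reg 4, Num 1], Query 0 1 [Reg 4]]"
  have "wp ?C ?E b ?xs (seq (prologue @ ?cs)) ?Q (r, h)"
    if r: "r 1 = int n" "r 2 = int s" "r 3 = int (initial A)" "r 4 = int (\<phi> x)" for r h
    unfolding wp_seq_append
  proof (rule prologue_wp[OF k r(1-3)], goal_cases)
    case (1 r1)
    have "r1 1 = int n" "r1 4 = int (\<phi> x)" using 1(1) r by auto
    then show ?case
      using 1(2-4) small_nat[of "code (canon x)"] lt small_reach[OF rp] ext_postproc[OF rp]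
      by (simp, intro exC[OF c2], simp, intro exC[OF c3], simp)
  qed
  from this[of "loaded 4 ?xs ((\<lambda>_. 0)(2 := int s))" "\<lambda>_. 0"]
  have "wp ?C ?E b ?xs (Seq (loads 4) (seq (prologue @ ?cs))) ?Q ((\<lambda>_. 0)(2 := int s), \<lambda>_. 0)"
    unfolding wp.simps(6) by (intro wp_loads pa) (auto simp: loaded_def)
  moreover have "small b (int s)" using pa[of 1] by simp
  moreover have "loaded 0 ?xs (\<lambda>_. 0) = (\<lambda>_. 0)" by (auto simp: loaded_def)
  ultimately show "wp ?C ?E b ?xs post_body ?Q (loaded 0 ?xs (\<lambda>_. 0), \<lambda>_. 0)"
    unfolding post_body_def using s1 by (simp del: seq.simps append.simps loads.simps wp.simps(6), simp add: wp.simps(6)[of _ _ _ _ "Load 2 1"] del: seq.simps append.simps loads.simps wp.simps(6))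
qed (use k in \<open>auto simp: sketch_program_def post_body_def prologue_def com_regs_loads\<close>)

lemma init_ok:
  assumes k: "1 \<le> k"
  shows "cmp k 2 xs 0"
  by (rule procI[where l = 0 and c = Skip])
    (use k in \<open>auto simp: sketch_program_def loaded_def\<close>)

end

subsection \<open>The sketching algorithm\<close>

text \<open>The assumptions say that equality under \<open>\<phi>\<close> is a congruence, so
  operations defined through chosen preimages are well defined on the image and make
  \<open>\<phi>\<close> a homomorphism.\<close>

lemma quotient_module:
  fixes \<phi> :: "int vec \<Rightarrow> nat"
  assumes add: "\<And>x x' y y'. {x, x', y, y'} \<subseteq> carrier_vec n \<Longrightarrow> \<phi> x = \<phi> x' \<Longrightarrow> \<phi> y = \<phi> y' \<Longrightarrow>
      \<phi> (x + y) = \<phi> (x' + y')"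
    and smult: "\<And>k x x'. {x, x'} \<subseteq> carrier_vec n \<Longrightarrow> \<phi> x = \<phi> x' \<Longrightarrow> \<phi> (k \<cdot>\<^sub>v x) = \<phi> (k \<cdot>\<^sub>v x')"
  shows "\<exists>M :: (int, nat) module. mod_hom (class_ring :: int ring) (module_vec TYPE(int) n) M \<phi>"
proof -
  let ?R = "class_ring :: int ring"
  let ?V = "carrier_vec n :: int vec set"
  define rep where "rep a = (SOME x. x \<in> ?V \<and> \<phi> x = a)" for a
  have rep: "rep (\<phi> x) \<in> ?V \<and> \<phi> (rep (\<phi> x)) = \<phi> x" if "x \<in> ?V" for x
    unfolding rep_def by (rule someI[of "\<lambda>y. y \<in> ?V \<and> \<phi> y = \<phi> x" x]) (use that in simp)
  define M :: "(int, nat) module" where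
    "M = \<lparr>carrier = \<phi> ` ?V, mult = (\<lambda>_ _. 0), one = 0, zero = \<phi> (0\<^sub>v n),
          add = (\<lambda>a b. \<phi> (rep a + rep b)), smult = (\<lambda>k a. \<phi> (k \<cdot>\<^sub>v rep a))\<rparr>"
  have M: "carrier M = \<phi> ` ?V" "\<zero>\<^bsub>M\<^esub> = \<phi> (0\<^sub>v n)" by (simp_all add: M_def)
  have add_M: "\<phi> x \<oplus>\<^bsub>M\<^esub> \<phi> y = \<phi> (x + y)" if "x \<in> ?V" "y \<in> ?V" for x y
    unfolding M_def using rep that by (simp, intro add) auto
  have smult_M: "k \<odot>\<^bsub>M\<^esub> \<phi> x = \<phi> (k \<cdot>\<^sub>v x)" if "x \<in> ?V" for k x
    unfolding M_def using rep that by (simp, intro smult) auto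
  have grp_V: "abelian_group (module_vec TYPE(int) n)"
  proof (rule abelian_groupI, goal_cases)
    case (6 x)
    then show ?case by (intro bexI[of _ "- x"]) (auto simp: module_vec_simps)
  qed (auto simp: module_vec_simps)
  have mod_V: "module ?R (module_vec TYPE(int) n)"
    by (rule moduleI)
      (auto simp: module_vec_simps grp_V class_cring.cring_axioms add_smult_distrib_vec
        smult_add_distrib_vec smult_smult_assoc)
  have grp_M: "abelian_group M"
  proof (rule abelian_groupI, goal_cases)
    case (6 a)
    then obtain x where x: "x \<in> ?V" "a = \<phi> x" by (auto simp: M)
    then show ?case by (intro bexI[of _ "\<phi> (- x)"]) (auto simp: M add_M)
  qed (auto simp: M add_M assoc_add_vec comm_add_vec)
  have mod_M: "module ?R M"
    by (rule moduleI)
      (auto simp: M add_M smult_M grp_M class_cring.cring_axioms add_smult_distrib_vec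
        smult_add_distrib_vec smult_smult_assoc)
  have "\<phi> \<in> LinearCombinations.module_hom ?R (module_vec TYPE(int) n) M"
    by (auto simp: LinearCombinations.module_hom_def module_vec_simps M add_M smult_M)
  then have "mod_hom ?R (module_vec TYPE(int) n) M \<phi>"
    using mod_V mod_M by (intro mod_hom.intro mod_hom_axioms.intro)
  then show ?thesis by blast
qed

context sketch
begin

definition sketch_alg :: stream_alg where
  "sketch_alg = \<lparr>initial = 0,
     transition = (\<lambda>t (i, \<Delta>). \<phi> (\<lambda>j. unrank d t j + (if j = i then \<Delta> else 0))),
     postproc = (\<lambda>t. postproc A (walk start (code (unrank d t)) 1 n))\<rparr>"

lemma transition_sketch:
  "transition sketch_alg (\<phi> x) (i, \<Delta>) = \<phi> (\<lambda>j. x j + (if j = i then \<Delta> else 0))"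
proof -
  have "eqv (unrank d (\<phi> x)) x" using phi_unrank[of x] eqv_sym by simp
  from phi_eqv[OF eqv_add[OF this eqv_refl[of "\<lambda>j. if j = i then \<Delta> else 0"]]]
  show ?thesis by (simp add: sketch_alg_def)
qed

lemma final_state_sketch: "final_state sketch_alg \<sigma> = \<phi> (fr \<sigma>)"
proof (induction \<sigma> rule: rev_induct)
  case Nil
  have "fr [] = (\<lambda>_. 0)" by (simp add: fun_eq_iff)
  then show ?case by (simp add: final_state_def sketch_alg_def phi_0)
next
  case (snoc u \<sigma>)
  obtain i \<Delta> where u: "u = (i, \<Delta>)" by force
  have "final_state sketch_alg (\<sigma> @ [u]) = \<phi> (\<lambda>j. fr \<sigma> j + (if j = i then \<Delta> else 0))"
    using snoc transition_sketch by (simp add: final_state_def u)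
  also have "(\<lambda>j. fr \<sigma> j + (if j = i then \<Delta> else 0)) = fr (\<sigma> @ [u])"
    by (auto simp: fun_eq_iff fr_append u)
  finally show ?case .
qed

lemma postproc_sketch:
  "postproc sketch_alg (\<phi> x) = postproc A (walk start (code (canon x)) 1 n)"
  by (simp add: sketch_alg_def canon_def)

text \<open>Loops at \<open>start\<close> supply the difference between \<open>x\<close> and its
  representative, and the final walk supplies the representative itself.\<close>

lemma path_canon: "path (initial A) x (walk start (code (canon x)) 1 n)"
proof -
  have "path start (\<lambda>j. x j - canon x j) start" by (rule eqv_path[OF eqv_canon])
  from path_trans[OF path_trans[OF path_start this] path_walk[of start 1 "code (canon x)"]]
  show ?thesis by (rule path_cong) (simp add: dec_vcode)
qed

text \<open>The given algorithm need not reach this state on \<open>\<sigma>\<close> itself.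
  Correctness on another stream with the same frequency vector is enough, because validity of an
  output depends on that vector alone.\<close>

lemma solves_sketch:
  assumes "solves n A P"
  shows "solves n sketch_alg P"
  unfolding solves_def
proof
  fix \<sigma> assume \<sigma>: "\<sigma> \<in> streams n"
  obtain \<tau> where \<tau>: "\<tau> \<in> streams n" "final_state A \<tau> = walk start (code (canon (fr \<sigma>))) 1 n"
    "\<forall>j<n. fr \<tau> j = fr \<sigma> j"
    using path_canon[of "fr \<sigma>"] by (auto simp: path_def final_state_def)
  have "freq n \<tau> = freq n \<sigma>"
    by (rule eq_vecI) (use \<tau>(3) in \<open>auto simp: freq_index carrier_vecD[OF freq_carrier]\<close>)
  with assms \<tau> show "(freq n \<sigma>, postproc sketch_alg (final_state sketch_alg \<sigma>)) \<in> P"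
    unfolding solves_def final_state_sketch postproc_sketch by metis
qed

lemma linear_sketch: "linear_sketching n sketch_alg"
proof -
  let ?\<phi> = "\<lambda>x :: int vec. \<phi> (\<lambda>j. x $ j)"
  have "\<exists>M :: (int, nat) module. mod_hom (class_ring :: int ring) (module_vec TYPE(int) n) M ?\<phi>"
  proof (rule quotient_module)
    fix x x' y y' :: "int vec"
    assume v: "{x, x', y, y'} \<subseteq> carrier_vec n" and "?\<phi> x = ?\<phi> x'" "?\<phi> y = ?\<phi> y'"
    then have "eqv (\<lambda>j. x $ j + y $ j) (\<lambda>j. x' $ j + y' $ j)"
      by (intro eqv_add) (simp_all add: phi_eq_iff)
    then have "eqv (\<lambda>j. (x + y) $ j) (\<lambda>j. (x' + y') $ j)" by (rule eqv_cong) (use v in auto)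
    then show "?\<phi> (x + y) = ?\<phi> (x' + y')" by (rule phi_eqv)
  next
    fix k and x x' :: "int vec"
    assume v: "{x, x'} \<subseteq> carrier_vec n" and "?\<phi> x = ?\<phi> x'"
    then have "eqv (\<lambda>j. k * x $ j) (\<lambda>j. k * x' $ j)" by (intro eqv_mult) (simp add: phi_eq_iff)
    then have "eqv (\<lambda>j. (k \<cdot>\<^sub>v x) $ j) (\<lambda>j. (k \<cdot>\<^sub>v x') $ j)" by (rule eqv_cong) (use v in auto)
    then show "?\<phi> (k \<cdot>\<^sub>v x) = ?\<phi> (k \<cdot>\<^sub>v x')" by (rule phi_eqv)
  qed
  moreover have "final_state sketch_alg \<sigma> = ?\<phi> (freq n \<sigma>)" for \<sigma>
    unfolding final_state_sketch by (intro phi_eqv eqv_cong[OF eqv_refl]) (auto simp: freq_index)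
  ultimately show ?thesis unfolding linear_sketching_def by blast
qed

lemma implements_sketch:
  "implements_in_space (access \<Gamma>) sketch_program [int n, int s, int (initial A)] n sketch_alg
     (9 * (14 * (b + 2)) + S)"
  unfolding implements_in_space_def Let_def final_state_sketch transition_sketch postproc_sketch
  using trans_ok[of 9, unfolded cmp_def] post_ok[of 9, unfolded cmp_def] by simp

lemma sketch_result:
  assumes "solves n A P" and S': "S' = 9 * (14 * (b + 2)) + S"
  shows "solves n sketch_alg P \<and> linear_sketching n sketch_alg \<and> space_between_updates n sketch_alg s \<and>
    implements_in_space (access \<Gamma>) sketch_program [int n, int s, int (initial A)] n sketch_alg S' \<and>
    computes (access \<Gamma>) sketch_program 2 [int n, int s, int (initial A)] S' (int (initial sketch_alg))"
  using solves_sketch[OF assms(1)] linear_sketch implements_sketch init_ok[of 9, unfolded cmp_def]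
    phi_less_pow S'
  by (auto simp: space_between_updates_def final_state_sketch) (auto simp: sketch_alg_def)

end

section \<open>Constants and the case s = 0\<close>

lemma log_bound:
  assumes "1 \<le> (n :: nat)"
  obtains l where "n + 3 \<le> 2 ^ l" "real l \<le> log 2 (real n) + 3"
proof
  let ?l = "nat \<lceil>log 2 (real (n + 3))\<rceil>"
  have pos: "0 \<le> log 2 (real (n + 3))" using assms by simp
  have "real (n + 3) = 2 powr log 2 (real (n + 3))" by simp
  also have "\<dots> \<le> 2 powr real ?l" by (intro powr_mono) (use pos in linarith)+
  also have "\<dots> = real (2 ^ ?l)" by (simp only: powr_realpow[OF zero_less_numeral] of_nat_power of_nat_numeral)
  finally show "n + 3 \<le> 2 ^ ?l" by (simp only: of_nat_le_iff)
  have "log 2 (real (n + 3)) \<le> log 2 (4 * real n)" using assms by simp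
  also have "\<dots> = 2 + log 2 (real n)"
    using assms log_mult[of 2 4 "real n"] log_pow_cancel[of 2 2] by simp
  finally show "real ?l \<le> log 2 (real n) + 3" using pos by linarith
qed

text \<open>With 0 as the only reachable state, the output there is valid for every stream. The
  program finds out by loading \<open>s\<close> alone, before anything that might exceed the
  budget.\<close>

lemma trivial_sketch:
  assumes P: "solves n A P" and space: "space_between_updates n A 0"
    and impl: "implements_in_space no_externals \<Gamma> [] n A S" and S': "S' = 14 * (S + 4) + S"
  shows "\<exists>B. solves n B P \<and> linear_sketching n B \<and> space_between_updates n B 0 \<and>
    implements_in_space (access \<Gamma>) sketch_program [int n, int 0, int (initial A)] n B S' \<and>
    computes (access \<Gamma>) sketch_program 2 [int n, int 0, int (initial A)] S' (int (initial B))"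
proof -
  define B :: stream_alg where
    "B = \<lparr>initial = 0, transition = (\<lambda>_ _. 0), postproc = (\<lambda>_. postproc A 0)\<rparr>"
  have A0: "final_state A \<sigma> = 0" if "\<sigma> \<in> streams n" for \<sigma>
    using space that by (auto simp: space_between_updates_def)
  have B0: "final_state B \<sigma> = 0" for \<sigma>
    unfolding final_state_def B_def by (induction \<sigma> rule: rev_induct) auto
  have post: "computes no_externals \<Gamma> 1 [0] S (postproc A 0)"
    using bspec[OF impl[unfolded implements_in_space_def Let_def] streams_Nil] A0[of "[]"] by simp
  let ?b = "S + 2"
  let ?C = "\<lambda>_ _ _. False" and ?E = "\<lambda>p as y. access \<Gamma> p as S y"
  have small: "small ?b 0" by (simp add: small_def)
  have y: "small ?b (postproc A 0)"
  proof -
    have "(2::int) ^ S \<le> 2 ^ ?b" by (intro power_increasing) auto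
    with computes_result_small[OF post] show ?thesis unfolding small_def by linarith
  qed
  have l0: "loaded 0 xs r = r" for xs r by (auto simp: loaded_def)
  have len: "length sketch_program = 20" by (simp add: sketch_program_def)
  have trans: "computes (access \<Gamma>) sketch_program 0 [int n, 0, x, q, i, \<Delta>] S' 0" for x q i \<Delta>
  proof (rule computesI[where C = ?C and E = ?E and b = ?b and R = 14 and m' = S and k = 0])
    show "wp ?C ?E ?b [int n, 0, x, q, i, \<Delta>] trans_body (\<lambda>f. fst f 0 = 0) (loaded 0 [int n, 0, x, q, i, \<Delta>] (\<lambda>_. 0), \<lambda>_. 0)"
      unfolding trans_body_def l0 using small by simp
  qed (auto simp: len S' sketch_program_def trans_body_def prologue_def mod_body_def com_regs_loads)
  have postB: "computes (access \<Gamma>) sketch_program 1 [int n, 0, x, q] S' (postproc A 0)" for x q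
  proof (rule computesI[where C = ?C and E = ?E and b = ?b and R = 14 and m' = S and k = 0])
    have "access \<Gamma> 1 [0] S (postproc A 0)" using post by (simp add: access_def)
    then show "wp ?C ?E ?b [int n, 0, x, q] post_body (\<lambda>f. fst f 0 = postproc A 0) (loaded 0 [int n, 0, x, q] (\<lambda>_. 0), \<lambda>_. 0)"
      unfolding post_body_def l0 using small y by simp
  qed (auto simp: len S' sketch_program_def post_body_def prologue_def com_regs_loads)
  have init: "computes (access \<Gamma>) sketch_program 2 xs S' 0" for xs
    by (rule computesI[where C = ?C and E = ?E and b = ?b and R = 14 and m' = S and k = 0 and c = Skip])
      (auto simp: len S' sketch_program_def l0)
  have "\<exists>M :: (int, nat) module. mod_hom (class_ring :: int ring) (module_vec TYPE(int) n) M (\<lambda>_. 0)"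
    by (rule quotient_module) simp_all
  then have "linear_sketching n B" unfolding linear_sketching_def using B0 by blast
  moreover have "solves n B P" using P A0 B0 by (auto simp: solves_def B_def)
  moreover have "space_between_updates n B 0" by (simp add: space_between_updates_def B0)
  moreover have "implements_in_space (access \<Gamma>) sketch_program [int n, int 0, int (initial A)] n B S'"
    using trans postB by (auto simp: implements_in_space_def B0) (auto simp: B_def)
  moreover have "computes (access \<Gamma>) sketch_program 2 [int n, int 0, int (initial A)] S' (int (initial B))"
    using init by (simp add: B_def)
  ultimately show ?thesis by blast
qed

text \<open>Register 0 alone takes a cell, so additive constants can be charged to
  \<open>S\<close>.\<close>

lemma space_pos: "implements_in_space \<Omega> \<Gamma> ps n A S \<Longrightarrow> 1 \<le> S"
proof -
  assume "implements_in_space \<Omega> \<Gamma> ps n A S"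
  then have "mem (frame_regs (\<Gamma> ! 1)) (fst fresh) \<le> S"
    by (auto simp: implements_in_space_def Let_def computes_def dest!: bspec[OF _ streams_Nil])
  moreover have "Suc (length (tape (fst fresh 0))) \<le> mem (frame_regs (\<Gamma> ! 1)) (fst fresh)"
    unfolding mem_def by (rule member_le_sum) (use finite_frame_regs[of "\<Gamma> ! 1"] in \<open>auto simp: frame_regs_def\<close>)
  ultimately show ?thesis by linarith
qed

theorem theorem2:
  shows "\<exists>(\<Theta> :: com list) (c :: real). \<forall>(n :: nat) (P :: (int vec \<times> int) set)
           (A :: stream_alg) (\<Gamma> :: com list) (S :: nat) (s :: nat).
     n \<ge> 1 \<and> data_stream_problem n P \<and> solves n A P \<and>
     space_between_updates n A s \<and> s \<le> S \<and> implements_in_space no_externals \<Gamma> [] n A S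
     \<longrightarrow> (\<exists>(B :: stream_alg) (S' :: nat).
            solves n B P \<and> linear_sketching n B \<and> space_between_updates n B s \<and>
            s \<le> S' \<and> real S' \<le> c * (real S + real s * log 2 (real n)) \<and>
            implements_in_space (access \<Gamma>) \<Theta> [int n, int s, int (initial A)] n B S' \<and>
            computes (access \<Gamma>) \<Theta> 2 [int n, int s, int (initial A)] S' (int (initial B)))"
proof (intro exI[of _ sketch_program] exI[of _ "15000 :: real"] allI impI, elim conjE)
  fix n P A \<Gamma> S s
  assume n: "1 \<le> n" and P: "solves n A P" and space: "space_between_updates n A s"
    and sS: "s \<le> S" and impl: "implements_in_space no_externals \<Gamma> [] n A S"
  have S1: "1 \<le> S" by (rule space_pos[OF impl])
  have log0: "0 \<le> log 2 (real n)" using n by simp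
  show "\<exists>B S'. solves n B P \<and> linear_sketching n B \<and> space_between_updates n B s \<and>
            s \<le> S' \<and> real S' \<le> 15000 * (real S + real s * log 2 (real n)) \<and>
            implements_in_space (access \<Gamma>) sketch_program [int n, int s, int (initial A)] n B S' \<and>
            computes (access \<Gamma>) sketch_program 2 [int n, int s, int (initial A)] S' (int (initial B))"
  proof (cases "s = 0")
    case True
    define S' where "S' = 14 * (S + 4) + S"
    have "real S' \<le> 15000 * (real S + real s * log 2 (real n))"
      using S1 True by (simp add: S'_def)
    moreover have "s \<le> S'" using True by simp
    ultimately show ?thesis
      using trivial_sketch[OF P space[unfolded True] impl S'_def] True by (metis (no_types, lifting))
  next
    case False
    obtain l where l: "n + 3 \<le> 2 ^ l" "real l \<le> log 2 (real n) + 3" using log_bound[OF n] .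
    \<comment> \<open>The first summand makes room for \<open>M ^ 4 = (n + 3) ^ (36 * s)\<close>,
      the second for the outputs.\<close>
    define b where "b = 36 * l * s + S"
    define S' where "S' = 9 * (14 * (b + 2)) + S"
    interpret automaton n s A by unfold_locales (use n False space in auto)
    have "M ^ 4 = (n + 3) ^ (36 * s)" by (simp add: M_def power_mult[symmetric])
    also have "\<dots> \<le> (2 ^ l) ^ (36 * s)" using l(1) by (rule power_mono) simp
    also have "\<dots> = 2 ^ (36 * l * s)" by (simp add: power_mult[symmetric] ac_simps)
    also have "\<dots> \<le> 2 ^ b" unfolding b_def by (intro power_increasing) auto
    finally interpret sketch n s A \<Gamma> S b
      by unfold_locales (use impl in \<open>auto simp: b_def\<close>)
    have "real l * real s \<le> (log 2 (real n) + 3) * real s" using l(2) by (intro mult_right_mono) auto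
    \<comment> \<open>Here \<open>4536 = 9 * 14 * 36\<close>. With \<open>s \<le> S\<close> and
      \<open>1 \<le> S\<close> the last three terms are at most \<open>13987 * S\<close>, so 15000
      covers both parts.\<close>
    then have "real S' \<le> 4536 * (real s * log 2 (real n)) + 13608 * real s + 127 * real S + 252"
      by (simp add: S'_def b_def algebra_simps)
    moreover have "0 \<le> real s * log 2 (real n)" using log0 by simp
    ultimately have "real S' \<le> 15000 * (real S + real s * log 2 (real n))"
      using sS S1 by (simp add: algebra_simps)
    moreover have "s \<le> S'" using sS by (simp add: S'_def)
    ultimately show ?thesis using sketch_result[OF P S'_def] by blast
  qed
qed

end
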